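(* Fix a prime power $q$ and $n\ge1$. Suppose that for every composition $\alpha$ of $n$ and every integer $m\ge0$, $$\mathrm{Hilb}\bigl((S/(x_1^{q^m},\dots,x_n^{q^m}))^{P_\alpha},t\bigr)=C_{\alpha,m}(t).$$ Then for every composition $\alpha$ of $n$, every $m\ge1$ and every field $k\supseteq\mathbb{F}_{q^m}$ one has a $kC$-module isomorphism of $P_\alpha$-fixed spaces $$Q_k^{P_\alpha}\cong k[\mathbb{F}_{q^m}^n]^{P_\alpha},\qquad C=\mathbb{F}_{q^m}^\times.$$
   Context: $S=\mathbb{F}_q[x_1,\dots,x_n]$ with standard grading; $g=(g_{ij})\in G=GL_n(\mathbb{F}_q)$ acts on $S$ by algebra automorphisms $x_j\mapsto\sum_i g_{ij}x_i$, preserving $(x_1^{q^m},\dots,x_n^{q^m})$. A composition $\alpha=(\alpha_1,\dots,\alpha_\ell)$ of $n$ has positive integer parts summing to $n$; $P_\alpha\subset G$ is the group of block upper-triangular invertible matrices with diagonal blocks of sizes $\alpha_1,\dots,\alpha_\ell$. $\mathrm{Hilb}(U,t)=\sum_d\dim(U_d)t^d$. For a field $k\supseteq\mathbb{F}_{q^m}$: $Q_k=k[x_1,\dots,x_n]/(x_1^{q^m},\dots,x_n^{q^m})$ with $G$ acting $k$-linearly by the same substitutions and $\gamma\in C$ acting by the algebra automorphism $x_i\mapsto\gamma x_i$ for all $i$; $k[\mathbb{F}_{q^m}^n]$ is the $k$-vector space with basis $\{e_v:v\in\mathbb{F}_{q^m}^n\}$, with $g(e_v)=e_{gv}$, $(gv)_i=\sum_j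 g_{ij}v_j$, and $\gamma(e_v)=e_{\gamma v}$ for $\gamma\in C$. The actions of $G$ and $C$ commute. The polynomial $C_{\alpha,m}(t)$ is $$C_{\alpha,m}(t)=\sum_{\substack{\beta\le\alpha\\|\beta|\le m}}t^{\sum_{i=1}^\ell(\alpha_i-\beta_i)(q^m-q^{B_i})}\ \frac{\prod_{j=0}^{|\beta|-1}(1-t^{q^m-q^j})}{\prod_{i=1}^{\ell}\prod_{j=0}^{\beta_i-1}\bigl(1-t^{q^{B_i}-q^{B_{i-1}+j}}\bigr)},$$ the sum being over weak compositions $\beta=(\beta_1,\dots,\beta_\ell)$ (nonnegative integers) with $\beta_i\le\alpha_i$ for all $i$ and $|\beta|=\sum_i\beta_i\le m$, where $B_i=\beta_1+\cdots+\beta_i$, $B_0=0$. *)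

theory Defs
  imports
    "Jordan_Normal_Form.VS_Connect"
    "HOL-Algebra.Subrings"
    "HOL-Algebra.QuotRing"
    "HOL-Library.Poly_Mapping"
    "HOL-Computational_Algebra.Formal_Power_Series"
begin

text \<open>
  Multivariate polynomials are finitely supported maps from monomials (exponent vectors)
  to coefficients. All indices start at 0: the variables are \<open>x\<^sub>0, \<dots>, x\<^sub>n\<^sub>-\<^sub>1\<close>, matrices and
  vectors are those of \<open>Jordan_Normal_Form\<close>, and the parts of a composition are the entries
  \<open>\<alpha> ! 0, \<dots>, \<alpha> ! (l - 1)\<close> of a list. The finite field with \<open>q\<close> elements is a finite type
  of class \<open>field\<close>.
\<close>

type_synonym 'a mpoly = "(nat \<Rightarrow>\<^sub>0 nat) \<Rightarrow>\<^sub>0 'a"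

definition Const :: "'a::comm_ring_1 \<Rightarrow> 'a mpoly" where
  "Const c = Poly_Mapping.single 0 c"

definition Var :: "nat \<Rightarrow> 'a::comm_ring_1 mpoly" where
  "Var i = Poly_Mapping.single (Poly_Mapping.single i 1) 1"

definition mpoly_ring :: "nat \<Rightarrow> 'a::comm_ring_1 mpoly ring" where
  "mpoly_ring n =
     \<lparr>carrier = {p. \<forall>\<mu>\<in>Poly_Mapping.keys p. Poly_Mapping.keys \<mu> \<subseteq> {..<n}},
      monoid.mult = (*), one = 1, zero = 0, add = (+)\<rparr>"

definition homogeneous :: "nat \<Rightarrow> 'a::comm_ring_1 mpoly \<Rightarrow> bool" where
  "homogeneous d p \<longleftrightarrow>
     (\<forall>\<mu>\<in>Poly_Mapping.keys p. (\<Sum>i\<in>Poly_Mapping.keys \<mu>. Poly_Mapping.lookup \<mu> i) = d)"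

text \<open>The algebra endomorphism \<open>x\<^sub>j \<mapsto> f j\<close>:\<close>

definition poly_subst :: "(nat \<Rightarrow> 'a mpoly) \<Rightarrow> 'a::comm_ring_1 mpoly \<Rightarrow> 'a mpoly" where
  "poly_subst f p =
     (\<Sum>\<mu>\<in>Poly_Mapping.keys p. Const (Poly_Mapping.lookup p \<mu>) *
        (\<Prod>j\<in>Poly_Mapping.keys \<mu>. f j ^ Poly_Mapping.lookup \<mu> j))"

definition mat_subst :: "'a::comm_ring_1 mat \<Rightarrow> 'a mpoly \<Rightarrow> 'a mpoly" where
  "mat_subst g = poly_subst (\<lambda>j. \<Sum>i<dim_row g. Const (g $$ (i, j)) * Var i)"

definition scalar_subst :: "'a::comm_ring_1 \<Rightarrow> 'a mpoly \<Rightarrow> 'a mpoly" where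
  "scalar_subst \<gamma> = poly_subst (\<lambda>i. Const \<gamma> * Var i)"


text \<open>The quotient by the ideal of the \<open>x\<^sub>i\<^sup>N\<close>, as a vector space; elements are cosets.\<close>

definition power_ideal :: "nat \<Rightarrow> nat \<Rightarrow> 'a::comm_ring_1 mpoly set" where
  "power_ideal n N = genideal (mpoly_ring n) {Var i ^ N | i. i < n}"

definition coset :: "nat \<Rightarrow> nat \<Rightarrow> 'a::comm_ring_1 mpoly \<Rightarrow> 'a mpoly set" where
  "coset n N p = power_ideal n N +>\<^bsub>mpoly_ring n\<^esub> p"

definition trunc_module :: "nat \<Rightarrow> nat \<Rightarrow> ('a::comm_ring_1, 'a mpoly set) module" where
  "trunc_module n N = (let Q = mpoly_ring n Quot power_ideal n N in
     \<lparr>carrier = carrier Q, monoid.mult = monoid.mult Q, one = one Q, zero = zero Q, add = add Q,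
      smult = (\<lambda>c X. coset n N (Const c) \<otimes>\<^bsub>Q\<^esub> X)\<rparr>)"

text \<open>
  The substitutions used below are algebra automorphisms \<open>\<sigma>\<close> of the polynomial ring that map
  the ideal onto itself, so the induced map \<open>p + I \<mapsto> \<sigma> p + I\<close> on cosets is the direct image
  under \<open>\<sigma>\<close>.
\<close>

definition trunc_mat_act :: "'a::comm_ring_1 mat \<Rightarrow> 'a mpoly set \<Rightarrow> 'a mpoly set" where
  "trunc_mat_act g X = mat_subst g ` X"

definition trunc_scalar_act :: "'a::comm_ring_1 \<Rightarrow> 'a mpoly set \<Rightarrow> 'a mpoly set" where
  "trunc_scalar_act \<gamma> X = scalar_subst \<gamma> ` X"

definition fixed_module ::
  "'g set \<Rightarrow> ('g \<Rightarrow> 'v \<Rightarrow> 'v) \<Rightarrow> ('k, 'v) module \<Rightarrow> ('k, 'v) module" where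
  "fixed_module H act M = M\<lparr>carrier := {x \<in> carrier M. \<forall>h\<in>H. act h x = x}\<rparr>"


definition composition :: "nat \<Rightarrow> nat list \<Rightarrow> bool" where
  "composition n \<alpha> \<longleftrightarrow> (\<forall>a\<in>set \<alpha>. 0 < a) \<and> sum_list \<alpha> = n"

definition partial_sum :: "nat list \<Rightarrow> nat \<Rightarrow> nat" where
  "partial_sum \<beta> i = sum_list (take i \<beta>)"

text \<open>
  An entry lies below the block diagonal iff some block boundary \<open>s\<close> separates its column
  index \<open>j < s\<close> from its row index \<open>s \<le> i\<close>.
\<close>

definition parabolic :: "nat list \<Rightarrow> 'a::field mat set" where
  "parabolic \<alpha> = {g \<in> carrier_mat (sum_list \<alpha>) (sum_list \<alpha>). invertible_mat g \<and>
     (\<forall>b<length \<alpha>. \<forall>i<sum_list \<alpha>. \<forall>j<sum_list \<alpha>.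
        j < partial_sum \<alpha> b \<and> partial_sum \<alpha> b \<le> i \<longrightarrow> g $$ (i, j) = 0)}"

text \<open>
  The degree \<open>d\<close> component of a subspace \<open>U\<close> of the quotient consists of the elements of \<open>U\<close>
  that are classes of homogeneous polynomials of degree \<open>d\<close>.
\<close>

definition graded_part ::
  "nat \<Rightarrow> nat \<Rightarrow> ('a::field, 'a mpoly set) module \<Rightarrow> nat \<Rightarrow> ('a, 'a mpoly set) module" where
  "graded_part n N U d =
     U\<lparr>carrier := {X \<in> carrier U. \<exists>p\<in>carrier (mpoly_ring n). homogeneous d p \<and> X = coset n N p}\<rparr>"

definition Hilb :: "nat \<Rightarrow> nat \<Rightarrow> ('a::field, 'a mpoly set) module \<Rightarrow> rat fps" where
  "Hilb n N U = Abs_fps (\<lambda>d. of_nat (vectorspace.dim class_ring (graded_part n N U d)))"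

text \<open>
  In \<open>rat fps\<close> every denominator below has constant coefficient 1, so the division is exact.
  The natural-number subtractions do not truncate, because \<open>\<beta>\<^sub>i \<le> \<alpha>\<^sub>i\<close> and the sum of \<open>\<beta>\<close> is
  at most \<open>m\<close>. With 0-based part indices, \<open>B\<^sub>i\<close> and \<open>B\<^sub>i\<^sub>-\<^sub>1\<close> become \<open>partial_sum \<beta> (Suc i)\<close>
  and \<open>partial_sum \<beta> i\<close>.
\<close>

definition C_series :: "nat \<Rightarrow> nat list \<Rightarrow> nat \<Rightarrow> rat fps" where
  "C_series q \<alpha> m =
     (\<Sum>\<beta> | length \<beta> = length \<alpha> \<and> (\<forall>i<length \<alpha>. \<beta> ! i \<le> \<alpha> ! i) \<and> sum_list \<beta> \<le> m.
        fps_X ^ (\<Sum>i<length \<alpha>. (\<alpha> ! i - \<beta> ! i) * (q ^ m - q ^ partial_sum \<beta> (Suc i))) *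
        ((\<Prod>j<sum_list \<beta>. 1 - fps_X ^ (q ^ m - q ^ j)) /
         (\<Prod>i<length \<alpha>. \<Prod>j<\<beta> ! i.
            1 - fps_X ^ (q ^ partial_sum \<beta> (Suc i) - q ^ (partial_sum \<beta> i + j)))))"


text \<open>
  The vector space with basis \<open>e\<^sub>v\<close>, \<open>v \<in> E\<^sup>n\<close>, for a subset \<open>E\<close> of the ground field; \<open>e\<^sub>v\<close> is
  \<open>Poly_Mapping.single v 1\<close>.
\<close>

definition perm_module :: "nat \<Rightarrow> 'k set \<Rightarrow> ('k::field, 'k vec \<Rightarrow>\<^sub>0 'k) module" where
  "perm_module n E =
     \<lparr>carrier = {f. Poly_Mapping.keys f \<subseteq> {v \<in> carrier_vec n. \<forall>i<n. v $ i \<in> E}},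
      monoid.mult = undefined, one = undefined, zero = 0, add = (+),
      smult = (\<lambda>c. Poly_Mapping.map ((*) c))\<rparr>"

text \<open>The linear extension of \<open>e\<^sub>v \<mapsto> e\<^bsub>h v\<^esub>\<close>:\<close>

definition push :: "('b \<Rightarrow> 'b) \<Rightarrow> ('b \<Rightarrow>\<^sub>0 'k) \<Rightarrow> ('b \<Rightarrow>\<^sub>0 'k::comm_monoid_add)" where
  "push h f = (\<Sum>v\<in>Poly_Mapping.keys f. Poly_Mapping.single (h v) (Poly_Mapping.lookup f v))"

definition perm_mat_act :: "'k::field mat \<Rightarrow> ('k vec \<Rightarrow>\<^sub>0 'k) \<Rightarrow> ('k vec \<Rightarrow>\<^sub>0 'k)" where
  "perm_mat_act g = push (\<lambda>v. g *\<^sub>v v)"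

definition perm_scalar_act :: "'k::field \<Rightarrow> ('k vec \<Rightarrow>\<^sub>0 'k) \<Rightarrow> ('k vec \<Rightarrow>\<^sub>0 'k)" where
  "perm_scalar_act \<gamma> = push (\<lambda>v. \<gamma> \<cdot>\<^sub>v v)"

text \<open>
  A module over the group algebra of \<open>C\<close> is given by a vector space with a linear action of
  \<open>C\<close>; an isomorphism is a bijective linear map commuting with the action.
\<close>

definition group_module_iso ::
  "'c set \<Rightarrow> ('k::field, 'v) module \<Rightarrow> ('c \<Rightarrow> 'v \<Rightarrow> 'v) \<Rightarrow>
     ('k, 'w) module \<Rightarrow> ('c \<Rightarrow> 'w \<Rightarrow> 'w) \<Rightarrow> bool" where
  "group_module_iso C V actV W actW \<longleftrightarrow>
     (\<exists>\<phi>. linear_map class_ring V W \<phi> \<and> bij_betw \<phi> (carrier V) (carrier W) \<and>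
        (\<forall>\<gamma>\<in>C. \<forall>x\<in>carrier V. \<phi> (actV \<gamma> x) = actW \<gamma> (\<phi> x)))"

end

theory Submission
  imports Defs
    "HOL-Computational_Algebra.Polynomial_FPS"
    "HOL-Algebra.Multiplicative_Group"
begin

text \<open>
  The group \<open>C\<close> is cyclic of order \<open>N = q\<^sup>m - 1\<close>, which is invertible in \<open>k\<close>, so both modules are
  sums of eigenspaces for the characters \<open>\<gamma> \<mapsto> \<gamma>\<^sup>r\<close>, and it suffices to compare the dimensions for
  each \<open>r\<close> modulo \<open>N\<close>. By Fourier inversion this may be done by evaluating generating functions at
  the complex roots of unity \<open>\<omega>\<^sup>j\<close> of order dividing \<open>N\<close>.

  On the polynomial side, \<open>\<gamma>\<close> acts in degree \<open>r\<close> by \<open>\<gamma>\<^sup>r\<close>. The invariants are cut out by linear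
  equations over the small field, so their dimensions do not change under extension to \<open>k\<close>, and by
  hypothesis the generating function takes the value \<open>C\<^sub>\<alpha>\<^sub>,\<^sub>m(\<omega>\<^sup>j)\<close>. On the permutation side one obtains the number of
  orbits of the parabolic group that are fixed by \<open>g\<^sup>j\<close>, where \<open>g\<close> generates \<open>C\<close>. An orbit is
  determined by the flag of the spans of the final blocks of its vectors, so the fixed orbits are the
  flags of subspaces over \<open>L = F\<^sub>q(g\<^sup>j)\<close>.

  Let \<open>L\<close> have \<open>q\<^sup>d\<close> elements. In \<open>C\<^sub>\<alpha>\<^sub>,\<^sub>m\<close>, the summand of \<open>\<beta>\<close> has a zero at \<open>\<omega>\<^sup>j\<close> unless \<open>d\<close> divides
  every \<open>\<beta>\<^sub>i\<close>, and otherwise its limit is the number of flags over \<open>L\<close> of type \<open>\<beta>/d\<close>.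
\<close>

section \<open>Coordinates on vector spaces\<close>

text \<open>A vector is read as a list of \<open>n\<close> elements of the field with
  \<open>q^m\<close> elements. A block upper-triangular matrix over the small field replaces each
  entry by a combination of the entries from its own block onwards, so the spans of the final
  segments survive. That they form a complete invariant is a counting argument: at every step there
  are more admissible matrix rows than dependent ones.

  The obstacle on the other side is that numerators and denominators of the series may both vanish
  at a root of unity, so values exist only as limits. The number of numerator factors vanishing at
  \<open>w\<close> is |\<beta>| / d rounded up; for the denominator it is the sum of the parts of
  \<beta>, each divided by \<open>d\<close> and rounded down. The two agree exactly if
  \<open>d\<close> divides every part. Then the factors that do not vanish cancel in pairs, and
  those that vanish leave quotients of exponents, whose product is a flag count.

  Flags are built from the last block upwards while the series lists \<beta> from the first block;
  the count of flags does not change under reversal of the type.\<close>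

definition coordinates :: "('k::field, 'v) module \<Rightarrow> 'j set \<Rightarrow> ('v \<Rightarrow> 'j \<Rightarrow> 'k) \<Rightarrow> bool" where
  "coordinates V J co \<longleftrightarrow> finite J \<and> bij_betw co (carrier V) (J \<rightarrow>\<^sub>E UNIV) \<and>
     \<zero>\<^bsub>V\<^esub> \<in> carrier V \<and> (\<forall>j\<in>J. co \<zero>\<^bsub>V\<^esub> j = 0) \<and>
     (\<forall>x\<in>carrier V. \<forall>y\<in>carrier V. x \<oplus>\<^bsub>V\<^esub> y \<in> carrier V \<and>
        (\<forall>j\<in>J. co (x \<oplus>\<^bsub>V\<^esub> y) j = co x j + co y j)) \<and>
     (\<forall>c. \<forall>x\<in>carrier V. c \<odot>\<^bsub>V\<^esub> x \<in> carrier V \<and> (\<forall>j\<in>J. co (c \<odot>\<^bsub>V\<^esub> x) j = c * co x j))"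

lemma coordinatesD:
  assumes "coordinates V J co"
  shows "finite J" "bij_betw co (carrier V) (J \<rightarrow>\<^sub>E UNIV)"
    "\<zero>\<^bsub>V\<^esub> \<in> carrier V" "\<And>j. j \<in> J \<Longrightarrow> co \<zero>\<^bsub>V\<^esub> j = 0"
    "\<And>x y. x \<in> carrier V \<Longrightarrow> y \<in> carrier V \<Longrightarrow> x \<oplus>\<^bsub>V\<^esub> y \<in> carrier V"
    "\<And>x y j. x \<in> carrier V \<Longrightarrow> y \<in> carrier V \<Longrightarrow> j \<in> J \<Longrightarrow> co (x \<oplus>\<^bsub>V\<^esub> y) j = co x j + co y j"
    "\<And>c x. x \<in> carrier V \<Longrightarrow> c \<odot>\<^bsub>V\<^esub> x \<in> carrier V"
    "\<And>c x j. x \<in> carrier V \<Longrightarrow> j \<in> J \<Longrightarrow> co (c \<odot>\<^bsub>V\<^esub> x) j = c * co x j"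
  using assms unfolding coordinates_def by auto

lemma coordinates_eqI:
  assumes "coordinates V J co" "x \<in> carrier V" "y \<in> carrier V" "\<And>j. j \<in> J \<Longrightarrow> co x j = co y j"
  shows "x = y"
proof -
  have "co x \<in> J \<rightarrow>\<^sub>E UNIV" "co y \<in> J \<rightarrow>\<^sub>E UNIV"
    using assms coordinatesD(2)[OF assms(1)] by (auto simp: bij_betw_def)
  then have "co x = co y" using assms(4) by (intro PiE_ext) auto
  then show ?thesis using assms coordinatesD(2)[OF assms(1)] by (auto simp: bij_betw_def inj_on_def)
qed

text \<open>A coordinate map transports the structure of a function space, so \<open>eqI\<close>
  turns each axiom into an identity in the field. The additive inverse is the multiple by
  -1.\<close>

lemma coordinates_vectorspace:
  fixes V :: "('k::field, 'v) module"
  assumes c: "coordinates V J co"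
  shows "vectorspace class_ring V"
proof -
  note d = coordinatesD[OF c]
  note eqI = coordinates_eqI[OF c]
  have "abelian_group V"
  proof (rule abelian_groupI)
    fix x assume x: "x \<in> carrier V"
    have "(- 1) \<odot>\<^bsub>V\<^esub> x \<oplus>\<^bsub>V\<^esub> x = \<zero>\<^bsub>V\<^esub>"
      by (rule eqI) (use x d in auto)
    then show "\<exists>y\<in>carrier V. y \<oplus>\<^bsub>V\<^esub> x = \<zero>\<^bsub>V\<^esub>" using d(7)[OF x] by blast
  next
    fix x y z assume "x \<in> carrier V" "y \<in> carrier V" "z \<in> carrier V"
    then show "x \<oplus>\<^bsub>V\<^esub> y \<oplus>\<^bsub>V\<^esub> z = x \<oplus>\<^bsub>V\<^esub> (y \<oplus>\<^bsub>V\<^esub> z)"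
      by (intro eqI) (auto simp: d)
  next
    fix x y assume "x \<in> carrier V" "y \<in> carrier V"
    then show "x \<oplus>\<^bsub>V\<^esub> y = y \<oplus>\<^bsub>V\<^esub> x"
      by (intro eqI) (auto simp: d)
  next
    fix x assume "x \<in> carrier V"
    then show "\<zero>\<^bsub>V\<^esub> \<oplus>\<^bsub>V\<^esub> x = x"
      by (intro eqI) (auto simp: d)
  qed (auto simp: d)
  moreover have "cring (class_ring :: 'k ring)" by (rule class_cring.cring_axioms)
  moreover have "module_axioms class_ring V"
  proof (rule module_axioms.intro)
    fix a b :: 'k and x y assume "x \<in> carrier V"
    then show "(a \<oplus>\<^bsub>class_ring\<^esub> b) \<odot>\<^bsub>V\<^esub> x = a \<odot>\<^bsub>V\<^esub> x \<oplus>\<^bsub>V\<^esub> b \<odot>\<^bsub>V\<^esub> x"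
      by (intro eqI) (auto simp: d algebra_simps)
  next
    fix a :: 'k and x y assume "x \<in> carrier V" "y \<in> carrier V"
    then show "a \<odot>\<^bsub>V\<^esub> (x \<oplus>\<^bsub>V\<^esub> y) = a \<odot>\<^bsub>V\<^esub> x \<oplus>\<^bsub>V\<^esub> a \<odot>\<^bsub>V\<^esub> y"
      by (intro eqI) (auto simp: d algebra_simps)
  next
    fix a b :: 'k and x assume "x \<in> carrier V"
    then show "(a \<otimes>\<^bsub>class_ring\<^esub> b) \<odot>\<^bsub>V\<^esub> x = a \<odot>\<^bsub>V\<^esub> (b \<odot>\<^bsub>V\<^esub> x)"
      by (intro eqI) (auto simp: d algebra_simps)
  next
    fix x assume "x \<in> carrier V"
    then show "\<one>\<^bsub>class_ring\<^esub> \<odot>\<^bsub>V\<^esub> x = x"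
      by (intro eqI) (auto simp: d algebra_simps)
  qed (auto simp: d)
  ultimately have "Module.module (class_ring :: 'k ring) V"
    by (simp add: Module.module_def)
  then show ?thesis
    by (simp add: vectorspace_def class_field)
qed

text \<open>The preimages of the unit vectors form a basis: \<open>lc\<close> reads the coefficients
  of a linear combination off its coordinates.\<close>

lemma coordinates_dim:
  fixes V :: "('k::field, 'v) module"
  assumes c: "coordinates V J co"
  shows "vectorspace.dim class_ring V = card J"
proof -
  note d = coordinatesD[OF c]
  note eqI = coordinates_eqI[OF c]
  interpret V: vectorspace class_ring V by (rule coordinates_vectorspace[OF c])
  define b where "b j = inv_into (carrier V) co (\<lambda>i\<in>J. if i = j then 1 else 0)" for j
  have im: "(\<lambda>i\<in>J. if i = j then 1 else 0) \<in> co ` carrier V" for j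
    using d(2) by (auto simp: bij_betw_def)
  have bc: "b j \<in> carrier V" for j unfolding b_def using im by (rule inv_into_into)
  have cb: "co (b j) i = (if i = j then 1 else 0)" if "i \<in> J" for i j
    unfolding b_def f_inv_into_f[OF im] using that by simp
  have inj: "inj_on b J"
  proof (rule inj_onI)
    fix i j assume "i \<in> J" "j \<in> J" "b i = b j"
    then show "i = j" using cb[of i i] cb[of i j] by (auto split: if_splits)
  qed
  have fs: "finsum V f A \<in> carrier V \<and> (\<forall>j\<in>J. co (finsum V f A) j = (\<Sum>a\<in>A. co (f a) j))"
    if "finite A" "f \<in> A \<rightarrow> carrier V" for f and A :: "'v set"
    using that by (induct A rule: finite_induct) (auto simp: d)
  have lc: "co (V.lincomb a (b ` J)) j = a (b j)" if "j \<in> J" for a j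
  proof -
    have "co (V.lincomb a (b ` J)) j = (\<Sum>v\<in>b ` J. co (a v \<odot>\<^bsub>V\<^esub> v) j)"
      unfolding V.lincomb_def using fs[of "b ` J" "\<lambda>v. a v \<odot>\<^bsub>V\<^esub> v"] that d(1) bc d(7) by (auto simp: Pi_iff)
    also have "\<dots> = (\<Sum>i\<in>J. a (b i) * co (b i) j)"
      using inj that bc by (simp add: sum.reindex d)
    also have "\<dots> = (\<Sum>i\<in>J. if i = j then a (b i) else 0)"
      using that by (intro sum.cong) (auto simp: cb)
    finally show ?thesis using d(1) that by simp
  qed
  have "V.basis (b ` J)" unfolding V.basis_def
  proof (intro conjI)
    show "V.lin_indpt (b ` J)"
    proof (rule V.finite_lin_indpt2)
      fix a assume "a \<in> b ` J \<rightarrow> carrier (class_ring :: 'k ring)" "V.lincomb a (b ` J) = \<zero>\<^bsub>V\<^esub>"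
      then show "\<forall>v\<in>b ` J. a v = \<zero>\<^bsub>class_ring\<^esub>" using lc[of _ a] d(4) by auto
    qed (use d(1) bc in auto)
    show "V.span (b ` J) = carrier V"
    proof
      show "V.span (b ` J) \<subseteq> carrier V" using bc by (intro V.span_is_subset2) auto
      show "carrier V \<subseteq> V.span (b ` J)"
      proof
        fix x assume x: "x \<in> carrier V"
        define a where "a v = co x (inv_into J b v)" for v
        have "V.lincomb a (b ` J) = x"
          by (rule eqI) (use x inj lc bc in \<open>auto simp: a_def\<close>)
        then show "x \<in> V.span (b ` J)"
          unfolding V.span_def using d(1) by (auto intro!: exI[of _ "b ` J"] exI[of _ a])
      qed
    qed
    show "b ` J \<subseteq> carrier V" using bc by auto
  qed
  then have "V.dim = card (b ` J)" using d(1) by (intro V.dim_basis) auto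
  then show ?thesis using inj by (simp add: card_image)
qed

text \<open>Both actions are diagonal in the given coordinates, so permuting coordinates along a
  bijection that matches the characters is an equivariant isomorphism.\<close>

lemma group_module_isoI:
  fixes V :: "('k::field, 'v) module" and W :: "('k, 'w) module"
    and e :: "'i \<Rightarrow> 'c \<Rightarrow> 'k" and f :: "'j \<Rightarrow> 'c \<Rightarrow> 'k"
  assumes c: "coordinates V I co" and c': "coordinates W J co'"
    and actV: "\<And>\<gamma> x. \<gamma> \<in> C \<Longrightarrow> x \<in> carrier V \<Longrightarrow> actV \<gamma> x \<in> carrier V"
    and actV_eq: "\<And>\<gamma> x i. \<gamma> \<in> C \<Longrightarrow> x \<in> carrier V \<Longrightarrow> i \<in> I \<Longrightarrow> co (actV \<gamma> x) i = e i \<gamma> * co x i"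
    and actW: "\<And>\<gamma> x. \<gamma> \<in> C \<Longrightarrow> x \<in> carrier W \<Longrightarrow> actW \<gamma> x \<in> carrier W"
    and actW_eq: "\<And>\<gamma> x i. \<gamma> \<in> C \<Longrightarrow> x \<in> carrier W \<Longrightarrow> i \<in> J \<Longrightarrow> co' (actW \<gamma> x) i = f i \<gamma> * co' x i"
    and \<sigma>: "bij_betw \<sigma> J I" and ef: "\<And>j \<gamma>. j \<in> J \<Longrightarrow> \<gamma> \<in> C \<Longrightarrow> f j \<gamma> = e (\<sigma> j) \<gamma>"
  shows "group_module_iso C V actV W actW"
proof -
  note d = coordinatesD[OF c] and d' = coordinatesD[OF c']
  define \<phi> where "\<phi> x = inv_into (carrier W) co' (\<lambda>j\<in>J. co x (\<sigma> j))" for x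
  have im: "(\<lambda>j\<in>J. co x (\<sigma> j)) \<in> co' ` carrier W" for x
    using d'(2) by (auto simp: bij_betw_def)
  have \<phi>c: "\<phi> x \<in> carrier W" for x unfolding \<phi>_def using im by (rule inv_into_into)
  have \<phi>co: "co' (\<phi> x) j = co x (\<sigma> j)" if "j \<in> J" for x j
    unfolding \<phi>_def f_inv_into_f[OF im] using that by simp
  have \<sigma>I: "\<sigma> j \<in> I" if "j \<in> J" for j using \<sigma> that by (auto simp: bij_betw_def)
  interpret V: vectorspace class_ring V by (rule coordinates_vectorspace[OF c])
  interpret W: vectorspace class_ring W by (rule coordinates_vectorspace[OF c'])
  have "linear_map class_ring V W \<phi>"
  proof unfold_locales
    show "\<phi> \<in> LinearCombinations.module_hom class_ring V W"
      unfolding LinearCombinations.module_hom_def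
      by (auto intro!: coordinates_eqI[OF c'] simp: \<phi>c \<phi>co d d' \<sigma>I)
  qed
  moreover have "bij_betw \<phi> (carrier V) (carrier W)"
  proof (rule bij_betw_imageI)
    show "inj_on \<phi> (carrier V)"
    proof (rule inj_onI)
      fix x y assume xy: "x \<in> carrier V" "y \<in> carrier V" "\<phi> x = \<phi> y"
      show "x = y"
      proof (rule coordinates_eqI[OF c xy(1,2)])
        fix i assume "i \<in> I"
        then obtain j where "j \<in> J" "i = \<sigma> j" using \<sigma> by (auto simp: bij_betw_def)
        then show "co x i = co y i" using \<phi>co[of j x] \<phi>co[of j y] xy(3) by simp
      qed
    qed
    show "\<phi> ` carrier V = carrier W"
    proof
      show "\<phi> ` carrier V \<subseteq> carrier W" using \<phi>c by auto
      show "carrier W \<subseteq> \<phi> ` carrier V"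
      proof
        fix y assume y: "y \<in> carrier W"
        have "(\<lambda>i\<in>I. co' y (inv_into J \<sigma> i)) \<in> co ` carrier V"
          using d(2) by (auto simp: bij_betw_def)
        then obtain x where x: "x \<in> carrier V" "co x = (\<lambda>i\<in>I. co' y (inv_into J \<sigma> i))" by auto
        have "\<phi> x = y"
          by (rule coordinates_eqI[OF c' \<phi>c y])
            (use \<sigma> in \<open>auto simp: \<phi>co x \<sigma>I bij_betw_def\<close>)
        then show "y \<in> \<phi> ` carrier V" using x by auto
      qed
    qed
  qed
  moreover have "\<phi> (actV \<gamma> x) = actW \<gamma> (\<phi> x)" if "\<gamma> \<in> C" "x \<in> carrier V" for \<gamma> x
    by (rule coordinates_eqI[OF c'])
      (use that in \<open>auto simp: \<phi>c \<phi>co actV actW actV_eq actW_eq \<sigma>I ef\<close>)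
  ultimately show ?thesis unfolding group_module_iso_def by blast
qed

text \<open>The values on \<open>J\<close> of an element of \<open>U\<close> can be prescribed
  freely and determine it, so \<open>J\<close> has as many elements as the dimension. Recording
  positions instead of basis vectors makes it meaningful to keep the same \<open>J\<close> over a
  larger field.\<close>

definition restriction_basis :: "'m set \<Rightarrow> ('m \<Rightarrow> 'k::field) set \<Rightarrow> bool" where
  "restriction_basis J U \<longleftrightarrow> bij_betw (\<lambda>x. restrict x J) U (J \<rightarrow>\<^sub>E UNIV)"

definition supp_in :: "'m set \<Rightarrow> ('m \<Rightarrow> 'k::zero) set" where
  "supp_in M = {x. \<forall>\<mu>. \<mu> \<notin> M \<longrightarrow> x \<mu> = 0}"

definition fun_subspace :: "('m \<Rightarrow> 'k::field) set \<Rightarrow> bool" where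
  "fun_subspace U \<longleftrightarrow> (\<lambda>_. 0) \<in> U \<and> (\<forall>c. \<forall>x\<in>U. \<forall>y\<in>U. (\<lambda>\<mu>. c * x \<mu> + y \<mu>) \<in> U)"

lemma fun_subspace_comb:
  "fun_subspace U \<Longrightarrow> x \<in> U \<Longrightarrow> y \<in> U \<Longrightarrow> (\<lambda>\<mu>. c * x \<mu> + y \<mu>) \<in> U"
  unfolding fun_subspace_def by blast

lemma fun_subspace_zero: "fun_subspace U \<Longrightarrow> (\<lambda>_. 0) \<in> U"
  unfolding fun_subspace_def by blast

lemma restriction_basisI:
  assumes "fun_subspace U"
    and "\<And>x. x \<in> U \<Longrightarrow> (\<And>j. j \<in> J \<Longrightarrow> x j = 0) \<Longrightarrow> x = (\<lambda>_. 0)"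
    and "\<And>y. \<exists>x\<in>U. \<forall>j\<in>J. x j = y j"
  shows "restriction_basis J U"
  unfolding restriction_basis_def
proof (rule bij_betw_imageI)
  show "inj_on (\<lambda>x. restrict x J) U"
  proof (rule inj_onI)
    fix x y assume xy: "x \<in> U" "y \<in> U" "restrict x J = restrict y J"
    have "(\<lambda>\<mu>. (-1) * x \<mu> + y \<mu>) \<in> U" using assms(1) xy unfolding fun_subspace_def by blast
    moreover have "x j = y j" if "j \<in> J" for j using xy(3) that by (metis restrict_apply')
    ultimately have "(\<lambda>\<mu>. (-1) * x \<mu> + y \<mu>) = (\<lambda>_. 0)" using assms(2) by simp
    then show "x = y" by (auto simp: fun_eq_iff)
  qed
  show "(\<lambda>x. restrict x J) ` U = J \<rightarrow>\<^sub>E UNIV"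
  proof (intro equalityI subsetI)
    fix y :: "'a \<Rightarrow> 'b" assume y: "y \<in> J \<rightarrow>\<^sub>E UNIV"
    obtain x where "x \<in> U" "\<forall>j\<in>J. x j = y j" using assms(3) by blast
    moreover from this y have "restrict x J = y"
      by (auto simp: fun_eq_iff restrict_def PiE_def extensional_def)
    ultimately show "y \<in> (\<lambda>x. restrict x J) ` U" by blast
  qed auto
qed

lemma restriction_basis_zero:
  assumes "restriction_basis J U" "fun_subspace U" "x \<in> U" "\<And>j. j \<in> J \<Longrightarrow> x j = 0"
  shows "x = (\<lambda>_. 0)"
proof -
  have "restrict x J = restrict (\<lambda>_. 0) J" using assms(4) by (auto simp: fun_eq_iff)
  then show ?thesis using assms(1-3)
    unfolding restriction_basis_def bij_betw_def inj_on_def fun_subspace_def by blast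
qed

lemma restriction_basis_ex:
  assumes "restriction_basis J U"
  obtains x where "x \<in> U" "\<And>j. j \<in> J \<Longrightarrow> x j = y j"
proof -
  have "restrict y J \<in> (\<lambda>x. restrict x J) ` U"
    using assms by (auto simp: restriction_basis_def bij_betw_def)
  then obtain x where "x \<in> U" "restrict y J = restrict x J" by auto
  then show ?thesis using that by (metis restrict_apply')
qed

text \<open>Gaussian elimination, one coordinate at a time: the elements vanishing at
  \<open>a\<close> are handled by induction, and \<open>a\<close> joins \<open>J\<close> exactly if
  some element does not vanish there.\<close>

lemma restriction_basis_exists:
  fixes U :: "('m \<Rightarrow> 'k::field) set"
  assumes "finite M" "fun_subspace U" "U \<subseteq> supp_in M"
  shows "\<exists>J\<subseteq>M. restriction_basis J U"
  using assms
proof (induct M arbitrary: U rule: finite_induct)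
  case empty
  then have "U = {\<lambda>_. 0}" by (auto simp: supp_in_def fun_subspace_def fun_eq_iff)
  then show ?case by (auto simp: restriction_basis_def bij_betw_def)
next
  case (insert a M)
  define U' where "U' = {x\<in>U. x a = 0}"
  have sub: "fun_subspace U'" using insert.prems(1) by (auto simp: U'_def fun_subspace_def)
  have "U' \<subseteq> supp_in M" using insert.prems(2) by (auto simp: U'_def supp_in_def)
  then obtain J where J: "J \<subseteq> M" "restriction_basis J U'" using insert.hyps(3)[OF sub] by auto
  show ?case
  proof (cases "U' = U")
    case True then show ?thesis using J by auto
  next
    case False
    then obtain u0 where u0: "u0 \<in> U" "u0 a \<noteq> 0" by (auto simp: U'_def)
    \<comment> \<open>The summand 0 brings the normalised element into the shape of
      \<open>fun_subspace_comb\<close>.\<close>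
    define u where "u = (\<lambda>\<mu>. inverse (u0 a) * u0 \<mu> + 0)"
    have "u \<in> U" unfolding u_def
      by (rule fun_subspace_comb[OF insert.prems(1) u0(1) fun_subspace_zero[OF insert.prems(1)]])
    then have u: "u \<in> U" "u a = 1" using u0 by (auto simp: u_def)
    have "restriction_basis (insert a J) U"
    proof (rule restriction_basisI[OF insert.prems(1)])
      fix x assume x: "x \<in> U" "\<And>j. j \<in> insert a J \<Longrightarrow> x j = 0"
      then have "x \<in> U'" by (simp add: U'_def)
      then show "x = (\<lambda>_. 0)" using restriction_basis_zero[OF J(2) sub] x(2) by blast
    next
      fix y :: "'m \<Rightarrow> 'k"
      \<comment> \<open>The contribution of \<open>y a\<close> times \<open>u\<close> is subtracted
        beforehand, so that adding this multiple of \<open>u\<close> sets the value at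
        \<open>a\<close> and restores those on \<open>J\<close>.\<close>
      obtain w where w: "w \<in> U'" "\<And>j. j \<in> J \<Longrightarrow> w j = y j - y a * u j"
        using restriction_basis_ex[OF J(2), of "\<lambda>j. y j - y a * u j"] by auto
      have "(\<lambda>\<mu>. y a * u \<mu> + w \<mu>) \<in> U"
        using w(1) u(1) insert.prems(1) unfolding U'_def fun_subspace_def by blast
      moreover have "y a * u j + w j = y j" if "j \<in> insert a J" for j
        using that w u(2) by (auto simp: U'_def)
      ultimately show "\<exists>x\<in>U. \<forall>j\<in>insert a J. x j = y j" by (intro bexI) auto
    qed
    then show ?thesis using J(1) by blast
  qed
qed

section \<open>Multivariate polynomials and the truncated polynomial ring\<close>

lemma Const_simps [simp]: "Const 0 = 0" "Const 1 = 1"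
  by (simp_all add: Const_def)

lemma Const_add: "Const (a + b) = Const a + Const b"
  by (simp add: Const_def single_add)

lemma Const_mult: "Const (a * b) = Const a * Const b"
  by (simp add: Const_def mult_single)

lemma Const_times_single: "Const a * Poly_Mapping.single \<mu> b = Poly_Mapping.single \<mu> (a * b)"
  by (simp add: Const_def mult_single)

lemma lookup_Const_times:
  "Poly_Mapping.lookup (Const c * p) \<mu> = c * Poly_Mapping.lookup p \<mu>"
  unfolding Const_def mult_map_scale_conv_mult[symmetric] by (simp add: Poly_Mapping.map.rep_eq when_def)

lemma mpoly_expand:
  assumes "finite A" "Poly_Mapping.keys p \<subseteq> A"
  shows "p = (\<Sum>\<mu>\<in>A. Poly_Mapping.single \<mu> (Poly_Mapping.lookup p \<mu>))"
proof (rule poly_mapping_eqI)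
  fix k
  show "Poly_Mapping.lookup p k =
    Poly_Mapping.lookup (\<Sum>\<mu>\<in>A. Poly_Mapping.single \<mu> (Poly_Mapping.lookup p \<mu>)) k"
    using assms by (auto simp: lookup_sum lookup_single when_def sum.delta in_keys_iff)
qed

lemma mpoly_induct [case_names single add]:
  fixes p :: "'b \<Rightarrow>\<^sub>0 'a::comm_monoid_add"
  assumes "\<And>\<mu> c. P (Poly_Mapping.single \<mu> c)" "\<And>p r. P p \<Longrightarrow> P r \<Longrightarrow> P (p + r)"
  shows "P p"
proof -
  have "P (\<Sum>\<mu>\<in>A. Poly_Mapping.single \<mu> (Poly_Mapping.lookup p \<mu>))" if "finite A" for A
    using that
  proof (induct A rule: finite_induct)
    case empty
    \<comment> \<open>The zero element is itself a single term, with coefficient 0.\<close>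
    then show ?case using assms(1)[of undefined 0] by simp
  next
    case (insert x F) then show ?case using assms by simp
  qed
  from this[OF finite_keys[of p]] show ?thesis using mpoly_expand[OF finite_keys order_refl, of p] by simp
qed

section \<open>Substitution homomorphisms\<close>

definition monom_val :: "(nat \<Rightarrow> 'a::comm_ring_1 mpoly) \<Rightarrow> (nat \<Rightarrow>\<^sub>0 nat) \<Rightarrow> 'a mpoly" where
  "monom_val f \<mu> = (\<Prod>j\<in>Poly_Mapping.keys \<mu>. f j ^ Poly_Mapping.lookup \<mu> j)"

lemma monom_val_superset:
  assumes "finite A" "Poly_Mapping.keys \<mu> \<subseteq> A"
  shows "monom_val f \<mu> = (\<Prod>j\<in>A. f j ^ Poly_Mapping.lookup \<mu> j)"
  unfolding monom_val_def using assms by (intro prod.mono_neutral_left) (auto simp: in_keys_iff)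

lemma monom_val_add: "monom_val f (\<mu> + \<nu>) = monom_val f \<mu> * monom_val f \<nu>"
proof -
  let ?A = "Poly_Mapping.keys \<mu> \<union> Poly_Mapping.keys \<nu>"
  have "monom_val f (\<mu> + \<nu>) = (\<Prod>j\<in>?A. f j ^ Poly_Mapping.lookup (\<mu> + \<nu>) j)"
    using Poly_Mapping.keys_add[of \<mu> \<nu>] by (intro monom_val_superset) auto
  also have "\<dots> = (\<Prod>j\<in>?A. f j ^ Poly_Mapping.lookup \<mu> j) * (\<Prod>j\<in>?A. f j ^ Poly_Mapping.lookup \<nu> j)"
    by (simp add: lookup_add power_add prod.distrib)
  also have "\<dots> = monom_val f \<mu> * monom_val f \<nu>"
    by (subst (1 2) monom_val_superset[of ?A]) auto
  finally show ?thesis .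
qed

lemma monom_val_cong:
  "(\<And>j. j \<in> Poly_Mapping.keys \<mu> \<Longrightarrow> f j = h j) \<Longrightarrow> monom_val f \<mu> = monom_val h \<mu>"
  unfolding monom_val_def by (intro prod.cong) auto

lemma poly_subst_superset:
  assumes "finite A" "Poly_Mapping.keys p \<subseteq> A"
  shows "poly_subst f p = (\<Sum>\<mu>\<in>A. Const (Poly_Mapping.lookup p \<mu>) * monom_val f \<mu>)"
  unfolding poly_subst_def monom_val_def[symmetric] using assms
  by (intro sum.mono_neutral_left) (auto simp: in_keys_iff)

lemma poly_subst_add: "poly_subst f (p + r) = poly_subst f p + poly_subst f r"
proof -
  let ?A = "Poly_Mapping.keys p \<union> Poly_Mapping.keys r"
  have "poly_subst f (p + r) = (\<Sum>\<mu>\<in>?A. Const (Poly_Mapping.lookup (p + r) \<mu>) * monom_val f \<mu>)"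
    using Poly_Mapping.keys_add[of p r] by (intro poly_subst_superset) auto
  also have "\<dots> = (\<Sum>\<mu>\<in>?A. Const (Poly_Mapping.lookup p \<mu>) * monom_val f \<mu>)
                + (\<Sum>\<mu>\<in>?A. Const (Poly_Mapping.lookup r \<mu>) * monom_val f \<mu>)"
    by (simp add: lookup_add Const_add distrib_right sum.distrib)
  also have "\<dots> = poly_subst f p + poly_subst f r"
    by (subst (1 2) poly_subst_superset[of ?A]) auto
  finally show ?thesis .
qed

lemma poly_subst_zero [simp]: "poly_subst f 0 = 0"
  by (simp add: poly_subst_def)

lemma poly_subst_sum: "poly_subst f (\<Sum>a\<in>A. p a) = (\<Sum>a\<in>A. poly_subst f (p a))"
  by (induct A rule: infinite_finite_induct) (auto simp: poly_subst_add)

lemma poly_subst_single: "poly_subst f (Poly_Mapping.single \<mu> c) = Const c * monom_val f \<mu>"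
  by (subst poly_subst_superset[of "{\<mu>}"]) auto

lemma poly_subst_mult: "poly_subst f (p * r) = poly_subst f p * poly_subst f r"
proof (induct p rule: mpoly_induct)
  case (single \<mu> c)
  show ?case
  proof (induct r rule: mpoly_induct)
    case (single \<nu> d)
    then show ?case by (simp add: mult_single poly_subst_single monom_val_add Const_mult mult_ac)
  qed (simp add: distrib_left poly_subst_add)
qed (simp add: poly_subst_add distrib_right)

lemma poly_subst_Const [simp]: "poly_subst f (Const c) = Const c"
  by (simp add: Const_def poly_subst_single monom_val_def)

lemma poly_subst_one [simp]: "poly_subst f 1 = 1"
  using poly_subst_Const[of f 1] by simp

lemma poly_subst_Var [simp]: "poly_subst f (Var i) = f i"
  by (simp add: Var_def poly_subst_single monom_val_def)

lemma poly_subst_power: "poly_subst f (p ^ k) = poly_subst f p ^ k"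
  by (induct k) (auto simp: poly_subst_mult)

lemma poly_subst_prod: "poly_subst f (\<Prod>a\<in>A. p a) = (\<Prod>a\<in>A. poly_subst f (p a))"
  by (induct A rule: infinite_finite_induct) (auto simp: poly_subst_mult)

lemma poly_subst_comp:
  "poly_subst f (poly_subst h p) = poly_subst (\<lambda>j. poly_subst f (h j)) p"
  unfolding poly_subst_def[of h] poly_subst_def[of "\<lambda>j. poly_subst f (h j)"]
  by (simp add: poly_subst_sum poly_subst_mult poly_subst_prod poly_subst_power)

lemma Var_power: "Var i ^ k = Poly_Mapping.single (Poly_Mapping.single i k) 1"
proof (induct k)
  case (Suc k)
  then show ?case by (simp add: Var_def mult_single single_add[symmetric])
qed simp

lemma monom_val_Var: "monom_val Var \<mu> = Poly_Mapping.single \<mu> 1"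
proof -
  have "(\<Prod>j\<in>A. Poly_Mapping.single (h j) (1::'a)) = Poly_Mapping.single (sum h A) 1"
    for A :: "nat set" and h :: "nat \<Rightarrow> nat \<Rightarrow>\<^sub>0 nat"
    by (induct A rule: infinite_finite_induct) (auto simp: mult_single)
  then show ?thesis
    unfolding monom_val_def Var_power
    using mpoly_expand[OF finite_keys order_refl, of \<mu>] by simp
qed

lemma poly_subst_id: "poly_subst Var p = p"
  by (induct p rule: mpoly_induct)
    (auto simp: poly_subst_add poly_subst_single monom_val_Var Const_times_single)

section \<open>Polynomials in finitely many variables\<close>

definition mpoly_carrier :: "nat \<Rightarrow> 'a::comm_ring_1 mpoly set" where
  "mpoly_carrier n = {p. \<forall>\<mu>\<in>Poly_Mapping.keys p. Poly_Mapping.keys \<mu> \<subseteq> {..<n}}"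

lemma mpoly_ring_simps [simp]:
  "carrier (mpoly_ring n) = mpoly_carrier n" "monoid.mult (mpoly_ring n) = (*)" "add (mpoly_ring n) = (+)"
  "one (mpoly_ring n) = 1" "zero (mpoly_ring n) = 0"
  by (auto simp: mpoly_ring_def mpoly_carrier_def)

lemma mpoly_carrier_single:
  "Poly_Mapping.keys \<mu> \<subseteq> {..<n} \<Longrightarrow> Poly_Mapping.single \<mu> c \<in> mpoly_carrier n"
  by (auto simp: mpoly_carrier_def)

lemma mpoly_carrier_simps [simp]:
  "0 \<in> mpoly_carrier n" "1 \<in> mpoly_carrier n" "Const c \<in> mpoly_carrier n"
  by (auto simp: mpoly_carrier_def Const_def)

lemma mpoly_carrier_Var [simp]: "i < n \<Longrightarrow> Var i \<in> mpoly_carrier n"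
  by (auto simp: mpoly_carrier_def Var_def)

lemma mpoly_carrier_add: "p \<in> mpoly_carrier n \<Longrightarrow> r \<in> mpoly_carrier n \<Longrightarrow> p + r \<in> mpoly_carrier n"
  using Poly_Mapping.keys_add[of p r] by (auto simp: mpoly_carrier_def)

lemma mpoly_carrier_uminus: "p \<in> mpoly_carrier n \<Longrightarrow> - p \<in> mpoly_carrier n"
  by (auto simp: mpoly_carrier_def in_keys_iff)

lemma mpoly_carrier_diff: "p \<in> mpoly_carrier n \<Longrightarrow> r \<in> mpoly_carrier n \<Longrightarrow> p - r \<in> mpoly_carrier n"
  using mpoly_carrier_add[of p n "- r"] mpoly_carrier_uminus[of r n] by simp

lemma mpoly_carrier_mult: "p \<in> mpoly_carrier n \<Longrightarrow> r \<in> mpoly_carrier n \<Longrightarrow> p * r \<in> mpoly_carrier n"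
proof -
  assume pr: "p \<in> mpoly_carrier n" "r \<in> mpoly_carrier n"
  show "p * r \<in> mpoly_carrier n"
    unfolding mpoly_carrier_def
  proof (intro CollectI ballI)
    fix \<mu> assume "\<mu> \<in> Poly_Mapping.keys (p * r)"
    then obtain a b where "a \<in> Poly_Mapping.keys p" "b \<in> Poly_Mapping.keys r" "\<mu> = a + b"
      using keys_mult[of p r] by auto
    then show "Poly_Mapping.keys \<mu> \<subseteq> {..<n}"
      using pr Poly_Mapping.keys_add[of a b] unfolding mpoly_carrier_def by blast
  qed
qed

lemma mpoly_carrier_power: "p \<in> mpoly_carrier n \<Longrightarrow> p ^ k \<in> mpoly_carrier n"
  by (induct k) (auto simp: mpoly_carrier_mult)

lemma mpoly_carrier_sum: "(\<And>a. a \<in> A \<Longrightarrow> p a \<in> mpoly_carrier n) \<Longrightarrow> sum p A \<in> mpoly_carrier n"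
  by (induct A rule: infinite_finite_induct) (auto simp: mpoly_carrier_add)

lemma mpoly_carrier_prod: "(\<And>a. a \<in> A \<Longrightarrow> p a \<in> mpoly_carrier n) \<Longrightarrow> prod p A \<in> mpoly_carrier n"
  by (induct A rule: infinite_finite_induct) (auto simp: mpoly_carrier_mult)

lemma mpoly_carrier_monom_val:
  assumes "\<And>j. j < n \<Longrightarrow> f j \<in> mpoly_carrier n" "Poly_Mapping.keys \<mu> \<subseteq> {..<n}"
  shows "monom_val f \<mu> \<in> mpoly_carrier n"
  unfolding monom_val_def using assms by (intro mpoly_carrier_prod mpoly_carrier_power) auto

lemma mpoly_carrier_poly_subst:
  assumes "\<And>j. j < n \<Longrightarrow> f j \<in> mpoly_carrier n" "p \<in> mpoly_carrier n"
  shows "poly_subst f p \<in> mpoly_carrier n"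
  unfolding poly_subst_def monom_val_def[symmetric] using assms
  by (intro mpoly_carrier_sum mpoly_carrier_mult mpoly_carrier_monom_val mpoly_carrier_simps)
    (auto simp: mpoly_carrier_def)

lemma poly_subst_cong:
  assumes "\<And>j. j < n \<Longrightarrow> f j = h j" "p \<in> mpoly_carrier n"
  shows "poly_subst f p = poly_subst h p"
  unfolding poly_subst_def monom_val_def[symmetric] using assms
  by (intro sum.cong refl arg_cong[where f = "\<lambda>x. _ * x"] monom_val_cong) (auto simp: mpoly_carrier_def)

lemma cring_mpoly_ring: "cring (mpoly_ring n :: 'a::comm_ring_1 mpoly ring)"
proof (rule cringI)
  show "abelian_group (mpoly_ring n :: 'a mpoly ring)"
  proof (rule abelian_groupI)
    fix x :: "'a mpoly" assume "x \<in> carrier (mpoly_ring n)"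
    then show "\<exists>y\<in>carrier (mpoly_ring n). y \<oplus>\<^bsub>mpoly_ring n\<^esub> x = \<zero>\<^bsub>mpoly_ring n\<^esub>"
      by (intro bexI[of _ "- x"]) (auto simp: mpoly_carrier_uminus)
  qed (auto simp: mpoly_carrier_add add_ac)
  show "comm_monoid (mpoly_ring n :: 'a mpoly ring)"
    by (rule comm_monoidI) (auto simp: mpoly_carrier_mult mult_ac)
qed (auto simp: distrib_right)

text \<open>The monomial ideal spanned by the monomials divisible by some \<open>Var i ^ N\<close>.
  Membership is a condition on each monomial separately, which \<open>genideal\<close> does not
  show.\<close>

definition high_ideal :: "nat \<Rightarrow> nat \<Rightarrow> 'a::comm_ring_1 mpoly set" where
  "high_ideal n N =
     {p \<in> mpoly_carrier n. \<forall>\<mu>\<in>Poly_Mapping.keys p. \<exists>i<n. N \<le> Poly_Mapping.lookup \<mu> i}"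

lemma high_ideal_add: "p \<in> high_ideal n N \<Longrightarrow> r \<in> high_ideal n N \<Longrightarrow> p + r \<in> high_ideal n N"
  using Poly_Mapping.keys_add[of p r] by (auto simp: high_ideal_def mpoly_carrier_add)

lemma high_ideal_zero [simp]: "0 \<in> high_ideal n N"
  by (auto simp: high_ideal_def)

lemma high_ideal_carrier: "p \<in> high_ideal n N \<Longrightarrow> p \<in> mpoly_carrier n"
  by (simp add: high_ideal_def)

lemma high_ideal_uminus: "p \<in> high_ideal n N \<Longrightarrow> - p \<in> high_ideal n N"
  by (auto simp: high_ideal_def mpoly_carrier_uminus in_keys_iff)

lemma high_ideal_sum: "(\<And>a. a \<in> A \<Longrightarrow> p a \<in> high_ideal n N) \<Longrightarrow> sum p A \<in> high_ideal n N"
  by (induct A rule: infinite_finite_induct) (auto simp: high_ideal_add)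

lemma high_ideal_mult: "p \<in> high_ideal n N \<Longrightarrow> r \<in> mpoly_carrier n \<Longrightarrow> p * r \<in> high_ideal n N"
proof -
  assume pr: "p \<in> high_ideal n N" "r \<in> mpoly_carrier n"
  have "\<exists>i<n. N \<le> Poly_Mapping.lookup \<mu> i" if mu: "\<mu> \<in> Poly_Mapping.keys (p * r)" for \<mu>
  proof -
    obtain a b where "a \<in> Poly_Mapping.keys p" "b \<in> Poly_Mapping.keys r" "\<mu> = a + b"
      using mu keys_mult[of p r] by auto
    then show ?thesis using pr(1) by (auto simp: high_ideal_def lookup_add intro: trans_le_add1)
  qed
  then show ?thesis using pr by (auto simp: high_ideal_def mpoly_carrier_mult)
qed

lemma ideal_high_ideal: "ideal (high_ideal n N) (mpoly_ring n :: 'a::comm_ring_1 mpoly ring)"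
proof -
  interpret R: cring "mpoly_ring n :: 'a mpoly ring" by (rule cring_mpoly_ring)
  show ?thesis
  proof (rule idealI)
    show "ring (mpoly_ring n :: 'a mpoly ring)" by (rule R.ring_axioms)
    show "subgroup (high_ideal n N) (add_monoid (mpoly_ring n :: 'a mpoly ring))"
    proof (rule R.add.subgroupI)
      fix a :: "'a mpoly" assume a: "a \<in> high_ideal n N"
      have "\<ominus>\<^bsub>mpoly_ring n\<^esub> a = - a"
        using a by (intro R.minus_equality) (auto simp: high_ideal_def mpoly_carrier_uminus)
      then show "\<ominus>\<^bsub>mpoly_ring n\<^esub> a \<in> high_ideal n N" using high_ideal_uminus[OF a] by simp
    next
      show "high_ideal n N \<noteq> {}" using high_ideal_zero by blast
    qed (auto simp: high_ideal_carrier high_ideal_add)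
  qed (auto simp: high_ideal_mult mult.commute)
qed

lemma single_in_high_ideal:
  "Poly_Mapping.keys \<mu> \<subseteq> {..<n} \<Longrightarrow> i < n \<Longrightarrow> N \<le> Poly_Mapping.lookup \<mu> i \<Longrightarrow>
    Poly_Mapping.single \<mu> c \<in> high_ideal n N"
  by (auto simp: high_ideal_def mpoly_carrier_single)

text \<open>Each monomial of an element of \<open>high_ideal\<close> is a multiple of a generator;
  conversely \<open>high_ideal\<close> is an ideal that contains the generators.\<close>

lemma power_ideal_eq: "power_ideal n N = (high_ideal n N :: 'a::comm_ring_1 mpoly set)"
proof -
  interpret R: cring "mpoly_ring n :: 'a mpoly ring" by (rule cring_mpoly_ring)
  let ?G = "{Var i ^ N | i. i < n} :: 'a mpoly set"
  have G: "?G \<subseteq> carrier (mpoly_ring n)" by (auto simp: mpoly_carrier_power)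
  interpret P: ideal "power_ideal n N :: 'a mpoly set" "mpoly_ring n"
    unfolding power_ideal_def using G by (rule R.genideal_ideal)
  have GP: "?G \<subseteq> power_ideal n N" unfolding power_ideal_def using G by (rule R.genideal_self)
  show ?thesis
  proof
    have "Var i ^ N \<in> high_ideal n N" if "i < n" for i
      unfolding Var_power using that by (intro single_in_high_ideal[of _ _ i]) auto
    then show "power_ideal n N \<subseteq> (high_ideal n N :: 'a mpoly set)"
      unfolding power_ideal_def using ideal_high_ideal by (intro R.genideal_minimal) auto
    show "(high_ideal n N :: 'a mpoly set) \<subseteq> power_ideal n N"
    proof
      fix p :: "'a mpoly" assume p: "p \<in> high_ideal n N"
      have s: "Poly_Mapping.single \<mu> c \<in> power_ideal n N"
        if \<mu>: "\<mu> \<in> Poly_Mapping.keys p" for \<mu> and c :: 'a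
      proof -
        obtain i where i: "i < n" "N \<le> Poly_Mapping.lookup \<mu> i" using p \<mu> by (auto simp: high_ideal_def)
        have k: "Poly_Mapping.keys \<mu> \<subseteq> {..<n}" using p \<mu> by (auto simp: high_ideal_def mpoly_carrier_def)
        define \<nu> where "\<nu> = \<mu> - Poly_Mapping.single i N"
        \<comment> \<open>The truncated subtraction in \<open>\<nu>\<close> is exact because the
          exponent of \<open>i\<close> in \<open>\<mu>\<close> is at least \<open>N\<close>.\<close>
        have \<nu>: "\<mu> = \<nu> + Poly_Mapping.single i N"
          by (rule poly_mapping_eqI)
            (use i in \<open>auto simp: \<nu>_def lookup_add lookup_minus lookup_single when_def\<close>)
        have "Poly_Mapping.keys \<nu> \<subseteq> {..<n}"
          using k by (force simp: \<nu>_def in_keys_iff lookup_minus subset_iff)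
        then have "Poly_Mapping.single \<nu> c \<otimes>\<^bsub>mpoly_ring n\<^esub> Var i ^ N \<in> power_ideal n N"
          using GP i by (intro P.I_l_closed) (auto simp: mpoly_carrier_single)
        then show ?thesis by (simp add: Var_power mult_single \<nu>[symmetric])
      qed
      have "(\<Sum>\<mu>\<in>A. Poly_Mapping.single \<mu> (Poly_Mapping.lookup p \<mu>)) \<in> power_ideal n N"
        if "finite A" "A \<subseteq> Poly_Mapping.keys p" for A
        using that
      proof (induct A rule: finite_induct)
        case empty then show ?case using P.zero_closed by simp
      next
        case (insert x F)
        then show ?case using P.a_closed s[of x] by simp
      qed
      from this[OF finite_keys order_refl] show "p \<in> power_ideal n N"
        using mpoly_expand[OF finite_keys order_refl, of p] by simp
    qed
  qed
qed

text \<open>The exponents of the monomials whose classes form a basis of the quotient.\<close>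

definition low_monoms :: "nat \<Rightarrow> nat \<Rightarrow> (nat \<Rightarrow>\<^sub>0 nat) set" where
  "low_monoms n N = {\<mu>. Poly_Mapping.keys \<mu> \<subseteq> {..<n} \<and> (\<forall>i<n. Poly_Mapping.lookup \<mu> i < N)}"

lemma finite_low_monoms [simp]: "finite (low_monoms n N)"
proof -
  have "finite {f. \<forall>i. (i \<in> {..<n} \<longrightarrow> f i \<in> {..<N}) \<and> (i \<notin> {..<n} \<longrightarrow> f i = 0)}"
    by (rule finite_set_of_finite_funs) auto
  moreover have "Poly_Mapping.lookup ` low_monoms n N
      \<subseteq> {f. \<forall>i. (i \<in> {..<n} \<longrightarrow> f i \<in> {..<N}) \<and> (i \<notin> {..<n} \<longrightarrow> f i = 0)}"
    by (auto simp: low_monoms_def in_keys_iff subset_eq)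
  ultimately have "finite (Poly_Mapping.lookup ` low_monoms n N)" by (rule finite_subset[rotated])
  moreover have "inj_on Poly_Mapping.lookup (low_monoms n N)" by (auto simp: inj_on_def lookup_inject)
  ultimately show ?thesis by (rule finite_imageD)
qed

lemma high_ideal_iff:
  assumes "p \<in> mpoly_carrier n"
  shows "p \<in> high_ideal n N \<longleftrightarrow> (\<forall>\<mu>\<in>low_monoms n N. Poly_Mapping.lookup p \<mu> = 0)"
proof
  assume p: "p \<in> high_ideal n N"
  show "\<forall>\<mu>\<in>low_monoms n N. Poly_Mapping.lookup p \<mu> = 0"
  proof (intro ballI, rule ccontr)
    fix \<mu> assume \<mu>: "\<mu> \<in> low_monoms n N" "Poly_Mapping.lookup p \<mu> \<noteq> 0"
    from \<mu>(2) have "\<mu> \<in> Poly_Mapping.keys p" by (metis in_keys_iff)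
    then obtain i where "i < n" "N \<le> Poly_Mapping.lookup \<mu> i"
      using p unfolding high_ideal_def by blast
    moreover from \<mu>(1) have "\<forall>i<n. Poly_Mapping.lookup \<mu> i < N" unfolding low_monoms_def by blast
    ultimately show False using leD by blast
  qed
next
  assume z: "\<forall>\<mu>\<in>low_monoms n N. Poly_Mapping.lookup p \<mu> = 0"
  have "\<exists>i<n. N \<le> Poly_Mapping.lookup \<mu> i" if "\<mu> \<in> Poly_Mapping.keys p" for \<mu>
  proof (rule ccontr)
    assume "\<not> (\<exists>i<n. N \<le> Poly_Mapping.lookup \<mu> i)"
    then have "\<forall>i<n. Poly_Mapping.lookup \<mu> i < N" by (meson not_le)
    moreover have "Poly_Mapping.keys \<mu> \<subseteq> {..<n}" using that assms unfolding mpoly_carrier_def by blast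
    ultimately have "\<mu> \<in> low_monoms n N" unfolding low_monoms_def by blast
    then have "Poly_Mapping.lookup p \<mu> = 0" using z by blast
    then show False using that by (metis in_keys_iff)
  qed
  then show "p \<in> high_ideal n N" using assms by (simp add: high_ideal_def)
qed

section \<open>Cosets of the ideal and their coefficients\<close>

lemma coset_eq: "coset n N p = {r + p | r. r \<in> high_ideal n N}"
  by (auto simp: coset_def power_ideal_eq a_r_coset_def')

lemma coset_memI: "r - p \<in> high_ideal n N \<Longrightarrow> r \<in> coset n N p"
  unfolding coset_eq by (intro CollectI exI[of _ "r - p"]) auto

lemma coset_self: "p \<in> coset n N p"
  by (rule coset_memI) simp

lemma coset_memD: "r \<in> coset n N p \<Longrightarrow> r - p \<in> high_ideal n N"
  unfolding coset_eq by auto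

lemma coset_eqI:
  assumes "p - r \<in> high_ideal n N"
  shows "coset n N p = coset n N r"
proof -
  have "(x - p \<in> high_ideal n N) = (x - r \<in> high_ideal n N)" for x
    using high_ideal_add[OF assms, of "x - p"]
      high_ideal_add[OF high_ideal_uminus[OF assms], of "x - r"] by (auto simp: algebra_simps)
  then show ?thesis using coset_memI coset_memD by blast
qed

text \<open>The representative is arbitrary; at low monomials the choice does not matter, because
  elements of the ideal have coefficient 0 there.\<close>

definition coset_coeff :: "'a::comm_ring_1 mpoly set \<Rightarrow> (nat \<Rightarrow>\<^sub>0 nat) \<Rightarrow> 'a" where
  "coset_coeff X \<mu> = Poly_Mapping.lookup (SOME p. p \<in> X) \<mu>"

lemma coset_coeff:
  assumes "\<mu> \<in> low_monoms n N"
  shows "coset_coeff (coset n N p) \<mu> = Poly_Mapping.lookup p \<mu>"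
proof -
  have "(SOME r. r \<in> coset n N p) \<in> coset n N p" using coset_self by (rule someI)
  then have "(SOME r. r \<in> coset n N p) - p \<in> high_ideal n N" by (rule coset_memD)
  then have "Poly_Mapping.lookup ((SOME r. r \<in> coset n N p) - p) \<mu> = 0"
    using assms high_ideal_iff[OF high_ideal_carrier] by blast
  then show ?thesis by (simp add: coset_coeff_def lookup_minus)
qed

lemma coset_eq_iff:
  assumes "p \<in> mpoly_carrier n" "r \<in> mpoly_carrier n"
  shows "coset n N p = coset n N r \<longleftrightarrow>
    (\<forall>\<mu>\<in>low_monoms n N. Poly_Mapping.lookup p \<mu> = Poly_Mapping.lookup r \<mu>)"
proof
  assume "coset n N p = coset n N r"
  then show "\<forall>\<mu>\<in>low_monoms n N. Poly_Mapping.lookup p \<mu> = Poly_Mapping.lookup r \<mu>"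
    by (metis coset_coeff)
next
  assume "\<forall>\<mu>\<in>low_monoms n N. Poly_Mapping.lookup p \<mu> = Poly_Mapping.lookup r \<mu>"
  then have "p - r \<in> high_ideal n N"
    using assms by (subst high_ideal_iff) (auto simp: mpoly_carrier_diff lookup_minus)
  then show "coset n N p = coset n N r" by (rule coset_eqI)
qed

lemma trunc_module_simps:
  shows "carrier (trunc_module n N) = coset n N ` (mpoly_carrier n :: 'a::comm_ring_1 mpoly set)"
    and "zero (trunc_module n N) = (coset n N 0 :: 'a mpoly set)"
    and "p \<in> mpoly_carrier n \<Longrightarrow> r \<in> mpoly_carrier n \<Longrightarrow>
      add (trunc_module n N) (coset n N p) (coset n N r) = coset n N (p + r :: 'a mpoly)"
    and "p \<in> mpoly_carrier n \<Longrightarrow> module.smult (trunc_module n N) c (coset n N p) = coset n N (Const c * p)"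
proof -
  interpret R: cring "mpoly_ring n :: 'a mpoly ring" by (rule cring_mpoly_ring)
  interpret I: ideal "power_ideal n N :: 'a mpoly set" "mpoly_ring n"
    unfolding power_ideal_eq by (rule ideal_high_ideal)
  show "carrier (trunc_module n N) = coset n N ` (mpoly_carrier n :: 'a mpoly set)"
    by (auto simp: trunc_module_def Let_def FactRing_def A_RCOSETS_def' coset_def)
  show "zero (trunc_module n N) = (coset n N 0 :: 'a mpoly set)"
    by (simp add: trunc_module_def Let_def FactRing_def coset_eq power_ideal_eq)
  show "add (trunc_module n N) (coset n N p) (coset n N r) = coset n N (p + r :: 'a mpoly)"
    if "p \<in> mpoly_carrier n" "r \<in> mpoly_carrier n" for p r
    using that I.a_rcos_sum[of p r] by (simp add: trunc_module_def Let_def FactRing_def coset_def)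
  show "module.smult (trunc_module n N) c (coset n N p) = coset n N (Const c * p :: 'a mpoly)"
    if "p \<in> mpoly_carrier n" for p
    using that I.rcoset_mult_add[of "Const c" p]
    by (simp add: trunc_module_def Let_def FactRing_def coset_def)
qed

section \<open>Linear systems and base change\<close>

definition solutions :: "'m set \<Rightarrow> ('m \<Rightarrow> 'k::field) set \<Rightarrow> ('m \<Rightarrow> 'k) set" where
  "solutions M A = {x \<in> supp_in M. \<forall>a\<in>A. (\<Sum>\<mu>\<in>M. a \<mu> * x \<mu>) = 0}"

lemma fun_subspace_solutions: "fun_subspace (solutions M A)"
  by (auto simp: fun_subspace_def solutions_def supp_in_def distrib_left sum.distrib
      mult.left_commute[of _ "_::'b"] sum_distrib_left[symmetric])

text \<open>The larger field is a vector space over the smaller one through \<iota>, and the nonzero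
  \<open>x\<close> alone is independent, so sending \<open>x\<close> to 1 extends to a linear
  functional.\<close>

lemma semilinear_functional_exists:
  fixes \<iota> :: "'f::field \<Rightarrow> 'k::field"
  assumes "field_hom \<iota>" "x \<noteq> 0"
  obtains l :: "'k \<Rightarrow> 'f" where "\<And>y z. l (y + z) = l y + l z" "\<And>a y. l (\<iota> a * y) = a * l y" "l x \<noteq> 0"
proof -
  interpret \<iota>: field_hom \<iota> by fact
  interpret vector_space_pair "\<lambda>a y. \<iota> a * y" "(*) :: 'f \<Rightarrow> 'f \<Rightarrow> 'f"
    by unfold_locales (auto simp: algebra_simps hom_distribs)
  have "vs1.independent {x}" using assms(2) by simp
  from linear_independent_extend[OF this, of "\<lambda>_. 1"] obtain l where
    l: "Vector_Spaces.linear (\<lambda>a y. \<iota> a * y) (*) l" "l x = 1" by auto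
  interpret l: Vector_Spaces.linear "\<lambda>a y. \<iota> a * y" "(*) :: 'f \<Rightarrow> 'f \<Rightarrow> 'f" l by fact
  show ?thesis using that[of l] l.add l.scale l(2) by simp
qed

text \<open>
  An \<open>f\<close>-linear functional on the larger field turns a nonzero solution that vanishes on \<open>J\<close>
  into one over the smaller field.
\<close>

lemma restriction_basis_base_change:
  fixes \<iota> :: "'f::field \<Rightarrow> 'k::field"
  assumes \<iota>: "field_hom \<iota>" and M: "finite M" "J \<subseteq> M" and J: "restriction_basis J (solutions M A)"
  shows "restriction_basis J (solutions M ((\<lambda>a \<mu>. \<iota> (a \<mu>)) ` A))"
proof (rule restriction_basisI[OF fun_subspace_solutions])
  interpret \<iota>: field_hom \<iota> by fact
  fix x :: "'a \<Rightarrow> 'k"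
  assume x: "x \<in> solutions M ((\<lambda>a \<mu>. \<iota> (a \<mu>)) ` A)" "\<And>j. j \<in> J \<Longrightarrow> x j = 0"
  show "x = (\<lambda>_. 0)"
  proof (rule ccontr)
    assume "x \<noteq> (\<lambda>_. 0)"
    then obtain \<mu>0 where "x \<mu>0 \<noteq> 0" by auto
    from semilinear_functional_exists[OF \<iota> this] obtain l where
      l: "\<And>y z. l (y + z) = l y + l z" "\<And>a y. l (\<iota> a * y) = a * l y" "l (x \<mu>0) \<noteq> 0" by metis
    have l0: "l 0 = 0" using l(2)[of 0 0] by simp
    have ls: "l (sum h B) = (\<Sum>b\<in>B. l (h b))" for h and B :: "'a set"
      by (induct B rule: infinite_finite_induct) (auto simp: l l0)
    have "(\<lambda>\<mu>. l (x \<mu>)) \<in> solutions M A"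
      unfolding solutions_def
    proof (intro CollectI conjI ballI)
      show "(\<lambda>\<mu>. l (x \<mu>)) \<in> supp_in M" using x(1) by (auto simp: solutions_def supp_in_def l0)
      fix a assume "a \<in> A"
      then have "(\<Sum>\<mu>\<in>M. \<iota> (a \<mu>) * x \<mu>) = 0" using x(1) by (auto simp: solutions_def)
      then have "l (\<Sum>\<mu>\<in>M. \<iota> (a \<mu>) * x \<mu>) = 0" by (simp add: l0)
      then show "(\<Sum>\<mu>\<in>M. a \<mu> * l (x \<mu>)) = 0" by (simp add: ls l)
    qed
    then have "(\<lambda>\<mu>. l (x \<mu>)) = (\<lambda>_. 0)"
      by (rule restriction_basis_zero[OF J fun_subspace_solutions]) (simp add: x l0)
    then show False using l(3) by (metis)
  qed
next
  interpret \<iota>: field_hom \<iota> by fact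
  fix y :: "'a \<Rightarrow> 'k"
  \<comment> \<open>Solutions dual to \<open>J\<close> over the smaller field remain solutions after
    \<iota>, and their combinations take every prescribed tuple of values on
    \<open>J\<close>.\<close>
  have "\<exists>b. b \<in> solutions M A \<and> (\<forall>i\<in>J. b i = (if i = j then 1 else 0))" for j
    using restriction_basis_ex[OF J, of "\<lambda>i. if i = j then 1 else 0"] by metis
  then obtain b where b: "\<And>j. b j \<in> solutions M A" "\<And>j i. i \<in> J \<Longrightarrow> b j i = (if i = j then 1 else 0)"
    by metis
  define x where "x \<mu> = (\<Sum>j\<in>J. y j * \<iota> (b j \<mu>))" for \<mu>
  have fJ: "finite J" using M by (rule finite_subset[rotated])
  have "x \<in> solutions M ((\<lambda>a \<mu>. \<iota> (a \<mu>)) ` A)"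
    unfolding solutions_def
  proof (intro CollectI conjI ballI)
    show "x \<in> supp_in M" using b(1) by (auto simp: solutions_def supp_in_def x_def)
    fix a' assume "a' \<in> (\<lambda>a \<mu>. \<iota> (a \<mu>)) ` A"
    then obtain a where a: "a \<in> A" "a' = (\<lambda>\<mu>. \<iota> (a \<mu>))" by auto
    have "(\<Sum>\<mu>\<in>M. a' \<mu> * x \<mu>) = (\<Sum>\<mu>\<in>M. \<Sum>j\<in>J. y j * \<iota> (a \<mu> * b j \<mu>))"
      by (simp add: a x_def sum_distrib_left hom_distribs mult_ac)
    also have "\<dots> = (\<Sum>j\<in>J. y j * \<iota> (\<Sum>\<mu>\<in>M. a \<mu> * b j \<mu>))"
      by (subst sum.swap) (simp add: sum_distrib_left hom_distribs)
    also have "\<dots> = 0" using b(1) a(1) by (auto simp: solutions_def)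
    finally show "(\<Sum>\<mu>\<in>M. a' \<mu> * x \<mu>) = 0" .
  qed
  moreover have "x i = y i" if "i \<in> J" for i
  proof -
    have "x i = (\<Sum>j\<in>J. if i = j then y j else 0)"
      unfolding x_def using that by (intro sum.cong) (auto simp: b(2))
    then show ?thesis using that fJ by simp
  qed
  ultimately show "\<exists>x\<in>solutions M ((\<lambda>a \<mu>. \<iota> (a \<mu>)) ` A). \<forall>j\<in>J. x j = y j" by blast
qed

text \<open>Each equation involves one degree only, so the homogeneous parts of a solution are
  solutions, and the sets found degree by degree glue together. One \<open>J\<close> thus serves the
  whole solution space and every graded piece.\<close>

lemma graded_restriction_basis:
  fixes A :: "('m \<Rightarrow> 'k::field) set" and deg :: "'m \<Rightarrow> nat"
  assumes M: "finite M" and A: "\<And>a. a \<in> A \<Longrightarrow> \<exists>d. \<forall>\<mu>\<in>M. deg \<mu> \<noteq> d \<longrightarrow> a \<mu> = 0"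
  obtains J where "J \<subseteq> M" "restriction_basis J (solutions M A)"
    "\<And>d. restriction_basis {\<mu>\<in>J. deg \<mu> = d} (solutions M A \<inter> supp_in {\<mu>\<in>M. deg \<mu> = d})"
proof -
  let ?S = "solutions M A" and ?M = "\<lambda>d. {\<mu>\<in>M. deg \<mu> = d}"
  have sub: "fun_subspace (?S \<inter> supp_in (?M d))" for d
    using fun_subspace_solutions[of M A] by (auto simp: fun_subspace_def supp_in_def)
  have "\<exists>J\<subseteq>?M d. restriction_basis J (?S \<inter> supp_in (?M d))" for d
    by (rule restriction_basis_exists[OF _ sub]) (use M in auto)
  then obtain J where J: "\<And>d. J d \<subseteq> ?M d" "\<And>d. restriction_basis (J d) (?S \<inter> supp_in (?M d))"
    by metis
  define J' where "J' = (\<Union>d. J d)"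
  have J': "{\<mu>\<in>J'. deg \<mu> = d} = J d" for d using J(1) by (auto simp: J'_def)
  have J'M: "J' \<subseteq> M" using J(1) by (auto simp: J'_def)
  define part where "part d x = (\<lambda>\<mu>. if deg \<mu> = d then x \<mu> else 0)" for d and x :: "'m \<Rightarrow> 'k"
  have part: "part d x \<in> ?S \<inter> supp_in (?M d)" if x: "x \<in> ?S" for d x
    unfolding solutions_def
  proof (intro CollectI conjI ballI IntI)
    show "part d x \<in> supp_in M" "part d x \<in> supp_in (?M d)"
      using x by (auto simp: solutions_def supp_in_def part_def)
    fix a assume a: "a \<in> A"
    then obtain d' where d': "\<forall>\<mu>\<in>M. deg \<mu> \<noteq> d' \<longrightarrow> a \<mu> = 0" using A by blast
    have "(\<Sum>\<mu>\<in>M. a \<mu> * part d x \<mu>) = (\<Sum>\<mu>\<in>M. if d = d' then a \<mu> * x \<mu> else 0)"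
      using d' by (intro sum.cong) (auto simp: part_def)
    also have "\<dots> = 0" using x a by (cases "d = d'") (auto simp: solutions_def)
    finally show "(\<Sum>\<mu>\<in>M. a \<mu> * part d x \<mu>) = 0" .
  qed
  have "restriction_basis J' ?S"
  proof (rule restriction_basisI[OF fun_subspace_solutions])
    fix x assume x: "x \<in> ?S" "\<And>j. j \<in> J' \<Longrightarrow> x j = 0"
    have z: "part d x = (\<lambda>_. 0)" for d
      by (rule restriction_basis_zero[OF J(2) sub part[OF x(1)]])
        (use x(2) J' in \<open>auto simp: part_def J'_def\<close>)
    have "x \<mu> = 0" for \<mu> using fun_cong[OF z[of "deg \<mu>"], of \<mu>] by (simp add: part_def)
    then show "x = (\<lambda>_. 0)" by auto
  next
    fix y :: "'m \<Rightarrow> 'k"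
    have "\<exists>x. x \<in> ?S \<inter> supp_in (?M d) \<and> (\<forall>j\<in>J d. x j = y j)" for d
      using restriction_basis_ex[OF J(2)[of d], of y] by metis
    then obtain x where x: "\<And>d. x d \<in> ?S \<inter> supp_in (?M d)" "\<And>d j. j \<in> J d \<Longrightarrow> x d j = y j" by metis
    \<comment> \<open>The solutions found in the separate degrees are glued by reading each one in
      its own degree.\<close>
    define w where "w \<mu> = x (deg \<mu>) \<mu>" for \<mu>
    have "w \<in> ?S" unfolding solutions_def
    proof (intro CollectI conjI ballI)
      show "w \<in> supp_in M" using x(1) by (auto simp: supp_in_def w_def)
      fix a assume a: "a \<in> A"
      then obtain d' where d': "\<forall>\<mu>\<in>M. deg \<mu> \<noteq> d' \<longrightarrow> a \<mu> = 0" using A by blast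
      have "(\<Sum>\<mu>\<in>M. a \<mu> * w \<mu>) = (\<Sum>\<mu>\<in>M. a \<mu> * x d' \<mu>)"
        using d' by (intro sum.cong) (auto simp: w_def)
      also have "\<dots> = 0" using x(1)[of d'] a by (auto simp: solutions_def)
      finally show "(\<Sum>\<mu>\<in>M. a \<mu> * w \<mu>) = 0" .
    qed
    moreover have "w j = y j" if "j \<in> J'" for j
      using that J' x(2)[of j "deg j"] by (auto simp: w_def)
    ultimately show "\<exists>x\<in>?S. \<forall>j\<in>J'. x j = y j" by blast
  qed
  then show ?thesis using that[of J'] J'M J' J(2) by auto
qed

section \<open>Degrees and homogeneous polynomials\<close>

definition mdeg :: "(nat \<Rightarrow>\<^sub>0 nat) \<Rightarrow> nat" where
  "mdeg \<mu> = (\<Sum>i\<in>Poly_Mapping.keys \<mu>. Poly_Mapping.lookup \<mu> i)"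

lemma mdeg_superset:
  "finite A \<Longrightarrow> Poly_Mapping.keys \<mu> \<subseteq> A \<Longrightarrow> mdeg \<mu> = (\<Sum>i\<in>A. Poly_Mapping.lookup \<mu> i)"
  unfolding mdeg_def by (intro sum.mono_neutral_left) (auto simp: in_keys_iff)

lemma mdeg_add: "mdeg (\<mu> + \<nu>) = mdeg \<mu> + mdeg \<nu>"
proof -
  let ?A = "Poly_Mapping.keys \<mu> \<union> Poly_Mapping.keys \<nu>"
  have "mdeg (\<mu> + \<nu>) = (\<Sum>i\<in>?A. Poly_Mapping.lookup (\<mu> + \<nu>) i)"
    using Poly_Mapping.keys_add[of \<mu> \<nu>] by (intro mdeg_superset) auto
  also have "\<dots> = (\<Sum>i\<in>?A. Poly_Mapping.lookup \<mu> i) + (\<Sum>i\<in>?A. Poly_Mapping.lookup \<nu> i)"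
    by (simp add: lookup_add sum.distrib)
  also have "\<dots> = mdeg \<mu> + mdeg \<nu>" by (subst (1 2) mdeg_superset[of ?A]) auto
  finally show ?thesis .
qed

lemma homogeneous_iff: "homogeneous d p \<longleftrightarrow> (\<forall>\<mu>\<in>Poly_Mapping.keys p. mdeg \<mu> = d)"
  by (simp add: homogeneous_def mdeg_def)

lemma homogeneous_mult: "homogeneous d p \<Longrightarrow> homogeneous e r \<Longrightarrow> homogeneous (d + e) (p * r)"
  unfolding homogeneous_iff
proof
  fix \<mu> assume pr: "\<forall>\<mu>\<in>Poly_Mapping.keys p. mdeg \<mu> = d" "\<forall>\<mu>\<in>Poly_Mapping.keys r. mdeg \<mu> = e"
    and "\<mu> \<in> Poly_Mapping.keys (p * r)"
  then obtain a b where "a \<in> Poly_Mapping.keys p" "b \<in> Poly_Mapping.keys r" "\<mu> = a + b"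
    using keys_mult[of p r] by auto
  then show "mdeg \<mu> = d + e" using pr by (simp add: mdeg_add)
qed

lemma homogeneous_one: "homogeneous 0 1"
  by (auto simp: homogeneous_iff mdeg_def)

lemma homogeneous_add: "homogeneous d p \<Longrightarrow> homogeneous d r \<Longrightarrow> homogeneous d (p + r)"
  using Poly_Mapping.keys_add[of p r] by (auto simp: homogeneous_iff)

lemma homogeneous_sum: "(\<And>a. a \<in> A \<Longrightarrow> homogeneous d (p a)) \<Longrightarrow> homogeneous d (sum p A)"
  by (induct A rule: infinite_finite_induct) (auto simp: homogeneous_add, auto simp: homogeneous_iff)

lemma homogeneous_power: "homogeneous d p \<Longrightarrow> homogeneous (k * d) (p ^ k)"
  by (induct k) (auto simp: homogeneous_one intro: homogeneous_mult)

lemma homogeneous_prod: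
  "(\<And>a. a \<in> A \<Longrightarrow> homogeneous (d a) (p a)) \<Longrightarrow> homogeneous (sum d A) (prod p A)"
  by (induct A rule: infinite_finite_induct) (auto simp: homogeneous_one intro: homogeneous_mult)

lemma homogeneous_monom_val:
  assumes "\<And>j. homogeneous 1 (f j)" shows "homogeneous (mdeg \<mu>) (monom_val f \<mu>)"
  unfolding monom_val_def mdeg_def
  by (intro homogeneous_prod) (use homogeneous_power[OF assms] in auto)

text \<open>Extension by 0 puts the coefficient vector into \<open>supp_in\<close>, where the linear
  algebra on solutions takes place.\<close>

definition cvec :: "nat \<Rightarrow> nat \<Rightarrow> 'a::comm_ring_1 mpoly set \<Rightarrow> (nat \<Rightarrow>\<^sub>0 nat) \<Rightarrow> 'a" where
  "cvec n N X = (\<lambda>\<mu>. if \<mu> \<in> low_monoms n N then coset_coeff X \<mu> else 0)"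

lemma cvec_coset:
  "cvec n N (coset n N p) = (\<lambda>\<mu>. if \<mu> \<in> low_monoms n N then Poly_Mapping.lookup p \<mu> else 0)"
  by (auto simp: cvec_def coset_coeff fun_eq_iff)

lemma cvec_supp: "cvec n N X \<in> supp_in (low_monoms n N)"
  by (auto simp: cvec_def supp_in_def)

lemma cvec_inj: "inj_on (cvec n N) (carrier (trunc_module n N))"
proof (rule inj_onI)
  fix X Y :: "'a mpoly set"
  assume "X \<in> carrier (trunc_module n N)" "Y \<in> carrier (trunc_module n N)" and e: "cvec n N X = cvec n N Y"
  then obtain p r where pr: "p \<in> mpoly_carrier n" "r \<in> mpoly_carrier n"
    and XY: "X = coset n N p" "Y = coset n N r" by (auto simp: trunc_module_simps)
  have "Poly_Mapping.lookup p \<mu> = Poly_Mapping.lookup r \<mu>" if "\<mu> \<in> low_monoms n N" for \<mu>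
    using fun_cong[OF e, of \<mu>] that by (simp add: XY cvec_coset)
  then show "X = Y" using pr XY by (simp add: coset_eq_iff)
qed

definition low_poly :: "nat \<Rightarrow> nat \<Rightarrow> ((nat \<Rightarrow>\<^sub>0 nat) \<Rightarrow> 'a::comm_ring_1) \<Rightarrow> 'a mpoly" where
  "low_poly n N x = (\<Sum>\<mu>\<in>low_monoms n N. Poly_Mapping.single \<mu> (x \<mu>))"

lemma low_poly_carrier: "low_poly n N x \<in> mpoly_carrier n"
  unfolding low_poly_def by (intro mpoly_carrier_sum mpoly_carrier_single) (auto simp: low_monoms_def)

lemma lookup_low_poly:
  "Poly_Mapping.lookup (low_poly n N x) \<mu> = (if \<mu> \<in> low_monoms n N then x \<mu> else 0)"
  by (auto simp: low_poly_def lookup_sum lookup_single when_def sum.delta)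

lemma cvec_low_poly: "x \<in> supp_in (low_monoms n N) \<Longrightarrow> cvec n N (coset n N (low_poly n N x)) = x"
  by (auto simp: cvec_coset lookup_low_poly supp_in_def fun_eq_iff)

lemma coset_low_poly_cvec:
  assumes "X \<in> carrier (trunc_module n N)"
  shows "X = coset n N (low_poly n N (cvec n N X))"
  by (rule inj_onD[OF cvec_inj]) (use assms low_poly_carrier in \<open>auto simp: cvec_low_poly cvec_supp trunc_module_simps\<close>)

text \<open>The carrier is given by a condition on coefficient vectors, so that the fixed module and
  its graded pieces are both covered.\<close>

lemma trunc_coordinates:
  fixes U :: "((nat \<Rightarrow>\<^sub>0 nat) \<Rightarrow> 'a::field) set"
  assumes U: "fun_subspace U" "U \<subseteq> supp_in (low_monoms n N)"
    and J: "J \<subseteq> low_monoms n N" "restriction_basis J U"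
    and V: "V = (trunc_module n N)\<lparr>carrier := {X \<in> carrier (trunc_module n N). cvec n N X \<in> U}\<rparr>"
  shows "coordinates V J (\<lambda>X. restrict (cvec n N X) J)"
proof -
  let ?T = "trunc_module n N :: ('a, 'a mpoly set) module"
  have bij: "bij_betw (cvec n N) (carrier V) U"
  proof (rule bij_betw_imageI)
    show "inj_on (cvec n N) (carrier V)" using cvec_inj V by (auto simp: inj_on_def)
    show "cvec n N ` carrier V = U"
    proof (intro equalityI subsetI)
      fix x assume x: "x \<in> U"
      then have "cvec n N (coset n N (low_poly n N x)) = x" using U(2) by (intro cvec_low_poly) auto
      then show "x \<in> cvec n N ` carrier V"
        using x low_poly_carrier by (intro image_eqI[of _ _ "coset n N (low_poly n N x)"]) (auto simp: V trunc_module_simps)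
    qed (auto simp: V)
  qed
  have add: "x \<oplus>\<^bsub>?T\<^esub> y \<in> carrier ?T \<and> cvec n N (x \<oplus>\<^bsub>?T\<^esub> y) = (\<lambda>\<mu>. 1 * cvec n N x \<mu> + cvec n N y \<mu>)"
    if xy: "x \<in> carrier ?T" "y \<in> carrier ?T" for x y
  proof -
    obtain p r where "p \<in> mpoly_carrier n" "r \<in> mpoly_carrier n" "x = coset n N p" "y = coset n N r"
      using xy by (auto simp: trunc_module_simps)
    then show ?thesis
      by (auto simp: trunc_module_simps mpoly_carrier_add cvec_coset lookup_add fun_eq_iff)
  qed
  have sm: "c \<odot>\<^bsub>?T\<^esub> x \<in> carrier ?T \<and> cvec n N (c \<odot>\<^bsub>?T\<^esub> x) = (\<lambda>\<mu>. c * cvec n N x \<mu> + 0)"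
    if x: "x \<in> carrier ?T" for c x
  proof -
    obtain p where "p \<in> mpoly_carrier n" "x = coset n N p"
      using x by (auto simp: trunc_module_simps)
    then show ?thesis
      by (auto simp: trunc_module_simps mpoly_carrier_mult cvec_coset lookup_Const_times fun_eq_iff)
  qed
  have z: "\<zero>\<^bsub>?T\<^esub> \<in> carrier ?T" "cvec n N (\<zero>\<^bsub>?T\<^esub>) = (\<lambda>_. 0)"
    by (auto simp: trunc_module_simps cvec_coset)
  have comb: "(\<lambda>\<mu>. c * x \<mu> + y \<mu>) \<in> U" if "x \<in> U" "y \<in> U" for c x y
    using fun_subspace_comb[OF U(1) that] .
  show ?thesis
    unfolding coordinates_def
  proof (intro conjI ballI allI)
    show "finite J" using J(1) finite_low_monoms by (rule finite_subset)
    show "bij_betw (\<lambda>X. restrict (cvec n N X) J) (carrier V) (J \<rightarrow>\<^sub>E UNIV)"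
      using bij_betw_trans[OF bij J(2)[unfolded restriction_basis_def]] by (simp add: comp_def)
    show "\<zero>\<^bsub>V\<^esub> \<in> carrier V" using z fun_subspace_zero[OF U(1)] by (simp add: V)
    show "restrict (cvec n N \<zero>\<^bsub>V\<^esub>) J j = 0" if "j \<in> J" for j using z that by (simp add: V)
  next
    fix x y assume xy: "x \<in> carrier V" "y \<in> carrier V"
    then show "x \<oplus>\<^bsub>V\<^esub> y \<in> carrier V" using add[of x y] comb[of "cvec n N x" "cvec n N y" 1] by (simp add: V)
    show "restrict (cvec n N (x \<oplus>\<^bsub>V\<^esub> y)) J j = restrict (cvec n N x) J j + restrict (cvec n N y) J j"
      if "j \<in> J" for j using add[of x y] that xy by (simp add: V)
  next
    fix c x assume x: "x \<in> carrier V"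
    then show "c \<odot>\<^bsub>V\<^esub> x \<in> carrier V"
      using sm[of x c] comb[of "cvec n N x" "\<lambda>_. 0" c] fun_subspace_zero[OF U(1)] by (simp add: V)
    show "restrict (cvec n N (c \<odot>\<^bsub>V\<^esub> x)) J j = c * restrict (cvec n N x) J j" if "j \<in> J" for j
      using sm[of x c] that x by (simp add: V)
  qed
qed

section \<open>Invariants of the truncated polynomial ring\<close>

text \<open>The vanishing of the inner binomial coefficients is assumed directly, since
  \<open>q\<close> is available only as the size of a finite field and not as a power of a named
  prime.\<close>

lemma add_power_binomial_zero:
  fixes a b :: "'a::comm_ring_1"
  assumes "q > 0" "\<And>i. 0 < i \<Longrightarrow> i < q \<Longrightarrow> of_nat (q choose i) = (0::'a)"
  shows "(a + b) ^ q = a ^ q + b ^ q"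
proof -
  have "(a + b) ^ q = (\<Sum>k\<le>q. of_nat (q choose k) * a ^ k * b ^ (q - k))" by (rule binomial_ring)
  also have "\<dots> = (\<Sum>k\<in>{0, q}. of_nat (q choose k) * a ^ k * b ^ (q - k))"
    using assms by (intro sum.mono_neutral_right) auto
  finally show ?thesis using assms(1) by simp
qed

lemma add_power_iterate:
  fixes a b :: "'a::comm_ring_1"
  assumes "\<And>a b :: 'a. (a + b) ^ q = a ^ q + b ^ q"
  shows "(a + b) ^ (q ^ m) = a ^ (q ^ m) + b ^ (q ^ m)"
  by (induct m) (simp_all only: power_Suc2 power_mult assms power_0 power_one_right)

text \<open>Multiplication by \<open>x\<close> permutes \<open>C\<close>; comparing the product over
  \<open>C\<close> before and after gives the identity.\<close>

lemma power_card_mult_closed: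
  fixes C :: "'a::field set"
  assumes C: "finite C" "0 \<notin> C" "\<And>x y. x \<in> C \<Longrightarrow> y \<in> C \<Longrightarrow> x * y \<in> C" and x: "x \<in> C"
  shows "x ^ card C = 1"
proof -
  have inj: "inj_on ((*) x) C" using C x by (auto simp: inj_on_def)
  have "(*) x ` C = C" using C x inj by (intro card_subset_eq) (auto simp: card_image)
  then have "\<Prod>C = (\<Prod>y\<in>C. x * y)" using inj prod.reindex[OF inj, of id] by (simp add: comp_def)
  also have "\<dots> = x ^ card C * \<Prod>C" by (simp add: prod.distrib)
  finally show ?thesis using C by (simp add: prod_zero_iff)
qed

lemma finite_field_power_card:
  fixes x :: "'f::{field,finite}"
  shows "x ^ card (UNIV :: 'f set) = x"
proof (cases "x = 0")
  case False
  have "x ^ card (UNIV - {0} :: 'f set) = 1" using False by (intro power_card_mult_closed) auto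
  moreover have "card (UNIV :: 'f set) = Suc (card (UNIV - {0} :: 'f set))"
    by (metis UNIV_I card.remove finite)
  ultimately show ?thesis by (metis power_Suc mult_1_right)
qed (simp add: finite_UNIV_card_ge_0)

text \<open>The polynomial \<open>(X + 1)\<^sup>q - X\<^sup>q - 1\<close> has degree less than \<open>q\<close> but vanishes at all \<open>q\<close> points.\<close>

lemma finite_field_choose_card:
  assumes "0 < i" "i < card (UNIV :: 'f set)"
  shows "of_nat (card (UNIV :: 'f set) choose i) = (0::'f::{field,finite})"
proof -
  define q where "q = card (UNIV :: 'f set)"
  have q0: "q > 0" by (simp add: q_def finite_UNIV_card_ge_0)
  define P :: "'f poly" where "P = (\<Sum>k\<in>{0<..<q}. Polynomial.monom (of_nat (q choose k)) k)"
  have c: "Polynomial.coeff P i = of_nat (q choose i)"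
    using assms by (simp add: P_def coeff_sum q_def if_distrib cong: if_cong)
  have "poly P x = 0" for x
  proof -
    have "(x + 1) ^ q = (\<Sum>k\<le>q. of_nat (q choose k) * x ^ k * 1 ^ (q - k))" by (rule binomial_ring)
    also have "{..q} = insert 0 (insert q {0<..<q})" using q0 by auto
    finally have "(x + 1) ^ q = 1 + (x ^ q + poly P x)"
      using q0 by (simp add: P_def poly_sum poly_monom)
    then show ?thesis by (simp add: q_def finite_field_power_card)
  qed
  then have "{x. poly P x = 0} = UNIV" by auto
  moreover have "Polynomial.degree P < q"
    using q0 unfolding P_def
    by (intro degree_sum_less) (auto intro: le_less_trans[OF degree_monom_le])
  ultimately have "P = 0" using card_poly_roots_bound[of P] by (force simp: q_def)
  then show ?thesis using c by (simp add: q_def)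
qed

lemma mpoly_of_nat: "of_nat k = Const (of_nat k :: 'a::comm_ring_1)"
  by (simp add: Const_def)

text \<open>The binomial coefficients vanish in the small field and hence in its extensions. Taking
  the identity for \<iota> covers the small field as well.\<close>

lemma frobenius_mpoly:
  fixes \<iota> :: "'f::{field,finite} \<Rightarrow> 'k::field" and a b :: "'k mpoly"
  assumes "field_hom \<iota>" "card (UNIV :: 'f set) = q"
  shows "(a + b) ^ (q ^ m) = a ^ (q ^ m) + b ^ (q ^ m)"
proof (rule add_power_iterate)
  interpret \<iota>: field_hom \<iota> by fact
  have q0: "q > 0" using assms(2) finite_UNIV_card_ge_0[where 'a = 'f] by simp
  have "of_nat (q choose i) = (0 :: 'k mpoly)" if "0 < i" "i < q" for i
  proof -
    have "of_nat (q choose i) = (0 :: 'f)"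
      using finite_field_choose_card[where 'f = 'f, unfolded assms(2), OF that] .
    then have "\<iota> (of_nat (q choose i)) = \<iota> 0" by (rule arg_cong)
    then have "(of_nat (q choose i) :: 'k) = 0" by (simp add: hom_distribs)
    then show ?thesis by (simp add: mpoly_of_nat)
  qed
  then show "(a + b) ^ q = a ^ q + b ^ q" for a b :: "'k mpoly"
    using q0 by (rule add_power_binomial_zero[rotated])
qed

lemma sum_power_additive:
  fixes h :: "'b \<Rightarrow> 'a::comm_ring_1"
  assumes "\<And>a b :: 'a. (a + b) ^ N = a ^ N + b ^ N" "N > 0"
  shows "(\<Sum>i\<in>A. h i) ^ N = (\<Sum>i\<in>A. h i ^ N)"
  by (induct A rule: infinite_finite_induct) (auto simp: assms power_0_left)

section \<open>Linear substitutions\<close>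

definition mat_lin :: "'a::comm_ring_1 mat \<Rightarrow> nat \<Rightarrow> 'a mpoly" where
  "mat_lin g j = (\<Sum>i<dim_row g. Const (g $$ (i, j)) * Var i)"

lemma mat_subst_lin: "mat_subst g = poly_subst (mat_lin g)"
  by (simp add: mat_subst_def mat_lin_def[abs_def])

lemma mat_lin_carrier: "g \<in> carrier_mat n n \<Longrightarrow> mat_lin g j \<in> mpoly_carrier n"
  unfolding mat_lin_def by (intro mpoly_carrier_sum mpoly_carrier_mult) auto

lemma mat_subst_carrier: "g \<in> carrier_mat n n \<Longrightarrow> p \<in> mpoly_carrier n \<Longrightarrow> mat_subst g p \<in> mpoly_carrier n"
  unfolding mat_subst_lin by (intro mpoly_carrier_poly_subst mat_lin_carrier)

lemma homogeneous_mat_lin: "homogeneous 1 (mat_lin g j)"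
  unfolding mat_lin_def
  by (intro homogeneous_sum) (auto simp: homogeneous_iff Const_def Var_def mult_single mdeg_def)

text \<open>Additivity of the \<open>N\<close>-th power turns the image of \<open>Var j ^ N\<close>
  into a combination of the \<open>Var i ^ N\<close>, so the generators stay in the ideal.\<close>

lemma mat_subst_high_ideal:
  fixes g :: "'a::comm_ring_1 mat"
  assumes g: "g \<in> carrier_mat n n" and N: "N > 0"
    and frob: "\<And>a b :: 'a mpoly. (a + b) ^ N = a ^ N + b ^ N" and p: "p \<in> high_ideal n N"
  shows "mat_subst g p \<in> high_ideal n N"
proof -
  have "mat_lin g j ^ N = (\<Sum>i<n. Const (g $$ (i, j)) ^ N * Var i ^ N)" for j
    using g by (simp add: mat_lin_def sum_power_additive[OF frob N] power_mult_distrib)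
  moreover have "Const (g $$ (i, j)) ^ N * Var i ^ N \<in> high_ideal n N" if "i < n" for i j
  proof -
    have "Var i ^ N \<in> high_ideal n N"
      unfolding Var_power using that by (intro single_in_high_ideal[of _ _ i]) auto
    from high_ideal_mult[OF this, of "Const (g $$ (i, j)) ^ N"] show ?thesis
      by (simp add: mpoly_carrier_power mult.commute)
  qed
  ultimately have lin: "mat_lin g j ^ N \<in> high_ideal n N" for j by (auto intro: high_ideal_sum)
  have "Const c * monom_val (mat_lin g) \<mu> \<in> high_ideal n N" if \<mu>: "\<mu> \<in> Poly_Mapping.keys p" for \<mu> c
  proof -
    obtain i where i: "i < n" "N \<le> Poly_Mapping.lookup \<mu> i" using p \<mu> by (auto simp: high_ideal_def)
    have k: "Poly_Mapping.keys \<mu> \<subseteq> {..<n}" using p \<mu> by (auto simp: high_ideal_def mpoly_carrier_def)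
    have "monom_val (mat_lin g) \<mu> = (\<Prod>j<n. mat_lin g j ^ Poly_Mapping.lookup \<mu> j)"
      using k by (intro monom_val_superset) auto
    also have "\<dots> = mat_lin g i ^ Poly_Mapping.lookup \<mu> i *
        (\<Prod>j\<in>{..<n} - {i}. mat_lin g j ^ Poly_Mapping.lookup \<mu> j)"
      using i by (intro prod.remove) auto
    also have "\<dots> = mat_lin g i ^ N * (mat_lin g i ^ (Poly_Mapping.lookup \<mu> i - N) *
        (\<Prod>j\<in>{..<n} - {i}. mat_lin g j ^ Poly_Mapping.lookup \<mu> j))"
      using i by (simp add: power_add[symmetric] mult.assoc[symmetric])
    finally have "Const c * monom_val (mat_lin g) \<mu> = mat_lin g i ^ N * (Const c *
        (mat_lin g i ^ (Poly_Mapping.lookup \<mu> i - N) *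
        (\<Prod>j\<in>{..<n} - {i}. mat_lin g j ^ Poly_Mapping.lookup \<mu> j)))"
      by (simp add: mult_ac)
    then show ?thesis
      using g lin by (auto intro!: high_ideal_mult mpoly_carrier_mult mpoly_carrier_power
          mpoly_carrier_prod mat_lin_carrier)
  qed
  then show ?thesis
    unfolding mat_subst_lin poly_subst_def monom_val_def[symmetric] by (intro high_ideal_sum) auto
qed

text \<open>Column \<open>j\<close> of a matrix gives the image of \<open>Var j\<close>; with this
  convention composition follows the matrix product in the same order, so the action is a left
  action.\<close>

lemma mat_subst_mult:
  assumes "g \<in> carrier_mat n n" "h \<in> carrier_mat n n" "p \<in> mpoly_carrier n"
  shows "mat_subst g (mat_subst h p) = mat_subst (g * h) p"
  unfolding mat_subst_lin poly_subst_comp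
proof (rule poly_subst_cong[OF _ assms(3)])
  fix j assume j: "j < n"
  have Const_sum: "Const (sum f A) = (\<Sum>a\<in>A. Const (f a))" for f :: "nat \<Rightarrow> 'a" and A
    by (induct A rule: infinite_finite_induct) (auto simp: Const_add)
  have "poly_subst (mat_lin g) (mat_lin h j) =
      (\<Sum>i<n. \<Sum>l<n. Const (h $$ (i, j) * g $$ (l, i)) * Var l)"
    using assms by (simp add: mat_lin_def[of h] poly_subst_sum poly_subst_mult)
      (simp add: mat_lin_def sum_distrib_left Const_mult mult.assoc)
  also have "\<dots> = (\<Sum>l<n. \<Sum>i<n. Const (h $$ (i, j) * g $$ (l, i)) * Var l)" by (rule sum.swap)
  also have "\<dots> = (\<Sum>l<n. Const ((g * h) $$ (l, j)) * Var l)"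
  proof (intro sum.cong refl)
    fix l assume "l \<in> {..<n}"
    then have "(g * h) $$ (l, j) = (\<Sum>i<n. h $$ (i, j) * g $$ (l, i))"
      using assms j by (simp add: scalar_prod_def mult.commute lessThan_atLeast0)
    then show "(\<Sum>i<n. Const (h $$ (i, j) * g $$ (l, i)) * Var l) = Const ((g * h) $$ (l, j)) * Var l"
      by (simp only: Const_sum sum_distrib_right)
  qed
  finally show "poly_subst (mat_lin g) (mat_lin h j) = mat_lin (g * h) j"
    using assms by (simp add: mat_lin_def)
qed

lemma mat_subst_one: "p \<in> mpoly_carrier n \<Longrightarrow> mat_subst (1\<^sub>m n) p = p"
proof -
  assume p: "p \<in> mpoly_carrier n"
  have "mat_lin (1\<^sub>m n :: 'a mat) j = Var j" if "j < n" for j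
  proof -
    have "mat_lin (1\<^sub>m n :: 'a mat) j = (\<Sum>i<n. if i = j then Var i else 0)"
      unfolding mat_lin_def using that by (intro sum.cong) auto
    then show ?thesis using that by simp
  qed
  then have "poly_subst (mat_lin (1\<^sub>m n)) p = poly_subst Var p" using p by (rule poly_subst_cong)
  then show ?thesis by (simp add: mat_subst_lin poly_subst_id)
qed

text \<open>The direct image fills the whole coset only if the ideal is hit in full; a right inverse
  \<open>\<tau>\<close> that preserves the ideal provides this.\<close>

lemma image_coset:
  assumes \<sigma>: "\<And>x y. \<sigma> (x + y) = \<sigma> x + \<sigma> y" "\<And>x. x \<in> high_ideal n N \<Longrightarrow> \<sigma> x \<in> high_ideal n N"
    and \<tau>: "\<And>x. x \<in> high_ideal n N \<Longrightarrow> \<tau> x \<in> high_ideal n N"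
    and inv: "\<And>x. x \<in> mpoly_carrier n \<Longrightarrow> \<sigma> (\<tau> x) = x"
  shows "\<sigma> ` coset n N p = coset n N (\<sigma> p)"
proof
  show "\<sigma> ` coset n N p \<subseteq> coset n N (\<sigma> p)" unfolding coset_eq using \<sigma> by auto
  show "coset n N (\<sigma> p) \<subseteq> \<sigma> ` coset n N p"
  proof
    fix x assume "x \<in> coset n N (\<sigma> p)"
    then obtain r where r: "r \<in> high_ideal n N" "x = r + \<sigma> p" unfolding coset_eq by auto
    then have "x = \<sigma> (\<tau> r + p)" using \<sigma>(1) inv high_ideal_carrier by metis
    moreover have "\<tau> r + p \<in> coset n N p" unfolding coset_eq using \<tau>[OF r(1)] by auto
    ultimately show "x \<in> \<sigma> ` coset n N p" by blast
  qed
qed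

text \<open>\<open>invertible_mat\<close> leaves the size of the inverse open; it is read off from
  the dimensions of the two products.\<close>

lemma invertible_matE:
  assumes "g \<in> carrier_mat n n" "invertible_mat (g :: 'a::comm_ring_1 mat)"
  obtains h where "h \<in> carrier_mat n n" "g * h = 1\<^sub>m n" "h * g = 1\<^sub>m n"
proof -
  obtain h where h: "g * h = 1\<^sub>m n" "h * g = 1\<^sub>m (dim_row h)"
    using assms by (auto simp: invertible_mat_def inverts_mat_def)
  have "dim_col (g * h) = n" using h(1) by simp
  moreover have "dim_col (h * g) = dim_row h" using h(2) by simp
  ultimately have "h \<in> carrier_mat n n" using assms(1) by auto
  then show ?thesis using that h by auto
qed

text \<open>The entry in row \<open>\<nu>\<close> and column \<open>\<mu>\<close> of the matrix by
  which \<open>g\<close> acts on monomials.\<close>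

definition mat_coeff :: "'a::comm_ring_1 mat \<Rightarrow> (nat \<Rightarrow>\<^sub>0 nat) \<Rightarrow> (nat \<Rightarrow>\<^sub>0 nat) \<Rightarrow> 'a" where
  "mat_coeff g \<nu> \<mu> = Poly_Mapping.lookup (monom_val (mat_lin g) \<mu>) \<nu>"

lemma mat_coeff_mdeg: "mdeg \<mu> \<noteq> mdeg \<nu> \<Longrightarrow> mat_coeff g \<nu> \<mu> = 0"
  using homogeneous_monom_val[of "mat_lin g" \<mu>, OF homogeneous_mat_lin]
  by (metis homogeneous_iff in_keys_iff mat_coeff_def)

lemma trunc_mat_act:
  fixes g :: "'a::field mat"
  assumes g: "g \<in> carrier_mat n n" "invertible_mat g" and N: "N > 0"
    and frob: "\<And>a b :: 'a mpoly. (a + b) ^ N = a ^ N + b ^ N"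
    and X: "X \<in> carrier (trunc_module n N)"
  shows "trunc_mat_act g X \<in> carrier (trunc_module n N)"
    and "\<nu> \<in> low_monoms n N \<Longrightarrow> cvec n N (trunc_mat_act g X) \<nu> =
      (\<Sum>\<mu>\<in>low_monoms n N. mat_coeff g \<nu> \<mu> * cvec n N X \<mu>)"
proof -
  obtain h where h: "h \<in> carrier_mat n n" "g * h = 1\<^sub>m n" using invertible_matE[OF g] by metis
  define p where "p = low_poly n N (cvec n N X)"
  have p: "p \<in> mpoly_carrier n" "X = coset n N p"
    using coset_low_poly_cvec[OF X] low_poly_carrier by (auto simp: p_def)
  have act: "trunc_mat_act g X = coset n N (mat_subst g p)"
    unfolding trunc_mat_act_def p(2)
  proof (rule image_coset[where \<tau> = "mat_subst h"])
    show "mat_subst g (x + y) = mat_subst g x + mat_subst g y" for x y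
      by (simp add: mat_subst_lin poly_subst_add)
    show "mat_subst g (mat_subst h x) = x" if "x \<in> mpoly_carrier n" for x
      using mat_subst_mult[OF g(1) h(1) that] h(2) mat_subst_one[OF that] by simp
  qed (use mat_subst_high_ideal[OF g(1) N frob] mat_subst_high_ideal[OF h(1) N frob] in auto)
  show "trunc_mat_act g X \<in> carrier (trunc_module n N)"
    using mat_subst_carrier[OF g(1) p(1)] by (auto simp: act trunc_module_simps)
  assume \<nu>: "\<nu> \<in> low_monoms n N"
  have "poly_subst (mat_lin g) p =
      (\<Sum>\<mu>\<in>low_monoms n N. Const (cvec n N X \<mu>) * monom_val (mat_lin g) \<mu>)"
    by (simp add: p_def low_poly_def poly_subst_sum poly_subst_single)
  then show "cvec n N (trunc_mat_act g X) \<nu> =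
      (\<Sum>\<mu>\<in>low_monoms n N. mat_coeff g \<nu> \<mu> * cvec n N X \<mu>)"
    using \<nu> by (simp add: act cvec_coset mat_subst_lin lookup_sum lookup_Const_times mat_coeff_def
        mult.commute[of "cvec n N X _"])
qed

text \<open>The rows of the matrices of \<open>g - 1\<close> on the low monomials, for all
  \<open>g\<close> in \<open>H\<close>; their common kernel consists of the invariants.\<close>

definition fix_eqs :: "nat \<Rightarrow> nat \<Rightarrow> 'a::field mat set \<Rightarrow> ((nat \<Rightarrow>\<^sub>0 nat) \<Rightarrow> 'a) set" where
  "fix_eqs n N H = (\<lambda>(g, \<nu>) \<mu>. mat_coeff g \<nu> \<mu> - (if \<mu> = \<nu> then 1 else 0)) ` (H \<times> low_monoms n N)"

lemma fix_eqs_graded: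
  assumes "a \<in> fix_eqs n N H" shows "\<exists>d. \<forall>\<mu>\<in>low_monoms n N. mdeg \<mu> \<noteq> d \<longrightarrow> a \<mu> = 0"
proof -
  obtain g \<nu> where a: "a = (\<lambda>\<mu>. mat_coeff g \<nu> \<mu> - (if \<mu> = \<nu> then 1 else 0))"
    using assms by (auto simp: fix_eqs_def)
  show ?thesis by (rule exI[of _ "mdeg \<nu>"]) (auto simp: a mat_coeff_mdeg)
qed

lemma fixed_module_trunc:
  fixes H :: "'a::field mat set"
  assumes H: "\<And>g. g \<in> H \<Longrightarrow> g \<in> carrier_mat n n \<and> invertible_mat g" and N: "N > 0"
    and frob: "\<And>a b :: 'a mpoly. (a + b) ^ N = a ^ N + b ^ N"
  shows "fixed_module H trunc_mat_act (trunc_module n N) = (trunc_module n N)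
    \<lparr>carrier := {X \<in> carrier (trunc_module n N). cvec n N X \<in> solutions (low_monoms n N) (fix_eqs n N H)}\<rparr>"
proof -
  have "trunc_mat_act g X = X \<longleftrightarrow> (\<forall>\<nu>\<in>low_monoms n N. (\<Sum>\<mu>\<in>low_monoms n N.
      (mat_coeff g \<nu> \<mu> - (if \<mu> = \<nu> then 1 else 0)) * cvec n N X \<mu>) = 0)"
    if g: "g \<in> H" and X: "X \<in> carrier (trunc_module n N)" for g X
  proof -
    note act = trunc_mat_act[OF conjunct1[OF H[OF g]] conjunct2[OF H[OF g]] N frob X]
    have s: "(\<Sum>\<mu>\<in>low_monoms n N. (mat_coeff g \<nu> \<mu> - (if \<mu> = \<nu> then 1 else 0)) * cvec n N X \<mu>)
        = cvec n N (trunc_mat_act g X) \<nu> - cvec n N X \<nu>" if "\<nu> \<in> low_monoms n N" for \<nu>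
    proof -
      have "(\<Sum>\<mu>\<in>low_monoms n N. (if \<mu> = \<nu> then 1 else 0) * cvec n N X \<mu>) =
          (\<Sum>\<mu>\<in>low_monoms n N. if \<mu> = \<nu> then cvec n N X \<mu> else 0)" by (intro sum.cong) auto
      then show ?thesis using that by (simp add: act left_diff_distrib sum_subtractf)
    qed
    have "trunc_mat_act g X = X \<longleftrightarrow> cvec n N (trunc_mat_act g X) = cvec n N X"
      using cvec_inj act(1) X by (auto dest: inj_onD)
    also have "\<dots> \<longleftrightarrow> (\<forall>\<nu>\<in>low_monoms n N. cvec n N (trunc_mat_act g X) \<nu> = cvec n N X \<nu>)"
      by (auto simp: fun_eq_iff cvec_def)
    finally show ?thesis using s by simp
  qed
  then have "{x \<in> carrier (trunc_module n N). \<forall>h\<in>H. trunc_mat_act h x = x} =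
    {X \<in> carrier (trunc_module n N). cvec n N X \<in> solutions (low_monoms n N) (fix_eqs n N H)}"
    by (auto simp: solutions_def cvec_supp fix_eqs_def)
  then show ?thesis by (simp add: fixed_module_def)
qed

section \<open>Scalars, graded pieces and base change of the invariants\<close>

lemma monom_val_scalar:
  "monom_val (\<lambda>i. Const \<gamma> * Var i) \<mu> = Poly_Mapping.single \<mu> (\<gamma> ^ mdeg \<mu>)"
proof -
  have "monom_val (\<lambda>i. Const \<gamma> * Var i) \<mu> = Const \<gamma> ^ mdeg \<mu> * monom_val Var \<mu>"
    unfolding monom_val_def mdeg_def by (simp add: power_mult_distrib prod.distrib power_sum)
  moreover have "Const \<gamma> ^ k = Const (\<gamma> ^ k)" for k by (induct k) (auto simp: Const_mult)
  ultimately show ?thesis by (simp add: monom_val_Var Const_times_single)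
qed

lemma lookup_scalar_subst:
  "Poly_Mapping.lookup (scalar_subst \<gamma> p) \<mu> = \<gamma> ^ mdeg \<mu> * Poly_Mapping.lookup p \<mu>"
  unfolding scalar_subst_def
  by (induct p rule: mpoly_induct)
    (auto simp: poly_subst_add poly_subst_single monom_val_scalar Const_times_single lookup_add
      lookup_single when_def distrib_left)

lemma keys_scalar_subst: "Poly_Mapping.keys (scalar_subst \<gamma> p) \<subseteq> Poly_Mapping.keys p"
proof
  fix \<mu> assume "\<mu> \<in> Poly_Mapping.keys (scalar_subst \<gamma> p)"
  then have "\<gamma> ^ mdeg \<mu> * Poly_Mapping.lookup p \<mu> \<noteq> 0" unfolding in_keys_iff lookup_scalar_subst .
  then show "\<mu> \<in> Poly_Mapping.keys p" by (metis in_keys_iff mult_zero_right)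
qed

lemma trunc_scalar_act:
  fixes \<gamma> :: "'a::field"
  assumes \<gamma>: "\<gamma> \<noteq> 0" and X: "X \<in> carrier (trunc_module n N)"
  shows "trunc_scalar_act \<gamma> X \<in> carrier (trunc_module n N)"
    and "cvec n N (trunc_scalar_act \<gamma> X) = (\<lambda>\<mu>. \<gamma> ^ mdeg \<mu> * cvec n N X \<mu>)"
proof -
  obtain p where p: "p \<in> mpoly_carrier n" "X = coset n N p" using X by (auto simp: trunc_module_simps)
  have hi: "scalar_subst c x \<in> high_ideal n N" if "x \<in> high_ideal n N" for c :: 'a and x
    using that keys_scalar_subst[of c x] unfolding high_ideal_def mpoly_carrier_def by blast
  have act: "trunc_scalar_act \<gamma> X = coset n N (scalar_subst \<gamma> p)"
    unfolding trunc_scalar_act_def p(2)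
  proof (rule image_coset[where \<tau> = "scalar_subst (inverse \<gamma>)"])
    show "scalar_subst \<gamma> (x + y) = scalar_subst \<gamma> x + scalar_subst \<gamma> y" for x y
      by (simp add: scalar_subst_def poly_subst_add)
    show "scalar_subst \<gamma> (scalar_subst (inverse \<gamma>) x) = x" for x
      using \<gamma> by (intro poly_mapping_eqI)
        (simp add: lookup_scalar_subst mult.assoc[symmetric] power_mult_distrib[symmetric])
  qed (use hi in auto)
  have "scalar_subst \<gamma> p \<in> mpoly_carrier n"
    using p(1) keys_scalar_subst[of \<gamma> p] unfolding mpoly_carrier_def by blast
  then show "trunc_scalar_act \<gamma> X \<in> carrier (trunc_module n N)" by (auto simp: act trunc_module_simps)
  show "cvec n N (trunc_scalar_act \<gamma> X) = (\<lambda>\<mu>. \<gamma> ^ mdeg \<mu> * cvec n N X \<mu>)"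
    unfolding act by (auto simp: p(2) cvec_coset lookup_scalar_subst fun_eq_iff)
qed

text \<open>On an equation that lives in degree \<open>d\<close> the scaling acts as multiplication
  by the constant \<open>\<gamma> ^ d\<close>.\<close>

lemma solutions_scale_graded:
  fixes deg :: "'m \<Rightarrow> nat" and \<gamma> :: "'a::field"
  assumes A: "\<And>a. a \<in> A \<Longrightarrow> \<exists>d. \<forall>\<mu>\<in>M. deg \<mu> \<noteq> d \<longrightarrow> a \<mu> = 0" and x: "x \<in> solutions M A"
  shows "(\<lambda>\<mu>. \<gamma> ^ deg \<mu> * x \<mu>) \<in> solutions M A"
  unfolding solutions_def
proof (intro CollectI conjI ballI)
  show "(\<lambda>\<mu>. \<gamma> ^ deg \<mu> * x \<mu>) \<in> supp_in M" using x by (auto simp: solutions_def supp_in_def)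
  fix a assume a: "a \<in> A"
  then obtain d where d: "\<forall>\<mu>\<in>M. deg \<mu> \<noteq> d \<longrightarrow> a \<mu> = 0" using A by blast
  have "(\<Sum>\<mu>\<in>M. a \<mu> * (\<gamma> ^ deg \<mu> * x \<mu>)) = (\<Sum>\<mu>\<in>M. \<gamma> ^ d * (a \<mu> * x \<mu>))"
  proof (intro sum.cong refl)
    fix \<mu> assume "\<mu> \<in> M" then show "a \<mu> * (\<gamma> ^ deg \<mu> * x \<mu>) = \<gamma> ^ d * (a \<mu> * x \<mu>)"
      using d by (cases "deg \<mu> = d") auto
  qed
  also have "\<dots> = \<gamma> ^ d * (\<Sum>\<mu>\<in>M. a \<mu> * x \<mu>)" by (simp add: sum_distrib_left)
  also have "\<dots> = 0" using x a by (simp add: solutions_def)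
  finally show "(\<Sum>\<mu>\<in>M. a \<mu> * (\<gamma> ^ deg \<mu> * x \<mu>)) = 0" .
qed

text \<open>\<open>low_poly\<close> keeps those terms of a representative that lie outside the
  ideal, so it is homogeneous as soon as some representative is.\<close>

lemma graded_part_trunc:
  assumes U: "U \<subseteq> supp_in (low_monoms n N)"
    and V: "V = (trunc_module n N)\<lparr>carrier := {X \<in> carrier (trunc_module n N). cvec n N X \<in> U}\<rparr>"
  shows "graded_part n N V d = (trunc_module n N)\<lparr>carrier := {X \<in> carrier (trunc_module n N).
    cvec n N X \<in> U \<inter> supp_in {\<mu>\<in>low_monoms n N. mdeg \<mu> = d}}\<rparr>"
proof -
  have "(\<exists>p\<in>carrier (mpoly_ring n). homogeneous d p \<and> X = coset n N p) \<longleftrightarrow>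
      cvec n N X \<in> supp_in {\<mu>\<in>low_monoms n N. mdeg \<mu> = d}"
    if X: "X \<in> carrier (trunc_module n N)" for X :: "'a mpoly set"
  proof
    assume "\<exists>p\<in>carrier (mpoly_ring n). homogeneous d p \<and> X = coset n N p"
    then obtain p where "homogeneous d p" "X = coset n N p" by blast
    then show "cvec n N X \<in> supp_in {\<mu>\<in>low_monoms n N. mdeg \<mu> = d}"
      unfolding supp_in_def homogeneous_iff by (auto simp: cvec_coset in_keys_iff)
  next
    assume s: "cvec n N X \<in> supp_in {\<mu>\<in>low_monoms n N. mdeg \<mu> = d}"
    have "homogeneous d (low_poly n N (cvec n N X))"
      unfolding homogeneous_iff
    proof
      fix \<mu> assume "\<mu> \<in> Poly_Mapping.keys (low_poly n N (cvec n N X))"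
      then have "cvec n N X \<mu> \<noteq> 0" unfolding in_keys_iff lookup_low_poly by (simp split: if_splits)
      then show "mdeg \<mu> = d" using s by (auto simp: supp_in_def)
    qed
    then show "\<exists>p\<in>carrier (mpoly_ring n). homogeneous d p \<and> X = coset n N p"
      using coset_low_poly_cvec[OF X] low_poly_carrier by (intro bexI) auto
  qed
  then show ?thesis unfolding graded_part_def V by (auto intro!: arg_cong[where f = "\<lambda>c. _ \<lparr>carrier := c\<rparr>"])
qed

text \<open>The entries of the action matrix are integer polynomials in the entries of
  \<open>g\<close>, so they commute with field homomorphisms. The map \<open>m\<close>, which
  applies \<iota> to each coefficient, is a ring homomorphism.\<close>

lemma map_mpoly_mat_coeff:
  fixes \<iota> :: "'f::field \<Rightarrow> 'k::field"
  assumes "field_hom \<iota>" "g \<in> carrier_mat n n" "Poly_Mapping.keys \<mu> \<subseteq> {..<n}"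
  shows "mat_coeff (map_mat \<iota> g) \<nu> \<mu> = \<iota> (mat_coeff g \<nu> \<mu>)"
proof -
  interpret \<iota>: field_hom \<iota> by fact
  define m :: "'f mpoly \<Rightarrow> 'k mpoly" where "m = Poly_Mapping.map \<iota>"
  have lm: "Poly_Mapping.lookup (m p) \<kappa> = \<iota> (Poly_Mapping.lookup p \<kappa>)" for p \<kappa>
    by (simp add: m_def Poly_Mapping.map.rep_eq when_def)
  have add: "m (p + r) = m p + m r" for p r
    by (rule poly_mapping_eqI) (simp add: lm lookup_add hom_distribs)
  have m_single: "m (Poly_Mapping.single \<kappa> c) = Poly_Mapping.single \<kappa> (\<iota> c)" for \<kappa> c
    by (rule poly_mapping_eqI) (simp add: lm lookup_single when_def)
  have mult: "m (p * r) = m p * m r" for p r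
  proof (induct p rule: mpoly_induct)
    case (single \<kappa> c)
    show ?case
    proof (induct r rule: mpoly_induct)
      case (single \<kappa>' d)
      show ?case by (simp add: mult_single m_single hom_distribs)
    qed (simp add: distrib_left add)
  qed (simp add: distrib_right add)
  have one: "m 1 = 1" using m_single[of 0 1] by simp
  have zero: "m 0 = 0" using m_single[of 0 0] by simp
  have power: "m (p ^ k) = m p ^ k" for p k by (induct k) (auto simp: one mult)
  have prod: "m (\<Prod>j\<in>A. h j) = (\<Prod>j\<in>A. m (h j))" for h and A :: "nat set"
    by (induct A rule: infinite_finite_induct) (auto simp: one mult)
  have sum: "m (\<Sum>j\<in>A. h j) = (\<Sum>j\<in>A. m (h j))" for h and A :: "nat set"
    by (induct A rule: infinite_finite_induct) (auto simp: zero add)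
  have lin: "m (mat_lin g j) = mat_lin (map_mat \<iota> g) j" if "j < n" for j
    using assms(2) that by (simp add: mat_lin_def sum mult Const_def Var_def m_single)
  have "m (monom_val (mat_lin g) \<mu>) = monom_val (\<lambda>j. m (mat_lin g j)) \<mu>"
    by (simp add: monom_val_def prod power)
  also have "\<dots> = monom_val (mat_lin (map_mat \<iota> g)) \<mu>"
    using assms(3) lin by (intro monom_val_cong) auto
  finally show ?thesis using lm[of "monom_val (mat_lin g) \<mu>" \<nu>] by (simp add: mat_coeff_def)
qed

lemma fix_eqs_base_change:
  fixes \<iota> :: "'f::field \<Rightarrow> 'k::field"
  assumes \<iota>: "field_hom \<iota>" and H: "H \<subseteq> carrier_mat n n"
  shows "solutions (low_monoms n N) (fix_eqs n N (map_mat \<iota> ` H)) =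
    solutions (low_monoms n N) ((\<lambda>a \<mu>. \<iota> (a \<mu>)) ` fix_eqs n N H)"
proof -
  interpret \<iota>: field_hom \<iota> by fact
  have "(\<Sum>\<mu>\<in>low_monoms n N. (mat_coeff (map_mat \<iota> g) \<nu> \<mu> - (if \<mu> = \<nu> then 1 else 0)) * x \<mu>) =
      (\<Sum>\<mu>\<in>low_monoms n N. \<iota> (mat_coeff g \<nu> \<mu> - (if \<mu> = \<nu> then 1 else 0)) * x \<mu>)"
    if "g \<in> H" for g \<nu> x
    using that H by (intro sum.cong refl)
      (auto simp: low_monoms_def map_mpoly_mat_coeff[OF \<iota>, of g n] hom_distribs)
  then show ?thesis by (auto simp: solutions_def fix_eqs_def)
qed

text \<open>One set of monomials serves both fields: its part of degree \<open>d\<close> gives the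
  dimension over the small field, about which the Hilbert series speaks, and the whole of it gives
  coordinates over the large field.\<close>

lemma trunc_fixed_coordinates:
  fixes \<iota> :: "'f::field \<Rightarrow> 'k::field"
  assumes \<iota>: "field_hom \<iota>" and N: "N > 0"
    and H: "\<And>g. g \<in> H \<Longrightarrow> g \<in> carrier_mat n n \<and> invertible_mat g"
    and frob: "\<And>a b :: 'f mpoly. (a + b) ^ N = a ^ N + b ^ N"
    and frob': "\<And>a b :: 'k mpoly. (a + b) ^ N = a ^ N + b ^ N"
  defines "V \<equiv> fixed_module (map_mat \<iota> ` H) trunc_mat_act (trunc_module n N)"
  obtains J where "finite J"
    "\<And>d. vectorspace.dim class_ring
       (graded_part n N (fixed_module H trunc_mat_act (trunc_module n N)) d) = card {\<mu>\<in>J. mdeg \<mu> = d}"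
    "coordinates V J (\<lambda>X. restrict (cvec n N X) J)"
    "\<And>\<gamma> X. \<gamma> \<noteq> 0 \<Longrightarrow> X \<in> carrier V \<Longrightarrow> trunc_scalar_act \<gamma> X \<in> carrier V"
    "\<And>\<gamma> X \<mu>. \<gamma> \<noteq> 0 \<Longrightarrow> X \<in> carrier V \<Longrightarrow>
       cvec n N (trunc_scalar_act \<gamma> X) \<mu> = \<gamma> ^ mdeg \<mu> * cvec n N X \<mu>"
proof -
  let ?L = "low_monoms n N" and ?S = "solutions (low_monoms n N) (fix_eqs n N H)"
    and ?S' = "solutions (low_monoms n N) (fix_eqs n N (map_mat \<iota> ` H))"
  interpret \<iota>: field_hom \<iota> by fact
  obtain J where J: "J \<subseteq> ?L" "restriction_basis J ?S"
    "\<And>d. restriction_basis {\<mu>\<in>J. mdeg \<mu> = d} (?S \<inter> supp_in {\<mu>\<in>?L. mdeg \<mu> = d})"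
    by (rule graded_restriction_basis[where deg = mdeg, OF finite_low_monoms[of n N] fix_eqs_graded[of _ n N H]])
      blast+
  have H': "g \<in> carrier_mat n n \<and> invertible_mat g" if g: "g \<in> map_mat \<iota> ` H" for g
  proof -
    obtain g0 where g0: "g0 \<in> H" "g = map_mat \<iota> g0" using g by auto
    obtain h where h: "h \<in> carrier_mat n n" "g0 * h = 1\<^sub>m n" "h * g0 = 1\<^sub>m n"
      using H[OF g0(1)] by (auto elim: invertible_matE)
    have g0c: "g0 \<in> carrier_mat n n" using H[OF g0(1)] by simp
    have "map_mat \<iota> g0 * map_mat \<iota> h = 1\<^sub>m n" "map_mat \<iota> h * map_mat \<iota> g0 = 1\<^sub>m n"
      using h g0c by (simp_all flip: \<iota>.mat_hom_mult add: \<iota>.mat_hom_one)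
    then show ?thesis
      using h g0c by (auto simp: g0 invertible_mat_def inverts_mat_def intro!: exI[of _ "map_mat \<iota> h"])
  qed
  have V: "V = (trunc_module n N)\<lparr>carrier := {X \<in> carrier (trunc_module n N). cvec n N X \<in> ?S'}\<rparr>"
    unfolding V_def by (rule fixed_module_trunc[OF H' N frob'])
  have sub: "fun_subspace (?S \<inter> supp_in {\<mu>\<in>?L. mdeg \<mu> = d})" for d
    using fun_subspace_solutions[of ?L] by (auto simp: fun_subspace_def supp_in_def)
  show ?thesis
  proof (rule that[of J])
    show "finite J" using J(1) finite_low_monoms by (rule finite_subset)
    show "vectorspace.dim class_ring
       (graded_part n N (fixed_module H trunc_mat_act (trunc_module n N)) d) = card {\<mu>\<in>J. mdeg \<mu> = d}" for d
    proof (rule coordinates_dim, rule trunc_coordinates[OF sub[of d] _ _ J(3)])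
      show "graded_part n N (fixed_module H trunc_mat_act (trunc_module n N)) d =
        (trunc_module n N)\<lparr>carrier := {X \<in> carrier (trunc_module n N).
          cvec n N X \<in> ?S \<inter> supp_in {\<mu>\<in>?L. mdeg \<mu> = d}}\<rparr>"
        by (rule graded_part_trunc[OF _ fixed_module_trunc[OF H N frob]]) (auto simp: solutions_def)
    qed (use J(1) in \<open>auto simp: supp_in_def\<close>)
    show "coordinates V J (\<lambda>X. restrict (cvec n N X) J)"
    proof (rule trunc_coordinates[OF fun_subspace_solutions _ J(1) _ V])
      show "restriction_basis J ?S'"
        using restriction_basis_base_change[OF \<iota> finite_low_monoms J(1,2)] H
        by (subst fix_eqs_base_change[OF \<iota>]) auto
    qed (auto simp: solutions_def)
    fix \<gamma> :: 'k and X assume a: "\<gamma> \<noteq> 0" "X \<in> carrier V"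
    then have X: "X \<in> carrier (trunc_module n N)" "cvec n N X \<in> ?S'" by (auto simp: V)
    note s = trunc_scalar_act[OF a(1) X(1)]
    show "cvec n N (trunc_scalar_act \<gamma> X) \<mu> = \<gamma> ^ mdeg \<mu> * cvec n N X \<mu>" for \<mu> by (simp add: s)
    show "trunc_scalar_act \<gamma> X \<in> carrier V"
      using s solutions_scale_graded[where deg = mdeg and \<gamma> = \<gamma>, OF fix_eqs_graded X(2)] by (simp add: V)
  qed
qed

section \<open>Counting flags over a finite field\<close>

lemma prod_lessThan_add:
  fixes f :: "nat \<Rightarrow> 'a::comm_monoid_mult"
  shows "(\<Prod>j<b + s. f j) = (\<Prod>j<b. f j) * (\<Prod>j<s. f (b + j))"
  by (induct s) (auto simp: mult.assoc)

text \<open>Fields are sets inside one ambient type because three of them are compared there: the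
  image of the small field, the field \<open>E\<close> of coordinates, and the field generated by a
  scalar.\<close>

locale finite_subfield =
  fixes K :: "'k::field set"
  assumes finite_K: "finite K" and K0: "0 \<in> K" and K1: "1 \<in> K"
    and K_add: "\<And>a b. a \<in> K \<Longrightarrow> b \<in> K \<Longrightarrow> a + b \<in> K"
    and K_mult: "\<And>a b. a \<in> K \<Longrightarrow> b \<in> K \<Longrightarrow> a * b \<in> K"
    and K_uminus: "\<And>a. a \<in> K \<Longrightarrow> - a \<in> K"
    and K_inverse: "\<And>a. a \<in> K \<Longrightarrow> inverse a \<in> K"
begin

abbreviation "Q \<equiv> card K"

lemma Q_ge_2: "Q \<ge> 2"
proof -
  have "card {0, 1 :: 'k} \<le> card K" using finite_K K0 K1 by (intro card_mono) auto
  then show ?thesis by simp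
qed

definition sp :: "'k set \<Rightarrow> bool" where
  "sp W \<longleftrightarrow> 0 \<in> W \<and> (\<forall>x\<in>W. \<forall>y\<in>W. x + y \<in> W) \<and> (\<forall>a\<in>K. \<forall>x\<in>W. a * x \<in> W)"

lemma spD:
  assumes "sp W"
  shows "0 \<in> W" "\<And>x y. x \<in> W \<Longrightarrow> y \<in> W \<Longrightarrow> x + y \<in> W" "\<And>a x. a \<in> K \<Longrightarrow> x \<in> W \<Longrightarrow> a * x \<in> W"
  using assms by (auto simp: sp_def)

lemma sp_diff: "sp W \<Longrightarrow> x \<in> W \<Longrightarrow> y \<in> W \<Longrightarrow> x - y \<in> W"
  using spD(2)[of W x "(-1) * y"] spD(3)[of W "-1" y] K_uminus[OF K1] by simp

lemma sp_sum: "sp W \<Longrightarrow> (\<And>a. a \<in> A \<Longrightarrow> h a \<in> W) \<Longrightarrow> sum h A \<in> W"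
  by (induct A rule: infinite_finite_induct) (auto simp: spD)

text \<open>The sum of \<open>U\<close> and the line through \<open>x\<close>.\<close>

definition adj :: "'k set \<Rightarrow> 'k \<Rightarrow> 'k set" where
  "adj U x = (\<lambda>(u, a). u + a * x) ` (U \<times> K)"

lemma adj_superset: "U \<subseteq> adj U x"
  unfolding adj_def using K0 by (force intro: image_eqI[where x = "(_, 0)"])

lemma adj_mem: "sp U \<Longrightarrow> x \<in> adj U x"
  unfolding adj_def using K1 spD(1) by (force intro: image_eqI[where x = "(0, 1)"])

lemma sp_adj:
  assumes U: "sp U" shows "sp (adj U x)"
  unfolding sp_def
proof (intro conjI ballI)
  show "0 \<in> adj U x" using adj_superset spD(1)[OF U] by blast
next
  fix y z assume "y \<in> adj U x" "z \<in> adj U x"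
  then obtain u a v b where h: "u \<in> U" "a \<in> K" "y = u + a * x" "v \<in> U" "b \<in> K" "z = v + b * x"
    by (auto simp: adj_def)
  then have "y + z = (u + v) + (a + b) * x" by (simp add: algebra_simps)
  then show "y + z \<in> adj U x" unfolding adj_def
    using h spD(2)[OF U] K_add by (intro image_eqI[where x = "(u + v, a + b)"]) auto
next
  fix c y assume c: "c \<in> K" "y \<in> adj U x"
  then obtain u a where h: "u \<in> U" "a \<in> K" "y = u + a * x" by (auto simp: adj_def)
  then have "c * y = c * u + (c * a) * x" by (simp add: algebra_simps)
  then show "c * y \<in> adj U x" unfolding adj_def
    using h c spD(3)[OF U] K_mult by (intro image_eqI[where x = "(c * u, c * a)"]) auto
qed

lemma adj_least: "sp W \<Longrightarrow> U \<subseteq> W \<Longrightarrow> x \<in> W \<Longrightarrow> adj U x \<subseteq> W"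
  using spD by (auto simp: adj_def)

lemma finite_adj: "finite U \<Longrightarrow> finite (adj U x)"
  by (simp add: adj_def finite_K)

text \<open>If one element had two representations \<open>u + a * x\<close> with different
  \<open>a\<close>, division would put \<open>x\<close> into \<open>U\<close>.\<close>

lemma card_adj:
  assumes U: "sp U" and x: "x \<notin> U"
  shows "card (adj U x) = card U * Q"
proof -
  have "inj_on (\<lambda>(u, a). u + a * x) (U \<times> K)"
  proof (rule inj_onI, clarify)
    fix u a v b assume h: "u \<in> U" "a \<in> K" "v \<in> U" "b \<in> K" "u + a * x = v + b * x"
    have e: "(a - b) * x = v - u" using h(5) by (simp add: algebra_simps)
    have "a = b"
    proof (rule ccontr)
      assume ab: "a \<noteq> b"
      have "a - b \<in> K" using h K_add[of a "- b"] K_uminus by simp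
      then have "inverse (a - b) * (v - u) \<in> U" using h spD(3)[OF U] K_inverse sp_diff[OF U] by blast
      moreover have "inverse (a - b) * (v - u) = x" using ab by (simp flip: e)
      ultimately show False using x by simp
    qed
    then show "u = v \<and> a = b" using h(5) by simp
  qed
  then show ?thesis by (simp add: adj_def card_image card_cartesian_product)
qed


text \<open>Lists in \<open>W\<close> that are linearly independent modulo \<open>U\<close>. Each
  entry avoids the span of \<open>U\<close> and its predecessors, so the lists can be counted entry
  by entry.\<close>

fun indep :: "'k set \<Rightarrow> 'k set \<Rightarrow> nat \<Rightarrow> 'k list set" where
  "indep U W 0 = {[]}"
| "indep U W (Suc a) = (\<lambda>(x, xs). x # xs) ` (SIGMA x:W - U. indep (adj U x) W a)"

fun gen :: "'k set \<Rightarrow> 'k list \<Rightarrow> 'k set" where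
  "gen U [] = U"
| "gen U (x # xs) = gen (adj U x) xs"

lemma finite_indep: "finite W \<Longrightarrow> finite (indep U W a)"
  by (induct a arbitrary: U) auto

text \<open>The entry at position \<open>j\<close> avoids the \<open>Q ^ (u + j)\<close> elements of
  the span so far. Real numbers keep the formula correct for lists that are too long: the factor
  with \<open>u + j = M\<close> is 0.\<close>

lemma card_indep:
  assumes W: "sp W" "finite W" "card W = Q ^ M"
    and U: "sp U" "U \<subseteq> W" "card U = Q ^ u"
  shows "real (card (indep U W a)) = (\<Prod>j<a. real Q ^ M - real Q ^ (u + j))"
  using U
proof (induct a arbitrary: U u)
  case (Suc a)
  have fU: "finite U" using W Suc.prems finite_subset by blast
  have c: "real (card (indep (adj U x) W a)) = (\<Prod>j<a. real Q ^ M - real Q ^ (u + Suc j))"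
    if "x \<in> W - U" for x
    using Suc.hyps[of "adj U x" "Suc u"] that Suc.prems W
    by (simp add: sp_adj adj_least card_adj mult.commute)
  have "card (indep U W (Suc a)) = (\<Sum>x\<in>W - U. card (indep (adj U x) W a))"
    using W by (simp add: card_image inj_on_def finite_indep)
  then have "real (card (indep U W (Suc a))) = (\<Sum>x\<in>W - U. real (card (indep (adj U x) W a)))"
    by simp
  also have "\<dots> = (\<Sum>x\<in>W - U. \<Prod>j<a. real Q ^ M - real Q ^ (u + Suc j))"
    using c by (intro sum.cong) auto
  also have "\<dots> = real (card (W - U)) * (\<Prod>j<a. real Q ^ M - real Q ^ (u + Suc j))" by simp
  also have "real (card (W - U)) = real Q ^ M - real Q ^ u"
    using W Suc.prems fU card_mono[OF W(2) Suc.prems(2)] by (simp add: card_Diff_subset of_nat_diff)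
  finally show ?case by (simp only: prod.lessThan_Suc_shift add_0_right comp_def)
qed simp

lemma indep_gen:
  assumes "xs \<in> indep U W a" "sp U" "sp W" "U \<subseteq> W"
  shows "sp (gen U xs) \<and> U \<subseteq> gen U xs \<and> gen U xs \<subseteq> W \<and> set xs \<subseteq> gen U xs \<and>
    card (gen U xs) = card U * Q ^ a \<and> length xs = a"
  using assms
proof (induct a arbitrary: U xs)
  case (Suc a)
  then obtain x ys where xs: "xs = x # ys" "x \<in> W - U" "ys \<in> indep (adj U x) W a" by auto
  have "adj U x \<subseteq> W" using adj_least Suc.prems xs by auto
  note IH = Suc.hyps[OF xs(3) sp_adj[OF Suc.prems(2)] Suc.prems(3) this]
  then show ?case
    using xs card_adj[OF Suc.prems(2), of x] adj_superset[of U x] adj_mem[OF Suc.prems(2), of x] by auto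
qed auto

lemma gen_least: "sp W \<Longrightarrow> U \<subseteq> W \<Longrightarrow> set xs \<subseteq> W \<Longrightarrow> gen U xs \<subseteq> W"
  by (induct xs arbitrary: U) (auto simp: adj_least)

lemma sp_gen: "sp U \<Longrightarrow> sp (gen U xs)"
  by (induct xs arbitrary: U) (auto simp: sp_adj)

lemma gen_superset: "U \<subseteq> gen U xs"
  by (induct xs arbitrary: U) (use adj_superset in fastforce)+

lemma indep_restrict: "xs \<in> indep U W a \<Longrightarrow> set xs \<subseteq> V \<Longrightarrow> xs \<in> indep U V a"
  by (induct a arbitrary: U xs) auto

lemma indep_mono: "xs \<in> indep U V a \<Longrightarrow> V \<subseteq> W \<Longrightarrow> xs \<in> indep U W a"
  by (induct a arbitrary: U xs) auto

text \<open>The dimension over \<open>U\<close> is expressed through the size, which avoids a choice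
  of bases.\<close>

definition subs :: "'k set \<Rightarrow> 'k set \<Rightarrow> nat \<Rightarrow> 'k set set" where
  "subs U W a = {V. sp V \<and> U \<subseteq> V \<and> V \<subseteq> W \<and> card V = card U * Q ^ a}"

lemma finite_subs: "finite W \<Longrightarrow> finite (subs U W a)"
  by (rule finite_subset[of _ "Pow W"]) (auto simp: subs_def)

text \<open>Double counting: every independent list spans, together with \<open>U\<close>, exactly
  one such subspace, and every subspace arises from equally many lists.\<close>

lemma card_subs:
  assumes W: "sp W" "finite W" "card W = Q ^ M"
    and U: "sp U" "U \<subseteq> W" "card U = Q ^ u"
  shows "real (card (subs U W a)) * (\<Prod>j<a. real Q ^ (u + a) - real Q ^ (u + j)) =
    (\<Prod>j<a. real Q ^ M - real Q ^ (u + j))"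
proof -
  have genV: "gen U xs = V" if V: "V \<in> subs U W a" and xs: "xs \<in> indep U V a" for V xs
  proof -
    have "finite V" using V W by (auto simp: subs_def intro: finite_subset)
    then show ?thesis using indep_gen[OF xs U(1)] V by (intro card_subset_eq) (auto simp: subs_def)
  qed
  have "indep U W a = (\<Union>V\<in>subs U W a. indep U V a)"
  proof (intro equalityI subsetI)
    fix xs assume xs: "xs \<in> indep U W a"
    note g = indep_gen[OF xs U(1) W(1) U(2)]
    then have "gen U xs \<in> subs U W a" by (auto simp: subs_def)
    moreover have "xs \<in> indep U (gen U xs) a" using indep_restrict[OF xs] g by blast
    ultimately show "xs \<in> (\<Union>V\<in>subs U W a. indep U V a)" by blast
  qed (auto simp: subs_def intro: indep_mono)
  then have "card (indep U W a) = (\<Sum>V\<in>subs U W a. card (indep U V a))"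
  proof (simp only:, intro card_UN_disjoint)
    show "finite (subs U W a)" using finite_subs W by blast
    show "\<forall>V\<in>subs U W a. finite (indep U V a)"
      using finite_subset[OF _ W(2)] by (auto simp: subs_def intro!: finite_indep)
    show "\<forall>V\<in>subs U W a. \<forall>V'\<in>subs U W a. V \<noteq> V' \<longrightarrow> indep U V a \<inter> indep U V' a = {}"
      using genV by blast
  qed
  then have "real (card (indep U W a)) = (\<Sum>V\<in>subs U W a. real (card (indep U V a)))" by simp
  also have "\<dots> = (\<Sum>V\<in>subs U W a. \<Prod>j<a. real Q ^ (u + a) - real Q ^ (u + j))"
  proof (intro sum.cong refl)
    fix V assume V: "V \<in> subs U W a"
    then have "sp V" "finite V" "U \<subseteq> V" "card V = Q ^ (u + a)"
      using finite_subset[OF _ W(2)] U(3) by (auto simp: subs_def power_add)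
    then show "real (card (indep U V a)) = (\<Prod>j<a. real Q ^ (u + a) - real Q ^ (u + j))"
      using card_indep U by blast
  qed
  finally show ?thesis using card_indep[OF W U, of a] by simp
qed

text \<open>Greedy extension: as long as \<open>U\<close> is not all of \<open>W\<close>, an element
  outside enlarges it, and finiteness ends the process.\<close>

lemma sp_basis:
  assumes W: "sp W" "finite W" and U: "sp U" "U \<subseteq> W"
  shows "\<exists>a. \<exists>xs\<in>indep U W a. gen U xs = W"
  using U
proof (induct "card W - card U" arbitrary: U rule: less_induct)
  case less
  show ?case
  proof (cases "U = W")
    case True then show ?thesis by (intro exI[of _ 0]) auto
  next
    case False
    then obtain x where x: "x \<in> W" "x \<notin> U" using less.prems by auto
    have a: "adj U x \<subseteq> W" using adj_least W less.prems x by blast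
    have "U \<subset> adj U x" using adj_superset adj_mem[OF less.prems(1), of x] x by blast
    then have "card U < card (adj U x)" using a W finite_subset psubset_card_mono by metis
    moreover have "card (adj U x) \<le> card W" using a W card_mono by blast
    ultimately have "card W - card (adj U x) < card W - card U" by simp
    from less.hyps[OF this sp_adj[OF less.prems(1)] a]
    obtain b xs where "xs \<in> indep (adj U x) W b" "gen (adj U x) xs = W" by blast
    then show ?thesis using x by (intro exI[of _ "Suc b"] bexI[of _ "x # xs"]) auto
  qed
qed

lemma sp_card:
  assumes W: "sp W" "finite W" and U: "sp U" "U \<subseteq> W"
  obtains a xs where "card W = card U * Q ^ a" "length xs = a" "gen U xs = W" "set xs \<subseteq> W"
proof -
  obtain a xs where "xs \<in> indep U W a" "gen U xs = W" using sp_basis[OF assms] by blast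
  then show ?thesis using that[of a xs] indep_gen[of xs U W a] assms by auto
qed

lemma sp_zero: "sp {0}"
  by (simp add: sp_def)

text \<open>Weakly increasing chains above \<open>U\<close>, smallest member first; the list of
  numbers prescribes the jumps in dimension.\<close>

fun flags :: "'k set \<Rightarrow> 'k set \<Rightarrow> nat list \<Rightarrow> 'k set list set" where
  "flags U W [] = {[]}"
| "flags U W (b # bs) = (\<lambda>(V, Vs). V # Vs) ` (SIGMA V:subs U W b. flags V W bs)"

end

text \<open>The product, over the steps of a flag, of the number of ordered bases of each member
  modulo its predecessor; \<open>u\<close> is the dimension reached so far.\<close>

fun flag_denom :: "nat \<Rightarrow> nat \<Rightarrow> nat list \<Rightarrow> real" where
  "flag_denom Q u [] = 1"
| "flag_denom Q u (b # bs) =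
    (\<Prod>j<b. real Q ^ (u + b) - real Q ^ (u + j)) * flag_denom Q (u + b) bs"

lemma (in finite_subfield) finite_flags: "finite W \<Longrightarrow> finite (flags U W bs)"
  by (induct bs arbitrary: U) (auto simp: finite_subs)

text \<open>Each step, multiplied by its own denominator, gives a run of consecutive factors by
  \<open>card_subs\<close>, and the runs concatenate to the product on the right.\<close>

lemma (in finite_subfield) card_flags:
  assumes W: "sp W" "finite W" "card W = Q ^ M"
    and U: "sp U" "U \<subseteq> W" "card U = Q ^ u"
  shows "real (card (flags U W bs)) * flag_denom Q u bs = (\<Prod>j<sum_list bs. real Q ^ M - real Q ^ (u + j))"
  using U
proof (induct bs arbitrary: U u)
  case (Cons b bs)
  have "card (flags U W (b # bs)) = (\<Sum>V\<in>subs U W b. card (flags V W bs))"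
    using W by (simp add: card_image inj_on_def finite_flags finite_subs)
  then have "real (card (flags U W (b # bs))) * flag_denom Q (u + b) bs =
      (\<Sum>V\<in>subs U W b. real (card (flags V W bs)) * flag_denom Q (u + b) bs)"
    by (simp add: sum_distrib_right)
  also have "\<dots> = (\<Sum>V\<in>subs U W b. \<Prod>j<sum_list bs. real Q ^ M - real Q ^ (u + b + j))"
    using Cons.prems by (intro sum.cong refl Cons.hyps) (auto simp: subs_def power_add)
  finally have "real (card (flags U W (b # bs))) * flag_denom Q (u + b) bs =
      real (card (subs U W b)) * (\<Prod>j<sum_list bs. real Q ^ M - real Q ^ (u + (b + j)))"
    by (simp add: add.assoc)
  then have "real (card (flags U W (b # bs))) * flag_denom Q u (b # bs) =
      real (card (subs U W b)) * (\<Prod>j<b. real Q ^ (u + b) - real Q ^ (u + j)) *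
      (\<Prod>j<sum_list bs. real Q ^ M - real Q ^ (u + (b + j)))"
    by (simp add: mult_ac)
  then show ?case by (simp only: card_subs[OF W Cons.prems] prod_lessThan_add sum_list.Cons)
qed simp

text \<open>The second elementary symmetric function of the list.\<close>

fun pair_sum :: "nat list \<Rightarrow> nat" where
  "pair_sum [] = 0"
| "pair_sum (b # bs) = b * sum_list bs + pair_sum bs"

text \<open>The other two quantities are visibly invariant under reversal, hence so is
  \<open>pair_sum\<close>.\<close>

lemma pair_sum_eq: "2 * pair_sum bs + (\<Sum>b\<leftarrow>bs. b\<^sup>2) = (sum_list bs)\<^sup>2"
  by (induct bs) (auto simp: power2_sum algebra_simps)

lemma pair_sum_rev: "pair_sum (rev bs) = pair_sum bs"
  using pair_sum_eq[of bs] pair_sum_eq[of "rev bs"] by (simp add: rev_map[symmetric] sum_list_rev)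

text \<open>Taking \<open>Q ^ u\<close> out of every factor separates a power of \<open>Q\<close>
  from a product over the parts; for \<open>u = 0\<close> both are symmetric in the parts.\<close>

lemma flag_denom_eq:
  "flag_denom Q u bs = real Q ^ (u * sum_list bs + pair_sum bs) * (\<Prod>b\<leftarrow>bs. \<Prod>j<b. real Q ^ b - real Q ^ j)"
proof (induct bs arbitrary: u)
  case (Cons b bs)
  have "(\<Prod>j<b. real Q ^ (u + b) - real Q ^ (u + j)) = (\<Prod>j<b. real Q ^ u * (real Q ^ b - real Q ^ j))"
    by (simp add: power_add right_diff_distrib)
  also have "\<dots> = real Q ^ (u * b) * (\<Prod>j<b. real Q ^ b - real Q ^ j)"
    by (simp add: prod.distrib power_mult)
  finally show ?case by (simp add: Cons power_add algebra_simps)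
qed simp

text \<open>Flags are built from the last block upwards, whereas the denominators of
  \<open>C_series\<close> start with the first block.\<close>

lemma flag_denom_rev: "flag_denom Q 0 (rev bs) = flag_denom Q 0 bs"
proof -
  have "prod_list (rev xs) = prod_list xs" for xs :: "real list" by (induct xs) auto
  then show ?thesis by (simp add: flag_denom_eq pair_sum_rev rev_map[symmetric] sum_list_rev)
qed

lemma flag_denom_pos: "Q \<ge> 2 \<Longrightarrow> flag_denom Q u bs > 0"
  by (induct bs arbitrary: u) (auto intro!: mult_pos_pos prod_pos)

text \<open>This form matches the double product in the denominator of \<open>C_series\<close>
  factor by factor.\<close>

lemma flag_denom_index:
  "flag_denom Q u bs = (\<Prod>i<length bs. \<Prod>j<bs ! i.
     real Q ^ (u + partial_sum bs (Suc i)) - real Q ^ (u + partial_sum bs i + j))"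
proof (induct bs arbitrary: u)
  case (Cons b bs)
  show ?case
    unfolding length_Cons prod.lessThan_Suc_shift
    by (simp add: Cons partial_sum_def add.assoc)
qed simp

section \<open>The series at roots of unity\<close>

text \<open>An identity of power series by itself says nothing about the point \<open>z\<close>.
  Multiplied by the common denominator it becomes an identity of polynomials, which can be
  evaluated.\<close>

lemma fps_sum_fractions_eval:
  fixes p :: "'a::field poly"
  assumes S: "finite S"
    and p: "fps_of_poly p = (\<Sum>s\<in>S. fps_X ^ e s * (fps_of_poly (nu s) / fps_of_poly (de s)))"
    and d0: "\<And>s. s \<in> S \<Longrightarrow> Polynomial.coeff (de s) 0 \<noteq> 0"
    and dz: "\<And>s. s \<in> S \<Longrightarrow> poly (de s) z \<noteq> 0"
  shows "poly p z = (\<Sum>s\<in>S. z ^ e s * (poly (nu s) z / poly (de s) z))"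
proof -
  have "fps_of_poly (p * (\<Prod>s\<in>S. de s)) =
      (\<Sum>s\<in>S. fps_X ^ e s * (fps_of_poly (nu s) / fps_of_poly (de s)) * fps_of_poly (\<Prod>s\<in>S. de s))"
    by (simp add: fps_of_poly_mult p sum_distrib_right)
  also have "\<dots> = (\<Sum>s\<in>S. fps_of_poly (Polynomial.monom 1 (e s) * (nu s * (\<Prod>s\<in>S - {s}. de s))))"
  proof (intro sum.cong refl)
    fix s assume s: "s \<in> S"
    have "fps_of_poly (nu s) / fps_of_poly (de s) * fps_of_poly (de s) = fps_of_poly (nu s)"
      using d0[OF s] by (simp add: fps_divide_unit mult.assoc inverse_mult_eq_1)
    moreover have P: "(\<Prod>s\<in>S. de s) = de s * (\<Prod>s\<in>S - {s}. de s)" using S s by (rule prod.remove)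
    moreover have "x * y * (z * r) = x * ((y * z) * r)" for x y z r :: "'a fps"
      by (simp only: mult.assoc)
    ultimately show "fps_X ^ e s * (fps_of_poly (nu s) / fps_of_poly (de s)) * fps_of_poly (\<Prod>s\<in>S. de s) =
        fps_of_poly (Polynomial.monom 1 (e s) * (nu s * (\<Prod>s\<in>S - {s}. de s)))"
      by (simp only: P fps_of_poly_mult fps_of_poly_monom')
  qed
  also have "\<dots> = fps_of_poly (\<Sum>s\<in>S. Polynomial.monom 1 (e s) * (nu s * (\<Prod>s\<in>S - {s}. de s)))"
    by (simp add: fps_of_poly_sum)
  finally have "p * (\<Prod>s\<in>S. de s) = (\<Sum>s\<in>S. Polynomial.monom 1 (e s) * (nu s * (\<Prod>s\<in>S - {s}. de s)))"
    by (simp only: fps_of_poly_eq_iff)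
  then have "poly (p * (\<Prod>s\<in>S. de s)) z =
      poly (\<Sum>s\<in>S. Polynomial.monom 1 (e s) * (nu s * (\<Prod>s\<in>S - {s}. de s))) z"
    by (rule arg_cong)
  then have "poly p z * (\<Prod>s\<in>S. poly (de s) z) =
      (\<Sum>s\<in>S. z ^ e s * (poly (nu s) z * (\<Prod>s\<in>S - {s}. poly (de s) z)))"
    by (simp add: poly_prod poly_sum poly_monom)
  also have "\<dots> = (\<Sum>s\<in>S. z ^ e s * (poly (nu s) z / poly (de s) z) * (\<Prod>s\<in>S. poly (de s) z))"
  proof (intro sum.cong refl)
    fix s assume s: "s \<in> S"
    have "(\<Prod>s\<in>S. poly (de s) z) = poly (de s) z * (\<Prod>s\<in>S - {s}. poly (de s) z)"
      using S s by (rule prod.remove)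
    then show "z ^ e s * (poly (nu s) z * (\<Prod>s\<in>S - {s}. poly (de s) z)) =
        z ^ e s * (poly (nu s) z / poly (de s) z) * (\<Prod>s\<in>S. poly (de s) z)"
      using dz[OF s] by simp
  qed
  finally have "poly p z * (\<Prod>s\<in>S. poly (de s) z) =
      (\<Sum>s\<in>S. z ^ e s * (poly (nu s) z / poly (de s) z)) * (\<Prod>s\<in>S. poly (de s) z)"
    by (simp add: sum_distrib_right)
  then show ?thesis using S dz by (simp add: prod_zero_iff)
qed

section \<open>From rational to complex power series\<close>

lemma fps_nth_prod_0: "fps_nth (prod f A) 0 = (\<Prod>a\<in>A. fps_nth (f a) 0)"
  for f :: "'b \<Rightarrow> 'a::comm_ring_1 fps"
  by (induct A rule: infinite_finite_induct) auto

definition fps_cplx :: "rat fps \<Rightarrow> complex fps" where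
  "fps_cplx f = Abs_fps (\<lambda>n. of_rat (fps_nth f n))"

lemma fps_cplx_add: "fps_cplx (f + g) = fps_cplx f + fps_cplx g"
  by (simp add: fps_cplx_def fps_eq_iff of_rat_add)

lemma fps_cplx_mult: "fps_cplx (f * g) = fps_cplx f * fps_cplx g"
  by (simp add: fps_cplx_def fps_eq_iff fps_mult_nth of_rat_sum of_rat_mult)

lemma fps_cplx_0: "fps_cplx 0 = 0"
  by (simp add: fps_cplx_def fps_eq_iff)

lemma fps_cplx_1: "fps_cplx 1 = 1"
  by (simp add: fps_cplx_def fps_eq_iff)

lemma fps_cplx_X: "fps_cplx fps_X = fps_X"
  by (simp add: fps_cplx_def fps_eq_iff fps_X_def)

lemma fps_cplx_power: "fps_cplx (f ^ k) = fps_cplx f ^ k"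
  by (induct k) (auto simp: fps_cplx_1 fps_cplx_mult)

lemma fps_cplx_diff: "fps_cplx (f - g) = fps_cplx f - fps_cplx g"
  by (simp add: fps_cplx_def fps_eq_iff of_rat_diff)

lemma fps_cplx_sum: "fps_cplx (sum h A) = (\<Sum>a\<in>A. fps_cplx (h a))"
  by (induct A rule: infinite_finite_induct) (auto simp: fps_cplx_0 fps_cplx_add)

lemma fps_cplx_prod: "fps_cplx (prod h A) = (\<Prod>a\<in>A. fps_cplx (h a))"
  by (induct A rule: infinite_finite_induct) (auto simp: fps_cplx_1 fps_cplx_mult)

lemma fps_cplx_divide:
  assumes "fps_nth g 0 \<noteq> 0" shows "fps_cplx (f / g) = fps_cplx f / fps_cplx g"
proof -
  have g0: "fps_nth (fps_cplx g) 0 \<noteq> 0" using assms by (simp add: fps_cplx_def)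
  have "f / g * g = f" using assms by (simp add: fps_divide_unit mult.assoc inverse_mult_eq_1)
  then have "fps_cplx (f / g) * fps_cplx g = fps_cplx f" by (simp flip: fps_cplx_mult)
  then have "fps_cplx (f / g) * fps_cplx g * inverse (fps_cplx g) = fps_cplx f * inverse (fps_cplx g)" by simp
  then show ?thesis
    using g0 by (simp add: fps_divide_unit mult.assoc inverse_mult_eq_1')
qed

abbreviation one_minus :: "nat \<Rightarrow> complex poly" where
  "one_minus a \<equiv> 1 - Polynomial.monom 1 a"

lemma fps_one_minus: "fps_of_poly (one_minus a) = 1 - fps_X ^ a"
  by (simp add: fps_of_poly_diff fps_of_poly_monom')

text \<open>The quotient is a geometric sum in \<open>t / w\<close>, all of whose \<open>a\<close>
  terms tend to 1.\<close>

lemma tendsto_one_minus_quotient: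
  fixes w :: complex
  assumes "w \<noteq> 0" "w ^ a = 1"
  shows "((\<lambda>t. (1 - t ^ a) / (1 - t / w)) \<longlongrightarrow> of_nat a) (at w)"
proof -
  have "((\<lambda>t. \<Sum>i<a. (t / w) ^ i) \<longlongrightarrow> (\<Sum>i<a. (w / w) ^ i)) (at w)"
    by (intro tendsto_intros) (use assms in auto)
  then have "((\<lambda>t. \<Sum>i<a. (t / w) ^ i) \<longlongrightarrow> of_nat a) (at w)" using assms by simp
  moreover have "\<forall>\<^sub>F t in at w. (\<Sum>i<a. (t / w) ^ i) = (1 - t ^ a) / (1 - t / w)"
    unfolding eventually_at_filter
  proof (intro always_eventually allI impI)
    fix t assume "t \<noteq> w"
    then have "1 - t / w \<noteq> 0" using assms by (simp add: field_simps)
    moreover have "1 - t ^ a = (1 - t / w) * (\<Sum>i<a. (t / w) ^ i)"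
      using one_diff_power_eq[of "t / w" a] assms by (simp add: power_divide)
    ultimately show "(\<Sum>i<a. (t / w) ^ i) = (1 - t ^ a) / (1 - t / w)" by simp
  qed
  ultimately show ?thesis by (rule Lim_transform_eventually)
qed

text \<open>For positive \<open>a\<close>, the first nonzero coefficient of \<open>1 - t ^ a\<close>
  at \<open>w\<close> in powers of \<open>1 - t / w\<close>.\<close>

definition leading :: "complex \<Rightarrow> nat \<Rightarrow> complex" where
  "leading w a = (if w ^ a = 1 then of_nat a else 1 - w ^ a)"

text \<open>Each factor that vanishes at \<open>w\<close> absorbs one \<open>1 - t / w\<close>, so
  orders of vanishing become counts of indices.\<close>

lemma tendsto_prod_one_minus:
  fixes w :: complex
  assumes "w \<noteq> 0" "finite I"
  shows "((\<lambda>t. (\<Prod>i\<in>I. 1 - t ^ a i) / (1 - t / w) ^ card {i\<in>I. w ^ a i = 1})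
    \<longlongrightarrow> (\<Prod>i\<in>I. leading w (a i))) (at w)"
proof -
  have "((\<lambda>t. \<Prod>i\<in>I. if w ^ a i = 1 then (1 - t ^ a i) / (1 - t / w) else 1 - t ^ a i)
      \<longlongrightarrow> (\<Prod>i\<in>I. leading w (a i))) (at w)"
  proof (rule tendsto_prod)
    fix i
    show "((\<lambda>t. if w ^ a i = 1 then (1 - t ^ a i) / (1 - t / w) else 1 - t ^ a i)
      \<longlongrightarrow> leading w (a i)) (at w)"
      using tendsto_one_minus_quotient[OF assms(1), of "a i"]
      by (cases "w ^ a i = 1") (auto simp: leading_def intro!: tendsto_intros)
  qed
  moreover have "(\<Prod>i\<in>I. if w ^ a i = 1 then (1 - t ^ a i) / (1 - t / w) else 1 - t ^ a i) =
      (\<Prod>i\<in>I. 1 - t ^ a i) / (1 - t / w) ^ card {i\<in>I. w ^ a i = 1}" for t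
    using assms(2)
  proof (induct I rule: finite_induct)
    case (insert x F)
    have "{i \<in> insert x F. w ^ a i = 1} =
        (if w ^ a x = 1 then insert x {i\<in>F. w ^ a i = 1} else {i\<in>F. w ^ a i = 1})" by auto
    then show ?case using insert by simp
  qed simp
  ultimately show ?thesis by simp
qed

text \<open>A surplus of zeros in the numerator leaves a power of \<open>1 - t / w\<close>, which
  tends to 0; without a surplus the leading coefficients remain.\<close>

lemma tendsto_quotient_one_minus:
  fixes w :: complex
  assumes w: "w \<noteq> 0" and fin: "finite I" "finite J"
    and pos: "\<And>j. j \<in> J \<Longrightarrow> b j > 0"
    and le: "card {j\<in>J. w ^ b j = 1} \<le> card {i\<in>I. w ^ a i = 1}"
  shows "((\<lambda>t. (\<Prod>i\<in>I. 1 - t ^ a i) / (\<Prod>j\<in>J. 1 - t ^ b j)) \<longlongrightarrow>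
    (if card {j\<in>J. w ^ b j = 1} < card {i\<in>I. w ^ a i = 1} then 0
     else (\<Prod>i\<in>I. leading w (a i)) / (\<Prod>j\<in>J. leading w (b j)))) (at w)"
proof -
  let ?nz = "card {i\<in>I. w ^ a i = 1}" and ?dz = "card {j\<in>J. w ^ b j = 1}"
  let ?L = "(\<Prod>i\<in>I. leading w (a i)) / (\<Prod>j\<in>J. leading w (b j))"
  have "leading w (b j) \<noteq> 0" if "j \<in> J" for j using pos[OF that] by (auto simp: leading_def)
  then have nz: "(\<Prod>j\<in>J. leading w (b j)) \<noteq> 0" using fin by simp
  have "((\<lambda>t. (1 - t / w) ^ (?nz - ?dz)) \<longlongrightarrow> (1 - w / w) ^ (?nz - ?dz)) (at w)"
    by (intro tendsto_intros) (use w in auto)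
  then have "((\<lambda>t. (1 - t / w) ^ (?nz - ?dz) *
      (((\<Prod>i\<in>I. 1 - t ^ a i) / (1 - t / w) ^ ?nz) / ((\<Prod>j\<in>J. 1 - t ^ b j) / (1 - t / w) ^ ?dz)))
      \<longlongrightarrow> (1 - w / w) ^ (?nz - ?dz) * ?L) (at w)"
    by (intro tendsto_mult tendsto_divide tendsto_prod_one_minus w fin nz)
  moreover have "\<forall>\<^sub>F t in at w. (1 - t / w) ^ (?nz - ?dz) *
      (((\<Prod>i\<in>I. 1 - t ^ a i) / (1 - t / w) ^ ?nz) / ((\<Prod>j\<in>J. 1 - t ^ b j) / (1 - t / w) ^ ?dz)) =
      (\<Prod>i\<in>I. 1 - t ^ a i) / (\<Prod>j\<in>J. 1 - t ^ b j)"
    unfolding eventually_at_filter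
  proof (intro always_eventually allI impI)
    fix t assume "t \<noteq> w"
    then have z: "1 - t / w \<noteq> 0" using w by (simp add: field_simps)
    have cancel: "y ^ (k - l) * ((N / y ^ k) / (D / y ^ l)) = N / D" if "y \<noteq> 0" "l \<le> k"
      for y N D :: complex and k l
      using that by (simp add: power_diff)
    show "(1 - t / w) ^ (?nz - ?dz) *
      (((\<Prod>i\<in>I. 1 - t ^ a i) / (1 - t / w) ^ ?nz) / ((\<Prod>j\<in>J. 1 - t ^ b j) / (1 - t / w) ^ ?dz)) =
      (\<Prod>i\<in>I. 1 - t ^ a i) / (\<Prod>j\<in>J. 1 - t ^ b j)"
      by (rule cancel[OF z le])
  qed
  ultimately have "((\<lambda>t. (\<Prod>i\<in>I. 1 - t ^ a i) / (\<Prod>j\<in>J. 1 - t ^ b j))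
      \<longlongrightarrow> (1 - w / w) ^ (?nz - ?dz) * ?L) (at w)" by (rule Lim_transform_eventually)
  moreover have "(1 - w / w) ^ (?nz - ?dz) * ?L = (if ?dz < ?nz then 0 else ?L)"
    using w le by (auto simp: power_0_left)
  ultimately show ?thesis by simp
qed

text \<open>Zero is among the multiples, which makes the count a ceiling.\<close>

lemma card_multiples_below:
  assumes "d > (0::nat)" shows "card {j\<in>{..<s}. d dvd j} = (s + d - 1) div d"
proof -
  have "{j\<in>{..<s}. d dvd j} = (*) d ` {..<(s + d - 1) div d}"
  proof (intro equalityI subsetI)
    fix j assume "j \<in> {j\<in>{..<s}. d dvd j}"
    then obtain k where k: "j = d * k" "d * k < s" by auto
    then have "Suc k * d \<le> s + d - 1" using assms by (simp add: mult.commute)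
    then have "Suc k \<le> (s + d - 1) div d" using assms by (simp add: less_eq_div_iff_mult_less_eq)
    then show "j \<in> (*) d ` {..<(s + d - 1) div d}" using k by auto
  next
    fix j assume "j \<in> (*) d ` {..<(s + d - 1) div d}"
    then obtain k where k: "j = d * k" "k < (s + d - 1) div d" by auto
    then have "Suc k \<le> (s + d - 1) div d" by simp
    then have "Suc k * d \<le> s + d - 1" using assms by (simp add: less_eq_div_iff_mult_less_eq)
    then show "j \<in> {j\<in>{..<s}. d dvd j}" using k assms by (auto simp: mult.commute)
  qed
  moreover have "inj ((*) d)" using assms by (auto simp: inj_on_def)
  ultimately show ?thesis by (simp add: card_image inj_on_def)
qed

text \<open>Here \<open>b - j\<close> runs from 1 to \<open>b\<close>, which makes the count a
  floor. The gap between this floor and the ceiling in \<open>card_multiples_below\<close> is what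
  makes summands of the series vanish.\<close>

lemma card_multiples_from_top:
  assumes "d > (0::nat)" shows "card {j\<in>{..<b}. d dvd b - j} = b div d"
proof -
  have "bij_betw (\<lambda>k. b - d * Suc k) {..<b div d} {j\<in>{..<b}. d dvd b - j}"
  proof (rule bij_betw_imageI)
    have le: "d * Suc k \<le> b" if "k < b div d" for k
    proof -
      have "Suc k \<le> b div d" using that by simp
      then show ?thesis using assms by (simp add: less_eq_div_iff_mult_less_eq mult.commute)
    qed
    show "inj_on (\<lambda>k. b - d * Suc k) {..<b div d}"
    proof (rule inj_onI)
      fix k l assume "k \<in> {..<b div d}" "l \<in> {..<b div d}" "b - d * Suc k = b - d * Suc l"
      then have "d * Suc k = d * Suc l" using le[of k] le[of l] by (metis diff_diff_cancel lessThan_iff)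
      then show "k = l" using assms by auto
    qed
    show "(\<lambda>k. b - d * Suc k) ` {..<b div d} = {j\<in>{..<b}. d dvd b - j}"
    proof (intro equalityI subsetI)
      fix j assume "j \<in> (\<lambda>k. b - d * Suc k) ` {..<b div d}"
      then obtain k where k: "k < b div d" "j = b - d * Suc k" by auto
      have "b - j = d * Suc k" using le[OF k(1)] k by simp
      moreover have "d * Suc k > 0" using assms by simp
      ultimately show "j \<in> {j\<in>{..<b}. d dvd b - j}" by (auto intro: dvdI) 
    next
      fix j assume "j \<in> {j\<in>{..<b}. d dvd b - j}"
      then obtain k where k: "b - j = d * k" "j < b" by auto
      then have "k \<noteq> 0" by (intro notI) simp
      then obtain l where l: "k = Suc l" using not0_implies_Suc by blast
      have "Suc l * d \<le> b" using k l by (simp add: mult.commute)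
      then have "l < b div d" using assms by (simp add: less_eq_div_iff_mult_less_eq flip: Suc_le_eq)
      moreover have "j = b - d * Suc l" using k l by simp
      ultimately show "j \<in> (\<lambda>k. b - d * Suc k) ` {..<b div d}" by blast
    qed
  qed
  from bij_betw_same_card[OF this] show ?thesis by simp
qed

text \<open>Cutting the range of the numerator into the blocks of the denominator lets the two
  products be compared factor by factor.\<close>

lemma prod_blocks:
  fixes f :: "nat \<Rightarrow> 'a::comm_monoid_mult"
  shows "(\<Prod>j<sum_list bs. f j) = (\<Prod>i<length bs. \<Prod>j<bs ! i. f (partial_sum bs i + j))"
proof (induct bs arbitrary: f)
  case (Cons b bs)
  show ?case
    unfolding length_Cons prod.lessThan_Suc_shift
    by (simp add: prod_lessThan_add Cons partial_sum_def add.assoc)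
qed simp

lemma prod_multiples:
  assumes "d > (0::nat)"
  shows "(\<Prod>j<d * b. if d dvd j then f j else 1) = (\<Prod>j<b. f (d * j) :: 'a::comm_monoid_mult)"
proof -
  have "(\<Prod>j<d * b. if d dvd j then f j else 1) = (\<Prod>j\<in>{j\<in>{..<d * b}. d dvd j}. f j)"
    by (rule prod.inter_filter[symmetric]) simp
  also have "{j\<in>{..<d * b}. d dvd j} = (*) d ` {..<b}" using assms by auto
  finally show ?thesis using assms by (simp add: prod.reindex inj_on_def)
qed

lemma dvd_sum_list: "(\<And>b. b \<in> set bs \<Longrightarrow> d dvd b) \<Longrightarrow> d dvd sum_list bs"
  for bs :: "nat list"
  by (induct bs) auto

lemma partial_sum_Suc: "i < length bs \<Longrightarrow> partial_sum bs (Suc i) = partial_sum bs i + bs ! i"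
  by (simp add: partial_sum_def take_Suc_conv_app_nth)

lemma partial_sum_le: "partial_sum bs i \<le> sum_list bs"
  using sum_list_append[of "take i bs" "drop i bs"] by (simp add: partial_sum_def)

lemma partial_sum_map_mult: "partial_sum (map ((*) d) bs) i = d * partial_sum bs i"
  by (simp add: partial_sum_def take_map sum_list_const_mult)

definition num_term :: "nat \<Rightarrow> nat \<Rightarrow> nat list \<Rightarrow> complex \<Rightarrow> complex" where
  "num_term q m \<beta> t = (\<Prod>j<sum_list \<beta>. 1 - t ^ (q ^ m - q ^ j))"

definition den_term :: "nat \<Rightarrow> nat list \<Rightarrow> complex \<Rightarrow> complex" where
  "den_term q \<beta> t = (\<Prod>i<length \<beta>. \<Prod>j<\<beta> ! i.
     1 - t ^ (q ^ partial_sum \<beta> (Suc i) - q ^ (partial_sum \<beta> i + j)))"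

text \<open>By \<open>card_dchains\<close> this is the number of flags of type \<open>b\<close> in a
  space of dimension \<open>m div d\<close> over a field with \<open>q ^ d\<close> elements.\<close>

definition term_value :: "nat \<Rightarrow> nat \<Rightarrow> nat \<Rightarrow> nat list \<Rightarrow> real" where
  "term_value q d m b =
     (\<Prod>j<sum_list b. real (q ^ d) ^ (m div d) - real (q ^ d) ^ j) / flag_denom (q ^ d) 0 b"

text \<open>The complex number \<open>w\<close> imitates a scalar of a finite field: by
  \<open>key\<close> its orbit under \<open>q\<close>-th powers has length \<open>d\<close>, the
  degree of that scalar over the small field.\<close>

context
  fixes w :: complex and q d m :: nat
  assumes q: "q \<ge> 2" and d: "d > 0" "d dvd m" and w0: "w \<noteq> 0"
    and key: "\<And>j. w ^ (q ^ j) = w \<longleftrightarrow> d dvd j"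
begin

lemma frobenius_power_diff: "a \<le> b \<Longrightarrow> w ^ (q ^ b - q ^ a) = 1 \<longleftrightarrow> w ^ (q ^ b) = w ^ (q ^ a)"
proof -
  assume "a \<le> b"
  then have "q ^ a \<le> q ^ b" using q by (intro power_increasing) auto
  then have "w ^ (q ^ b) = w ^ (q ^ b - q ^ a) * w ^ (q ^ a)" by (simp flip: power_add)
  then show ?thesis using w0 by auto
qed

lemma frobenius_power_eq_one:
  assumes "a \<le> b" shows "w ^ (q ^ b - q ^ a) = 1 \<longleftrightarrow> d dvd b - a"
proof
  assume "w ^ (q ^ b - q ^ a) = 1"
  then have e: "w ^ (q ^ b) = w ^ (q ^ a)" using frobenius_power_diff[OF assms] by simp
  \<comment> \<open>Raising to the power \<open>q ^ ?k\<close> turns the exponent \<open>a\<close>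
    into \<open>a * d\<close>, a multiple of \<open>d\<close>; this undoes the Frobenius power on
    the right-hand side and returns \<open>w\<close>.\<close>
  let ?k = "a * (d - 1)"
  have ak: "a + ?k = a * d" using d by (simp add: algebra_simps)
  have "(w ^ (q ^ b)) ^ (q ^ ?k) = (w ^ (q ^ a)) ^ (q ^ ?k)" by (simp only: e)
  then have "w ^ (q ^ (b + ?k)) = w ^ (q ^ (a + ?k))" by (simp only: power_mult[symmetric] power_add)
  also have "\<dots> = w" using key ak by simp
  finally have "d dvd b + ?k" using key by blast
  moreover have "b + ?k = (b - a) + a * d" using ak assms by simp
  ultimately show "d dvd b - a" by (metis dvd_add_left_iff dvd_triv_right)
next
  assume "d dvd b - a"
  then have "w ^ (q ^ (b - a)) = w" using key by blast
  then have "w ^ (q ^ b) = w ^ (q ^ a)"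
    using assms by (metis le_add_diff_inverse2 power_add power_mult)
  then show "w ^ (q ^ b - q ^ a) = 1" using frobenius_power_diff[OF assms] by simp
qed

text \<open>The orders of vanishing are compared through \<open>card_multiples_below\<close> for the
  numerator and \<open>card_multiples_from_top\<close> for each block of the denominator.\<close>

lemma tendsto_term:
  assumes s: "sum_list \<beta> \<le> m"
  shows "((\<lambda>t. num_term q m \<beta> t / den_term q \<beta> t) \<longlongrightarrow>
    (if \<forall>b\<in>set \<beta>. d dvd b then of_real (term_value q d m (map (\<lambda>b. b div d) \<beta>)) else 0)) (at w)"
proof -
  let ?s = "sum_list \<beta>" and ?J = "SIGMA i:{..<length \<beta>}. {..<\<beta> ! i}"
  define a where "a j = q ^ m - q ^ j" for j
  define c where "c = (\<lambda>(i, j). q ^ partial_sum \<beta> (Suc i) - q ^ (partial_sum \<beta> i + j))"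
  have numt: "num_term q m \<beta> t = (\<Prod>j<?s. 1 - t ^ a j)" for t by (simp add: num_term_def a_def)
  have dent: "den_term q \<beta> t = (\<Prod>ij\<in>?J. 1 - t ^ c ij)" for t
    by (simp add: den_term_def c_def prod.Sigma split_def)
  have cpos: "c ij > 0" if J: "ij \<in> ?J" for ij
  proof -
    obtain i j where ij: "ij = (i, j)" "i < length \<beta>" "j < \<beta> ! i" using J by auto
    then have "q ^ (partial_sum \<beta> i + j) < q ^ partial_sum \<beta> (Suc i)"
      using q by (intro power_strict_increasing) (auto simp: partial_sum_Suc)
    then show ?thesis by (simp add: c_def ij)
  qed
  have a1: "w ^ a j = 1 \<longleftrightarrow> d dvd j" if "j < ?s" for j
  proof -
    have "j \<le> m" using that s by simp
    moreover from this have "d dvd m - j \<longleftrightarrow> d dvd j" using dvd_diffD1 dvd_diff_nat d(2) by blast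
    ultimately show ?thesis using frobenius_power_eq_one[of j m] by (simp add: a_def)
  qed
  have c1: "w ^ c (i, j) = 1 \<longleftrightarrow> d dvd \<beta> ! i - j" if "i < length \<beta>" "j < \<beta> ! i" for i j
  proof -
    have "partial_sum \<beta> (Suc i) - (partial_sum \<beta> i + j) = \<beta> ! i - j"
      "partial_sum \<beta> i + j \<le> partial_sum \<beta> (Suc i)"
      using that by (simp_all add: partial_sum_Suc)
    then show ?thesis
      using frobenius_power_eq_one[of "partial_sum \<beta> i + j" "partial_sum \<beta> (Suc i)"]
      by (simp only: c_def case_prod_conv)
  qed
  have nz: "card {j\<in>{..<?s}. w ^ a j = 1} = (?s + d - 1) div d"
  proof -
    have "{j\<in>{..<?s}. w ^ a j = 1} = {j\<in>{..<?s}. d dvd j}" using a1 by auto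
    then show ?thesis using card_multiples_below[OF d(1)] by simp
  qed
  have dz: "card {ij\<in>?J. w ^ c ij = 1} = (\<Sum>i<length \<beta>. \<beta> ! i div d)"
  proof -
    have "{ij\<in>?J. w ^ c ij = 1} = (SIGMA i:{..<length \<beta>}. {j\<in>{..<\<beta> ! i}. d dvd \<beta> ! i - j})"
      using c1 by auto
    then show ?thesis using card_multiples_from_top[OF d(1)] by simp
  qed
  have ssum: "?s = (\<Sum>i<length \<beta>. \<beta> ! i)" by (simp add: sum_list_sum_nth lessThan_atLeast0)
  \<comment> \<open>After multiplication by \<open>d\<close>, the two orders of vanishing lie on
    either side of \<open>?s\<close>. The inequality here becomes strict as soon as one part is not
    divisible by \<open>d\<close>.\<close>
  have dzle: "d * (\<Sum>i<length \<beta>. \<beta> ! i div d) \<le> ?s"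
    unfolding ssum sum_distrib_left by (intro sum_mono) simp
  have nzge: "?s \<le> d * ((?s + d - 1) div d)"
  proof -
    have "(?s + d - 1) mod d < d" using d by simp
    then show ?thesis using mult_div_mod_eq[of d "?s + d - 1"] d by linarith
  qed
  have le: "card {ij\<in>?J. w ^ c ij = 1} \<le> card {j\<in>{..<?s}. w ^ a j = 1}"
    unfolding nz dz using dzle nzge d by (metis le_trans mult_le_cancel1)
  have finJ: "finite ?J" by simp
  note T = tendsto_quotient_one_minus[OF w0 finite_lessThan finJ cpos le, folded numt dent]
  show ?thesis
  proof (cases "\<forall>b\<in>set \<beta>. d dvd b")
    case False
    then obtain i where i: "i < length \<beta>" "\<not> d dvd \<beta> ! i" by (metis in_set_conv_nth)
    have "d * (\<beta> ! i div d) \<noteq> \<beta> ! i" using i(2) by (metis dvd_triv_left)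
    then have "d * (\<beta> ! i div d) < \<beta> ! i" using times_div_less_eq_dividend[of d "\<beta> ! i"] by linarith
    then have "d * (\<Sum>i<length \<beta>. \<beta> ! i div d) < ?s"
      unfolding ssum sum_distrib_left using i(1) by (intro sum_strict_mono_ex1) auto
    then have "d * (\<Sum>i<length \<beta>. \<beta> ! i div d) < d * ((?s + d - 1) div d)" using nzge by linarith
    then have "((\<lambda>t. num_term q m \<beta> t / den_term q \<beta> t) \<longlongrightarrow> 0) (at w)"
      using T unfolding nz dz by simp
    then show ?thesis by (simp only: False if_False)
  next
    case True
    define b where "b = map (\<lambda>b. b div d) \<beta>"
    have \<beta>: "\<beta> = map ((*) d) b" using True by (auto simp: b_def map_idI intro!: map_idI[symmetric])
    have len: "length \<beta> = length b" by (simp add: b_def)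
    have nth: "\<beta> ! i = d * b ! i" if "i < length b" for i using that by (simp add: \<beta>)
    have sb: "?s = d * sum_list b" by (simp add: \<beta> sum_list_const_mult)
    have "(?s + d - 1) div d = sum_list b" using d by (simp add: sb div_nat_eqI)
    moreover have "(\<Sum>i<length \<beta>. \<beta> ! i div d) = sum_list b"
      using d by (simp add: len nth sum_list_sum_nth lessThan_atLeast0)
    ultimately have T': "((\<lambda>t. num_term q m \<beta> t / den_term q \<beta> t) \<longlongrightarrow>
        (\<Prod>j<?s. leading w (a j)) / (\<Prod>ij\<in>?J. leading w (c ij))) (at w)"
      using T unfolding nz dz by simp
    have "(\<Prod>j<?s. leading w (a j)) / (\<Prod>ij\<in>?J. leading w (c ij)) =
      (\<Prod>i<length \<beta>. \<Prod>j<\<beta> ! i. leading w (a (partial_sum \<beta> i + j)) / leading w (c (i, j)))"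
    proof -
      have "(\<Prod>ij\<in>?J. leading w (c ij)) = (\<Prod>i<length \<beta>. \<Prod>j<\<beta> ! i. leading w (c (i, j)))"
        by (simp add: prod.Sigma split_def)
      then show ?thesis by (simp only: prod_blocks[of _ \<beta>] prod_dividef)
    qed
    also have "\<dots> = (\<Prod>i<length \<beta>. \<Prod>j<\<beta> ! i. if d dvd j
        then of_nat (a (partial_sum \<beta> i + j)) / of_nat (c (i, j)) else 1)"
    proof (intro prod.cong refl)
      fix i j assume ij: "i \<in> {..<length \<beta>}" "j \<in> {..<\<beta> ! i}"
      have lt: "partial_sum \<beta> i + j < partial_sum \<beta> (Suc i)" using ij by (simp add: partial_sum_Suc)
      then have lts: "partial_sum \<beta> i + j < ?s" using partial_sum_le[of \<beta> "Suc i"] by linarith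
      have dP: "d dvd partial_sum \<beta> k" for k by (simp add: \<beta> partial_sum_map_mult)
      have A: "w ^ a (partial_sum \<beta> i + j) = 1 \<longleftrightarrow> d dvd j"
        using a1[OF lts] dP[of i] by (simp add: dvd_add_right_iff)
      \<comment> \<open>The powers with exponents \<open>q ^ m\<close> and
        \<open>q ^ partial_sum \<beta> (Suc i)\<close> both return \<open>w\<close>, and the
        subtracted exponent is the same. So factors that do not vanish cancel in pairs, and those
        that vanish leave the quotient of their exponents.\<close>
      have "w ^ c (i, j) = w ^ a (partial_sum \<beta> i + j)"
      proof -
        have "w ^ c (i, j) * w ^ (q ^ (partial_sum \<beta> i + j)) = w ^ (q ^ partial_sum \<beta> (Suc i))"
          using lt q by (simp add: c_def power_increasing flip: power_add)
        also have "\<dots> = w" using key dP by blast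
        also have "\<dots> = w ^ (q ^ m)" using key d(2) by metis
        also have "\<dots> = w ^ a (partial_sum \<beta> i + j) * w ^ (q ^ (partial_sum \<beta> i + j))"
          using lts s q by (simp add: a_def power_increasing flip: power_add)
        finally show ?thesis using w0 by simp
      qed
      then show "leading w (a (partial_sum \<beta> i + j)) / leading w (c (i, j)) =
          (if d dvd j then of_nat (a (partial_sum \<beta> i + j)) / of_nat (c (i, j)) else 1)"
        using A by (auto simp: leading_def)
    qed
    also have "\<dots> = (\<Prod>i<length b. \<Prod>j<b ! i.
        of_nat (a (d * (partial_sum b i + j))) / of_nat (c (i, d * j)))"
      by (simp add: len nth prod_multiples[OF d(1)] distrib_left)
        (simp add: \<beta> partial_sum_map_mult)
    also have "\<dots> = (\<Prod>i<length b. \<Prod>j<b ! i. of_real (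
        (real (q ^ d) ^ (m div d) - real (q ^ d) ^ (partial_sum b i + j)) /
        (real (q ^ d) ^ (0 + partial_sum b (Suc i)) - real (q ^ d) ^ (0 + partial_sum b i + j))))"
    proof (intro prod.cong refl)
      fix i j assume ij: "i \<in> {..<length b}" "j \<in> {..<b ! i}"
      have lt: "partial_sum b i + j < partial_sum b (Suc i)" using ij by (simp add: partial_sum_Suc)
      have "partial_sum b (Suc i) \<le> sum_list b" by (rule partial_sum_le)
      then have "d * (partial_sum b i + j) \<le> m" using lt s sb d
        by (metis le_trans less_imp_le_nat mult_le_mono2)
      then have "of_nat (a (d * (partial_sum b i + j))) =
          (of_real (real (q ^ d) ^ (m div d) - real (q ^ d) ^ (partial_sum b i + j)) :: complex)"
        using d q by (simp add: a_def of_nat_diff power_increasing flip: power_mult)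
      moreover have "of_nat (c (i, d * j)) =
          (of_real (real (q ^ d) ^ (0 + partial_sum b (Suc i)) - real (q ^ d) ^ (0 + partial_sum b i + j)) :: complex)"
        using lt q d by (simp add: c_def \<beta> partial_sum_map_mult of_nat_diff power_increasing
            flip: power_mult distrib_left)
      ultimately show "of_nat (a (d * (partial_sum b i + j))) / of_nat (c (i, d * j)) =
        (of_real ((real (q ^ d) ^ (m div d) - real (q ^ d) ^ (partial_sum b i + j)) /
        (real (q ^ d) ^ (0 + partial_sum b (Suc i)) - real (q ^ d) ^ (0 + partial_sum b i + j))) :: complex)"
        by simp
    qed
    also have "\<dots> = of_real (term_value q d m b)"
      unfolding term_value_def flag_denom_index prod_blocks[of _ b]
      by (simp only: of_real_prod of_real_divide prod_dividef)
    finally show ?thesis using T' True by (simp add: b_def)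
  qed
qed

text \<open>The series is a polynomial because \<open>h\<close> has bounded support. By continuity
  its value at \<open>w\<close> is a limit, and the limit can be taken summand by summand with
  \<open>tendsto_term\<close>.\<close>

lemma C_series_at_root:
  assumes C: "Abs_fps (\<lambda>k. of_nat (h k)) = C_series q \<alpha> m" and h: "\<And>k. k > D \<Longrightarrow> h k = 0"
  shows "(\<Sum>k\<le>D. of_nat (h k) * w ^ k) =
    of_real (\<Sum>b | length b = length \<alpha> \<and> (\<forall>i<length \<alpha>. d * b ! i \<le> \<alpha> ! i) \<and> d * sum_list b \<le> m. term_value q d m b)"
proof -
  define S where "S = {\<beta>. length \<beta> = length \<alpha> \<and> (\<forall>i<length \<alpha>. \<beta> ! i \<le> \<alpha> ! i) \<and> sum_list \<beta> \<le> m}"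
  have finS: "finite S"
  proof (rule finite_subset)
    show "S \<subseteq> {\<beta>. set \<beta> \<subseteq> {..m} \<and> length \<beta> = length \<alpha>}"
      using member_le_sum_list unfolding S_def by (fastforce intro: order_trans)
    show "finite {\<beta>. set \<beta> \<subseteq> {..m} \<and> length \<beta> = length \<alpha>}" by (rule finite_lists_length_eq) simp
  qed
  define e where "e \<beta> = (\<Sum>i<length \<alpha>. (\<alpha> ! i - \<beta> ! i) * (q ^ m - q ^ partial_sum \<beta> (Suc i)))" for \<beta>
  define nu where "nu \<beta> = (\<Prod>j<sum_list \<beta>. one_minus (q ^ m - q ^ j))" for \<beta>
  define de where "de \<beta> = (\<Prod>i<length \<beta>. \<Prod>j<\<beta> ! i.
     one_minus (q ^ partial_sum \<beta> (Suc i) - q ^ (partial_sum \<beta> i + j)))" for \<beta>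
  define p :: "complex poly" where "p = (\<Sum>k\<le>D. Polynomial.monom (of_nat (h k)) k)"
  have pos: "q ^ partial_sum \<beta> (Suc i) - q ^ (partial_sum \<beta> i + j) > 0"
    if "i < length \<beta>" "j < \<beta> ! i" for \<beta> i j
  proof -
    have "q ^ (partial_sum \<beta> i + j) < q ^ partial_sum \<beta> (Suc i)"
      using q that by (intro power_strict_increasing) (auto simp: partial_sum_Suc)
    then show ?thesis by simp
  qed
  have d1: "fps_nth (\<Prod>i<length \<beta>. \<Prod>j<\<beta> ! i.
      1 - fps_X ^ (q ^ partial_sum \<beta> (Suc i) - q ^ (partial_sum \<beta> i + j)) :: 'z::field fps) 0 = 1" for \<beta>
    unfolding fps_nth_prod_0
  proof (intro prod.neutral ballI)
    fix i j assume ij: "i \<in> {..<length \<beta>}" "j \<in> {..<\<beta> ! i}"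
    have "q ^ partial_sum \<beta> (Suc i) - q ^ (partial_sum \<beta> i + j) \<noteq> 0" using pos[of i \<beta> j] ij by simp
    then show "fps_nth (1 - fps_X ^ (q ^ partial_sum \<beta> (Suc i) - q ^ (partial_sum \<beta> i + j)) :: 'z fps) 0 = 1"
      by (simp add: fps_X_power_nth)
  qed
  have "fps_of_poly p = fps_cplx (Abs_fps (\<lambda>k. of_nat (h k)))"
    using h by (auto simp: fps_eq_iff p_def fps_cplx_def coeff_sum not_le if_distrib cong: if_cong)
  also have "\<dots> = (\<Sum>\<beta>\<in>S. fps_X ^ e \<beta> * (fps_of_poly (nu \<beta>) / fps_of_poly (de \<beta>)))"
    unfolding C C_series_def S_def[symmetric] fps_cplx_sum
  proof (intro sum.cong refl)
    fix \<beta> assume "\<beta> \<in> S"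
    then have l: "length \<alpha> = length \<beta>" by (simp add: S_def)
    show "fps_cplx (fps_X ^ (\<Sum>i<length \<alpha>. (\<alpha> ! i - \<beta> ! i) * (q ^ m - q ^ partial_sum \<beta> (Suc i))) *
        ((\<Prod>j<sum_list \<beta>. 1 - fps_X ^ (q ^ m - q ^ j)) /
         (\<Prod>i<length \<alpha>. \<Prod>j<\<beta> ! i.
            1 - fps_X ^ (q ^ partial_sum \<beta> (Suc i) - q ^ (partial_sum \<beta> i + j))))) =
       fps_X ^ e \<beta> * (fps_of_poly (nu \<beta>) / fps_of_poly (de \<beta>))"
      unfolding l fps_cplx_mult
      by (subst fps_cplx_divide)
        (simp_all add: d1 e_def nu_def de_def l fps_cplx_mult fps_cplx_power fps_cplx_X fps_cplx_prod
          fps_cplx_diff fps_cplx_1 fps_of_poly_prod fps_one_minus)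
  qed
  finally have P: "fps_of_poly p = (\<Sum>\<beta>\<in>S. fps_X ^ e \<beta> * (fps_of_poly (nu \<beta>) / fps_of_poly (de \<beta>)))" .
  have dc: "Polynomial.coeff (de \<beta>) 0 \<noteq> 0" for \<beta>
  proof -
    have "fps_nth (fps_of_poly (de \<beta>)) 0 = 1"
      unfolding de_def fps_of_poly_prod fps_one_minus by (rule d1)
    then show ?thesis by simp
  qed
  have polynu: "poly (nu \<beta>) t = num_term q m \<beta> t" for \<beta> t
    by (simp add: nu_def num_term_def poly_prod poly_monom)
  have polyde: "poly (de \<beta>) t = den_term q \<beta> t" for \<beta> t
    by (simp add: de_def den_term_def poly_prod poly_monom)
  have "\<forall>\<^sub>F t in at w. poly (de \<beta>) t \<noteq> 0" for \<beta>
  proof -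
    have "de \<beta> \<noteq> 0" using dc[of \<beta>] by auto
    then have "finite {t. poly (de \<beta>) t = 0}" by (rule poly_roots_finite)
    \<comment> \<open>Only the roots other than \<open>w\<close> are removed, so \<open>w\<close>
      lies in this open set; \<open>w\<close> itself is excluded by the punctured filter.\<close>
    then have "open (- ({t. poly (de \<beta>) t = 0} - {w}))" by (intro open_Compl finite_imp_closed) simp
    then have "\<forall>\<^sub>F t in at w. t \<in> - ({t. poly (de \<beta>) t = 0} - {w})"
      by (rule eventually_at_in_open') simp
    then show ?thesis using eventually_neq_at_within[of w w UNIV] by eventually_elim auto
  qed
  then have "\<forall>\<^sub>F t in at w. \<forall>\<beta>\<in>S. poly (de \<beta>) t \<noteq> 0"
    using finS by (simp add: eventually_ball_finite_distrib)
  then have ev: "\<forall>\<^sub>F t in at w. (\<Sum>\<beta>\<in>S. t ^ e \<beta> * (num_term q m \<beta> t / den_term q \<beta> t)) = poly p t"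
    by eventually_elim (simp add: fps_sum_fractions_eval[OF finS P dc] polynu polyde)
  let ?L = "\<lambda>\<beta>. if \<forall>b\<in>set \<beta>. d dvd b then complex_of_real (term_value q d m (map (\<lambda>b. b div d) \<beta>)) else 0"
  have "((\<lambda>t. \<Sum>\<beta>\<in>S. t ^ e \<beta> * (num_term q m \<beta> t / den_term q \<beta> t)) \<longlongrightarrow>
      (\<Sum>\<beta>\<in>S. w ^ e \<beta> * ?L \<beta>)) (at w)"
    by (intro tendsto_sum tendsto_mult tendsto_term tendsto_power tendsto_ident_at) (simp add: S_def)
  from Lim_transform_eventually[OF this ev] have "(poly p \<longlongrightarrow> (\<Sum>\<beta>\<in>S. w ^ e \<beta> * ?L \<beta>)) (at w)" .
  moreover have "(poly p \<longlongrightarrow> poly p w) (at w)" by (rule poly_isCont[unfolded isCont_def])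
  ultimately have "poly p w = (\<Sum>\<beta>\<in>S. w ^ e \<beta> * ?L \<beta>)" using LIM_unique by blast
  \<comment> \<open>The monomial in front becomes 1 if \<open>d\<close> divides all parts, since
    then \<open>d\<close> also divides \<open>m\<close> minus each partial sum; in the other case
    the limit is 0 anyway.\<close>
  also have "\<dots> = (\<Sum>\<beta>\<in>S. ?L \<beta>)"
  proof (intro sum.cong refl)
    fix \<beta> assume \<beta>: "\<beta> \<in> S"
    show "w ^ e \<beta> * ?L \<beta> = ?L \<beta>"
    proof (cases "\<forall>b\<in>set \<beta>. d dvd b")
      case True
      have "w ^ ((\<alpha> ! i - \<beta> ! i) * (q ^ m - q ^ partial_sum \<beta> (Suc i))) = 1" for i
      proof -
        have "d dvd b" if "b \<in> set (take (Suc i) \<beta>)" for b using that True by (meson in_set_takeD)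
        then have "d dvd partial_sum \<beta> (Suc i)" unfolding partial_sum_def
          by (rule dvd_sum_list)
        moreover have "partial_sum \<beta> (Suc i) \<le> m" using partial_sum_le[of \<beta> "Suc i"] \<beta> by (simp add: S_def)
        ultimately have "w ^ (q ^ m - q ^ partial_sum \<beta> (Suc i)) = 1"
          using d by (subst frobenius_power_eq_one) (auto simp: dvd_diff_nat)
        then show ?thesis by (metis mult.commute power_mult power_one)
      qed
      then have "w ^ e \<beta> = 1" by (simp add: e_def power_sum)
      then show ?thesis by simp
    next
      case False
      then show ?thesis by (simp only: False if_False mult_zero_right)
    qed
  qed
  also have "\<dots> = (\<Sum>\<beta>\<in>{\<beta>\<in>S. \<forall>b\<in>set \<beta>. d dvd b}. of_real (term_value q d m (map (\<lambda>b. b div d) \<beta>)))"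
    using finS by (rule sum.inter_filter[symmetric])
  also have "{\<beta>\<in>S. \<forall>b\<in>set \<beta>. d dvd b} = map ((*) d) `
      {b. length b = length \<alpha> \<and> (\<forall>i<length \<alpha>. d * b ! i \<le> \<alpha> ! i) \<and> d * sum_list b \<le> m}" (is "_ = _ ` ?B")
  proof (intro equalityI subsetI)
    fix \<beta> assume \<beta>: "\<beta> \<in> {\<beta>\<in>S. \<forall>b\<in>set \<beta>. d dvd b}"
    define b where "b = map (\<lambda>b. b div d) \<beta>"
    have e: "\<beta> = map ((*) d) b" using \<beta> by (auto simp: b_def intro!: map_idI[symmetric])
    then have "b \<in> ?B" using \<beta> by (auto simp: S_def sum_list_const_mult)
    then show "\<beta> \<in> map ((*) d) ` ?B" using e by blast
  qed (auto simp: S_def sum_list_const_mult)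
  also have "(\<Sum>\<beta>\<in>map ((*) d) ` ?B. complex_of_real (term_value q d m (map (\<lambda>b. b div d) \<beta>))) =
      (\<Sum>b\<in>?B. complex_of_real (term_value q d m b))"
    using d by (subst sum.reindex) (auto simp: inj_on_def comp_def)
  finally show ?thesis by (simp add: p_def poly_sum poly_monom)
qed

end

section \<open>Flags spanned by lists of vectors\<close>

text \<open>In a finite multiplicatively closed set the inverse of a nonzero element is one of its
  powers.\<close>

lemma finite_subfieldI:
  fixes K :: "'k::field set"
  assumes K: "finite K" "0 \<in> K" "1 \<in> K" "\<And>a b. a \<in> K \<Longrightarrow> b \<in> K \<Longrightarrow> a + b \<in> K"
    "\<And>a b. a \<in> K \<Longrightarrow> b \<in> K \<Longrightarrow> a * b \<in> K" "\<And>a. a \<in> K \<Longrightarrow> - a \<in> K"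
  shows "finite_subfield K"
proof
  fix a assume a: "a \<in> K"
  show "inverse a \<in> K"
  proof (cases "a = 0")
    case False
    have "a ^ card (K - {0}) = 1" using K a False by (intro power_card_mult_closed) auto
    moreover have "card (K - {0}) > 0" using K(1) a False by (subst card_gt_0_iff) blast
    ultimately have "a * a ^ (card (K - {0}) - 1) = 1" by (metis Suc_diff_1 power_Suc)
    then have "inverse a = a ^ (card (K - {0}) - 1)" by (rule inverse_unique)
    moreover have "a ^ k \<in> K" for k by (induct k) (use K a in auto)
    ultimately show ?thesis by simp
  qed (use K in simp)
qed (use K in auto)

lemma subfield_finite_subfield:
  assumes "subfield E (class_ring :: 'k::field ring)" "finite E"
  shows "finite_subfield E"
proof -
  note r = subringE[OF subfieldE(1)[OF assms(1)]]
  have "- a = \<ominus>\<^bsub>class_ring\<^esub> a" for a :: 'k by (simp add: class_ring_simps)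
  then show ?thesis
    using r assms(2) by (intro finite_subfieldI) auto
qed

context finite_subfield
begin

lemma gen_append: "gen U (xs @ ys) = gen (gen U xs) ys"
  by (induct xs arbitrary: U) auto

lemma adj_zero: "adj U 0 = U"
  unfolding adj_def using K0 by force

lemma adj_absorb: "sp U \<Longrightarrow> x \<in> U \<Longrightarrow> adj U x = U"
  using adj_least[of U U x] adj_superset[of U x] by auto

lemma card_adj_cases: "sp U \<Longrightarrow> card (adj U x) = card U * Q ^ (if x \<in> U then 0 else 1)"
  by (simp add: adj_absorb card_adj)

lemma gen_replicate_zero: "gen U (replicate k 0) = U"
  by (induct k) (auto simp: adj_zero)

lemma finite_gen: "finite U \<Longrightarrow> finite (gen U xs)"
  by (induct xs arbitrary: U) (auto simp: finite_adj)

text \<open>Redundant entries leave the span unchanged, so the exponent may fall short of the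
  length.\<close>

lemma gen_card_exponent: "sp U \<Longrightarrow> \<exists>b\<le>length xs. card (gen U xs) = card U * Q ^ b"
proof (induct xs arbitrary: U)
  case (Cons x xs)
  obtain b where "b \<le> length xs" "card (gen (adj U x) xs) = card (adj U x) * Q ^ b"
    using Cons(1)[OF sp_adj[OF Cons(2)]] by blast
  then show ?case using card_adj_cases[OF Cons(2), of x]
    by (intro exI[of _ "b + (if x \<in> U then 0 else 1)"]) (auto simp: power_add)
qed auto

text \<open>The reversal makes \<open>lspan\<close> grow at the front of the list, so that dropping
  initial entries passes to a smaller span by one \<open>adj\<close> at a time.\<close>

definition lspan :: "'k list \<Rightarrow> 'k set" where
  "lspan xs = gen {0} (rev xs)"

lemma lspan_Nil [simp]: "lspan [] = {0}"
  by (simp add: lspan_def)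

lemma lspan_Cons [simp]: "lspan (x # xs) = adj (lspan xs) x"
  by (simp add: lspan_def gen_append)

lemma lspan_append: "lspan (ys @ xs) = gen (lspan xs) (rev ys)"
  by (simp add: lspan_def gen_append)

lemma sp_lspan: "sp (lspan xs)"
  by (simp add: lspan_def sp_gen sp_zero)

lemma finite_lspan: "finite (lspan xs)"
  by (simp add: lspan_def finite_gen)

lemma lspan_least: "sp W \<Longrightarrow> set xs \<subseteq> W \<Longrightarrow> lspan xs \<subseteq> W"
  unfolding lspan_def by (intro gen_least) (auto simp: spD)

lemma lspan_superset: "set xs \<subseteq> lspan xs"
  by (induct xs) (use adj_superset adj_mem sp_lspan in auto)

text \<open>Each dropped entry loses at most a factor \<open>Q\<close>.\<close>

lemma lspan_drop_card: "card (lspan (drop s xs)) \<le> Q ^ k * card (lspan (drop (s + k) xs))"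
proof (induct k)
  case (Suc k)
  have "card (lspan (drop (s + k) xs)) \<le> Q * card (lspan (drop (s + Suc k) xs))"
  proof (cases "s + k < length xs")
    case True
    then show ?thesis using Cons_nth_drop_Suc[OF True, symmetric] Q_ge_2
      by (auto simp: card_adj_cases[OF sp_lspan])
  qed (use Q_ge_2 in simp)
  then have "Q ^ k * card (lspan (drop (s + k) xs)) \<le> Q ^ k * (Q * card (lspan (drop (s + Suc k) xs)))"
    by (rule mult_le_mono2)
  also have "\<dots> = Q ^ Suc k * card (lspan (drop (s + Suc k) xs))" by simp
  finally show ?case using Suc by (rule le_trans[rotated])
qed simp

text \<open>Here a flag is extended at its large end, which is how \<open>dchains\<close>
  grows.\<close>

lemma flags_snoc:
  "flags U W (bs @ [b]) = (\<lambda>(Vs, V). Vs @ [V]) ` (SIGMA Vs:flags U W bs. subs (last (U # Vs)) W b)"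
proof (induct bs arbitrary: U)
  case (Cons c bs)
  then show ?case by (fastforce simp: image_iff Cons)
qed (auto simp: image_iff)

text \<open>Flags with the largest member first, as \<open>flag\<close> produces them. The appended
  default supplies the zero space below the last listed member.\<close>

fun dchains :: "'k set \<Rightarrow> nat list \<Rightarrow> 'k set list set" where
  "dchains W [] = {[]}"
| "dchains W (b # bs) = (\<lambda>(Vs, V). V # Vs) ` (SIGMA Vs:dchains W bs. subs (hd (Vs @ [{0}])) W b)"

lemma dchains_rev: "rev ` dchains W bs = flags {0} W (rev bs)"
proof (induct bs)
  case (Cons b bs)
  have h: "hd (Vs @ [{0}]) = last ({0} # rev Vs)" for Vs :: "'k set list"
    by (cases Vs) auto
  show ?case by (simp add: flags_snoc Cons[symmetric] image_image h) (force simp: image_iff)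
qed simp

lemma dchains_sp: "Vs \<in> dchains W bs \<Longrightarrow> V \<in> set (Vs @ [{0}]) \<Longrightarrow> sp V"
  by (induct bs arbitrary: Vs) (auto simp: subs_def sp_zero)

lemma finite_dchains: "finite W \<Longrightarrow> finite (dchains W bs)"
  by (induct bs) (auto simp: finite_subs)

text \<open>\<open>dchains\<close> reverses the type of the flag, and \<open>flag_denom_rev\<close>
  absorbs the reversal.\<close>

lemma card_dchains:
  assumes W: "sp W" "finite W" "card W = Q ^ M"
  shows "real (card (dchains W bs)) = (\<Prod>j<sum_list bs. real Q ^ M - real Q ^ j) / flag_denom Q 0 bs"
proof -
  have "card (dchains W bs) = card (flags {0} W (rev bs))"
    unfolding dchains_rev[symmetric] by (simp add: card_image inj_on_def)
  moreover have "real (card (flags {0} W (rev bs))) * flag_denom Q 0 (rev bs) =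
      (\<Prod>j<sum_list (rev bs). real Q ^ M - real Q ^ (0 + j))"
    by (rule card_flags[OF W sp_zero]) (use W spD(1) in auto)
  ultimately show ?thesis
    using flag_denom_pos[OF Q_ge_2, of 0 bs] by (simp add: flag_denom_rev sum_list_rev field_simps)
qed

text \<open>The type of a chain is recovered from the sizes of its members.\<close>

lemma dchains_disjoint:
  assumes "Vs \<in> dchains W bs" "Vs \<in> dchains W cs" "finite W" "length bs = length cs"
  shows "bs = cs"
  using assms(4,1,2)
proof (induct bs cs arbitrary: Vs rule: list_induct2)
  case (Cons b bs c cs)
  then obtain V Vs' where V: "Vs = V # Vs'" "Vs' \<in> dchains W bs" "Vs' \<in> dchains W cs"
    "V \<in> subs (hd (Vs' @ [{0}])) W b" "V \<in> subs (hd (Vs' @ [{0}])) W c" by auto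
  let ?U = "hd (Vs' @ [{0}])"
  have "?U \<in> set (Vs' @ [{0}])" by (intro hd_in_set) simp
  then have "sp ?U" using dchains_sp V(2) by blast
  moreover have "finite ?U" using V(4) assms(3) by (auto simp: subs_def intro: finite_subset)
  ultimately have "card ?U > 0" using spD(1) by (auto simp: card_gt_0_iff)
  then have "Q ^ b = Q ^ c" using V(4,5) by (simp add: subs_def)
  then have "b = c" using Q_ge_2 by simp
  then show ?case using Cons(2)[OF V(2,3)] by simp
qed simp

text \<open>The spans of the final segments that start at block boundaries; the zero space after the
  last block is left out.\<close>

fun flag :: "nat list \<Rightarrow> 'k list \<Rightarrow> 'k set list" where
  "flag [] xs = []"
| "flag (a # \<alpha>) xs = lspan xs # flag \<alpha> (drop a xs)"

lemma flag_index: "flag \<alpha> xs = map (\<lambda>b. lspan (drop (partial_sum \<alpha> b) xs)) [0..<length \<alpha>]"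
proof (induct \<alpha> arbitrary: xs)
  case (Cons a \<alpha>)
  have "[0..<length (a # \<alpha>)] = 0 # map Suc [0..<length \<alpha>]" 
    by (simp only: length_Cons map_Suc_upt upt_conv_Cons[OF zero_less_Suc])
  then show ?case by (simp add: Cons partial_sum_def comp_def add.commute)
qed simp

lemma hd_flag: "length xs = sum_list \<alpha> \<Longrightarrow> hd (flag \<alpha> xs @ [{0}]) = lspan xs"
  by (cases \<alpha>) auto

text \<open>The bound on \<open>b\<close> reflects that a block of \<open>a\<close> vectors enlarges
  the span by at most \<open>a\<close> dimensions.\<close>

fun stable_chains :: "'k set \<Rightarrow> 'k \<Rightarrow> nat list \<Rightarrow> 'k set list set" where
  "stable_chains E g [] = {[]}"
| "stable_chains E g (a # \<alpha>) = {W # Ws | W Ws. Ws \<in> stable_chains E g \<alpha> \<and> (\<forall>x\<in>W. g * x \<in> W) \<and>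
     (\<exists>b\<le>a. W \<in> subs (hd (Ws @ [{0}])) E b)}"

text \<open>A step of dimension at most \<open>a\<close> is realised by a block that consists of a
  basis modulo the smaller space, padded with zeros.\<close>

lemma flag_image_stable:
  assumes E: "sp E" "finite E"
  shows "{Ws \<in> flag \<alpha> ` {xs. length xs = sum_list \<alpha> \<and> set xs \<subseteq> E}. \<forall>W\<in>set Ws. \<forall>x\<in>W. g * x \<in> W} =
    stable_chains E g \<alpha>"
proof (induct \<alpha>)
  case Nil
  show ?case by auto
next
  case (Cons a \<alpha>)
  show ?case
  proof (intro equalityI subsetI)
    fix Ws assume "Ws \<in> {Ws \<in> flag (a # \<alpha>) ` {xs. length xs = sum_list (a # \<alpha>) \<and> set xs \<subseteq> E}.
      \<forall>W\<in>set Ws. \<forall>x\<in>W. g * x \<in> W}"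
    then obtain xs where xs: "Ws = flag (a # \<alpha>) xs" "length xs = a + sum_list \<alpha>" "set xs \<subseteq> E"
      and st: "\<forall>W\<in>set Ws. \<forall>x\<in>W. g * x \<in> W" by auto
    let ?ys = "drop a xs"
    have ys: "length ?ys = sum_list \<alpha>" "set ?ys \<subseteq> E" using xs set_drop_subset[of a xs] by auto
    have "flag \<alpha> ?ys \<in> stable_chains E g \<alpha>"
      unfolding Cons[symmetric] using ys st xs(1) by auto
    moreover have "\<exists>b\<le>a. lspan xs \<in> subs (hd (flag \<alpha> ?ys @ [{0}])) E b"
    proof -
      have s: "lspan xs = gen (lspan ?ys) (rev (take a xs))"
        using lspan_append[of "take a xs" ?ys] by simp
      obtain b where "b \<le> length (rev (take a xs))" "card (lspan xs) = card (lspan ?ys) * Q ^ b"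
        unfolding s using gen_card_exponent[OF sp_lspan] by blast
      moreover have "lspan ?ys \<subseteq> lspan xs" unfolding s by (rule gen_superset)
      ultimately show ?thesis
        using hd_flag[OF ys(1)] sp_lspan lspan_least[OF E(1) xs(3)] xs(2)
        by (intro exI[of _ b]) (auto simp: subs_def)
    qed
    ultimately show "Ws \<in> stable_chains E g (a # \<alpha>)" using st xs(1) by auto
  next
    fix Ws assume "Ws \<in> stable_chains E g (a # \<alpha>)"
    then obtain W Vs b where W: "Ws = W # Vs" "Vs \<in> stable_chains E g \<alpha>" "\<forall>x\<in>W. g * x \<in> W"
      "b \<le> a" "W \<in> subs (hd (Vs @ [{0}])) E b" by auto
    obtain ys where ys: "Vs = flag \<alpha> ys" "length ys = sum_list \<alpha>" "set ys \<subseteq> E"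
      and st: "\<forall>W\<in>set Vs. \<forall>x\<in>W. g * x \<in> W"
      using W(2) unfolding Cons[symmetric] by auto
    have hd: "hd (Vs @ [{0}]) = lspan ys" using hd_flag[OF ys(2)] ys(1) by simp
    have sW: "sp W" "lspan ys \<subseteq> W" "W \<subseteq> E" "card W = card (lspan ys) * Q ^ b"
      using W(5) by (auto simp: subs_def hd)
    obtain c zs where zs: "card W = card (lspan ys) * Q ^ c" "length zs = c" "gen (lspan ys) zs = W" "set zs \<subseteq> W"
      using sp_card[OF sW(1) finite_subset[OF sW(3) E(2)] sp_lspan sW(2)] by metis
    have "card (lspan ys) > 0" using finite_lspan sp_lspan spD(1) by (auto simp: card_gt_0_iff)
    then have "Q ^ b = Q ^ c" using sW(4) zs(1) by simp
    then have bc: "c = b" using Q_ge_2 by simp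
    \<comment> \<open>The padding fills the block up to \<open>a\<close> entries; the reversal
      matches the order in which \<open>lspan_append\<close> adds them.\<close>
    define xs where "xs = rev (zs @ replicate (a - b) 0) @ ys"
    have "lspan xs = W"
      by (simp add: xs_def lspan_append gen_append zs(3) gen_replicate_zero del: rev_append)
    moreover have "drop a xs = ys" using W(4) zs(2) bc by (simp add: xs_def)
    ultimately have "Ws = flag (a # \<alpha>) xs" by (simp add: W(1) ys(1))
    moreover have "length xs = sum_list (a # \<alpha>)" using W(4) zs(2) bc ys(2) by (simp add: xs_def)
    moreover have "set xs \<subseteq> E" using zs(4) sW(3) ys(3) spD(1)[OF E(1)] by (auto simp: xs_def)
    ultimately show "Ws \<in> {Ws \<in> flag (a # \<alpha>) ` {xs. length xs = sum_list (a # \<alpha>) \<and> set xs \<subseteq> E}.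
      \<forall>W\<in>set Ws. \<forall>x\<in>W. g * x \<in> W}" using W(1,3) st by auto
  qed
qed

text \<open>
  A subspace over \<open>K\<close> that is stable under \<open>g\<close> is a subspace over the field \<open>L = K[g]\<close>.
\<close>

lemma stable_chains_dchains:
  assumes L: "finite_subfield L" and LQ: "card L = Q ^ d" and d: "d > 0"
    and spL: "\<And>W. sp W \<and> (\<forall>x\<in>W. g * x \<in> W) \<longleftrightarrow> finite_subfield.sp L W"
    and E: "finite E"
  shows "stable_chains E g \<alpha> =
    (\<Union>b\<in>{b. length b = length \<alpha> \<and> (\<forall>i<length \<alpha>. d * b ! i \<le> \<alpha> ! i)}. finite_subfield.dchains L E b)"
proof (induct \<alpha>)
  case Nil
  interpret L: finite_subfield L by fact
  show ?case by auto
next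
  case (Cons a \<alpha>)
  interpret L: finite_subfield L by fact
  show ?case
  proof (intro equalityI subsetI)
    fix Ws assume "Ws \<in> stable_chains E g (a # \<alpha>)"
    then obtain W Vs c where W: "Ws = W # Vs" "Vs \<in> stable_chains E g \<alpha>" "\<forall>x\<in>W. g * x \<in> W"
      "c \<le> a" "W \<in> subs (hd (Vs @ [{0}])) E c" by auto
    obtain b where b: "length b = length \<alpha>" "\<forall>i<length \<alpha>. d * b ! i \<le> \<alpha> ! i" "Vs \<in> L.dchains E b"
      using W(2) unfolding Cons by auto
    let ?U = "hd (Vs @ [{0}])"
    have "?U \<in> set (Vs @ [{0}])" by (intro hd_in_set) simp
    then have U: "L.sp ?U" using L.dchains_sp b(3) by blast
    have WL: "L.sp W" using W(3,5) spL by (auto simp: subs_def)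
    have fW: "finite W" and UW: "?U \<subseteq> W" using W(5) E by (auto simp: subs_def intro: finite_subset)
    \<comment> \<open>Both spaces are spaces over \<open>L\<close>, so the dimension
      \<open>c\<close> of the step over \<open>K\<close> is \<open>d\<close> times the dimension
      \<open>e\<close> over \<open>L\<close>.\<close>
    obtain e where e: "card W = card ?U * card L ^ e" using L.sp_card[OF WL fW U UW] by metis
    have "card ?U > 0" using finite_subset[OF UW fW] L.spD(1)[OF U] by (auto simp: card_gt_0_iff)
    then have "Q ^ c = Q ^ (d * e)" using e W(5) by (simp add: subs_def LQ power_mult)
    then have ce: "c = d * e" using Q_ge_2 by simp
    have "W \<in> L.subs ?U E e" using WL e W(5) by (auto simp: L.subs_def subs_def)
    then have "Ws \<in> L.dchains E (e # b)" using b(3) W(1) by force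
    moreover have "d * (e # b) ! i \<le> (a # \<alpha>) ! i" if "i < length (a # \<alpha>)" for i
      using that b(2) W(4) ce by (cases i) auto
    ultimately show "Ws \<in> (\<Union>b\<in>{b. length b = length (a # \<alpha>) \<and>
        (\<forall>i<length (a # \<alpha>). d * b ! i \<le> (a # \<alpha>) ! i)}. L.dchains E b)"
      using b(1) by (intro UN_I[of "e # b"]) auto
  next
    fix Ws assume "Ws \<in> (\<Union>b\<in>{b. length b = length (a # \<alpha>) \<and>
        (\<forall>i<length (a # \<alpha>). d * b ! i \<le> (a # \<alpha>) ! i)}. L.dchains E b)"
    then obtain b' where b': "length b' = Suc (length \<alpha>)" "\<forall>i<Suc (length \<alpha>). d * b' ! i \<le> (a # \<alpha>) ! i"
      "Ws \<in> L.dchains E b'" by auto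
    then obtain e b where eb: "b' = e # b" by (cases b') auto
    have ea: "d * e \<le> a" using b'(2) eb by auto
    have b: "length b = length \<alpha>" "\<forall>i<length \<alpha>. d * b ! i \<le> \<alpha> ! i" using b'(1,2) eb by auto
    obtain W Vs where W: "Ws = W # Vs" "Vs \<in> L.dchains E b" "W \<in> L.subs (hd (Vs @ [{0}])) E e"
      using b'(3) eb by auto
    have "Vs \<in> stable_chains E g \<alpha>" unfolding Cons using b W(2) by blast
    moreover have "sp W" "\<forall>x\<in>W. g * x \<in> W" using W(3) spL by (auto simp: L.subs_def)
    moreover have "card W = card (hd (Vs @ [{0}])) * Q ^ (d * e)"
      using W(3) by (simp add: L.subs_def LQ power_mult)
    ultimately show "Ws \<in> stable_chains E g (a # \<alpha>)"
      using W(1,3) ea by (auto simp: subs_def L.subs_def intro!: exI[of _ "d * e"])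
  qed
qed

end

section \<open>Orbits of parabolic subgroups\<close>

lemma range_finite_subfield:
  fixes \<iota> :: "'f::{field,finite} \<Rightarrow> 'k::field"
  assumes "field_hom \<iota>"
  shows "finite_subfield (range \<iota>)" "card (range \<iota>) = card (UNIV :: 'f set)"
proof -
  interpret \<iota>: field_hom \<iota> by fact
  show "finite_subfield (range \<iota>)"
  proof (rule finite_subfieldI)
    show "0 \<in> range \<iota>" "1 \<in> range \<iota>"
      using \<iota>.hom_zero \<iota>.hom_one by (metis rangeI)+
    show "a + b \<in> range \<iota>" "a * b \<in> range \<iota>" if "a \<in> range \<iota>" "b \<in> range \<iota>" for a b
      using that by (auto simp flip: \<iota>.hom_add \<iota>.hom_mult)
    show "- a \<in> range \<iota>" if "a \<in> range \<iota>" for a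
      using that by (auto simp flip: \<iota>.hom_uminus)
  qed simp
  show "card (range \<iota>) = card (UNIV :: 'f set)"
    by (intro card_image) (auto simp: inj_on_def)
qed

text \<open>Candidates for matrix rows that vanish left of column \<open>s\<close>. As total
  functions that are 0 from \<open>n\<close> on, they can be compared by plain equality.\<close>

definition zero_off :: "nat \<Rightarrow> nat \<Rightarrow> (nat \<Rightarrow> 'f::zero) set" where
  "zero_off s n = {c. \<forall>j. j \<notin> {s..<n} \<longrightarrow> c j = 0}"

lemma card_zero_off:
  "card (zero_off s n :: (nat \<Rightarrow> 'f::{zero,finite}) set) = card (UNIV :: 'f set) ^ (n - s)"
  "finite (zero_off s n :: (nat \<Rightarrow> 'f) set)"
proof -
  have b: "bij_betw (\<lambda>c. restrict c {s..<n}) (zero_off s n :: (nat \<Rightarrow> 'f) set) ({s..<n} \<rightarrow>\<^sub>E UNIV)"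
  proof (rule bij_betw_imageI)
    show "inj_on (\<lambda>c. restrict c {s..<n}) (zero_off s n :: (nat \<Rightarrow> 'f) set)"
    proof (rule inj_onI, rule ext)
      fix c e :: "nat \<Rightarrow> 'f" and j
      assume h: "c \<in> zero_off s n" "e \<in> zero_off s n" "restrict c {s..<n} = restrict e {s..<n}"
      show "c j = e j"
      proof (cases "j \<in> {s..<n}")
        case True then show ?thesis using fun_cong[OF h(3), of j] by simp
      next
        case False then show ?thesis using h(1,2) by (simp add: zero_off_def)
      qed
    qed
    show "(\<lambda>c. restrict c {s..<n}) ` (zero_off s n :: (nat \<Rightarrow> 'f) set) = {s..<n} \<rightarrow>\<^sub>E UNIV"
    proof (intro equalityI subsetI)
      fix c :: "nat \<Rightarrow> 'f" assume c: "c \<in> {s..<n} \<rightarrow>\<^sub>E UNIV"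
      have "restrict (\<lambda>j. if j \<in> {s..<n} then c j else 0) {s..<n} = c"
        by (rule PiE_ext[OF _ c]) auto
      moreover have "(\<lambda>j. if j \<in> {s..<n} then c j else 0) \<in> zero_off s n"
        unfolding zero_off_def by simp
      ultimately show "c \<in> (\<lambda>c. restrict c {s..<n}) ` zero_off s n" by (rule image_eqI[OF sym])
    qed auto
  qed
  then show "card (zero_off s n :: (nat \<Rightarrow> 'f) set) = card (UNIV :: 'f set) ^ (n - s)"
    by (simp add: bij_betw_same_card card_PiE)
  show "finite (zero_off s n :: (nat \<Rightarrow> 'f) set)"
    using bij_betw_finite[OF b] by (simp add: finite_PiE)
qed

locale field_extension =
  fixes \<iota> :: "'f::{field,finite} \<Rightarrow> 'k::field"
  assumes hom: "field_hom \<iota>"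
begin

sublocale \<iota>: field_hom \<iota> by (rule hom)

sublocale F: finite_subfield "range \<iota>" by (rule range_finite_subfield[OF hom])

abbreviation "q \<equiv> card (range \<iota>)"

lemma card_F: "card (UNIV :: 'f set) = q" by (rule range_finite_subfield(2)[OF hom, symmetric])

lemma q_ge_2: "q \<ge> 2" by (rule F.Q_ge_2)

text \<open>The coordinate that a matrix row \<open>c\<close> produces from the vector
  \<open>xs\<close>.\<close>

definition dot :: "'k list \<Rightarrow> (nat \<Rightarrow> 'f) \<Rightarrow> 'k" where
  "dot xs c = (\<Sum>j<length xs. \<iota> (c j) * xs ! j)"

lemma dot_add: "dot xs (\<lambda>j. c j + e j) = dot xs c + dot xs e"
  by (simp add: dot_def \<iota>.hom_add distrib_right sum.distrib)

lemma dot_diff: "dot xs (\<lambda>j. c j - e j) = dot xs c - dot xs e"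
  by (simp add: dot_def \<iota>.hom_minus left_diff_distrib sum_subtractf)

lemma dot_sum: "dot xs (\<lambda>j. \<Sum>l\<in>A. a l * r l j) = (\<Sum>l\<in>A. \<iota> (a l) * dot xs (r l))"
proof -
  have "dot xs (\<lambda>j. \<Sum>l\<in>A. a l * r l j) = (\<Sum>j<length xs. \<Sum>l\<in>A. \<iota> (a l) * (\<iota> (r l j) * xs ! j))"
    by (simp add: dot_def \<iota>.hom_sum \<iota>.hom_mult sum_distrib_right mult.assoc)
  also have "\<dots> = (\<Sum>l\<in>A. \<iota> (a l) * dot xs (r l))"
    by (subst sum.swap) (simp add: dot_def sum_distrib_left)
  finally show ?thesis .
qed

text \<open>Descending induction on \<open>s\<close>: each step frees one more coefficient.\<close>

lemma lspan_drop:
  assumes "s \<le> length xs"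
  shows "F.lspan (drop s xs) = dot xs ` zero_off s (length xs)"
  using assms
proof (induct s rule: inc_induct)
  case base
  show ?case by (auto simp: zero_off_def dot_def image_iff intro!: exI[of _ "\<lambda>_. 0"])
next
  case (step s)
  have s: "s < length xs" using step by simp
  have e: "F.lspan (drop s xs) = F.adj (dot xs ` zero_off (Suc s) (length xs)) (xs ! s)"
    using Cons_nth_drop_Suc[OF s, symmetric] step(3) by simp
  show ?case
  proof (intro equalityI subsetI)
    fix y assume "y \<in> F.lspan (drop s xs)"
    then obtain c a where c: "c \<in> zero_off (Suc s) (length xs)" "y = dot xs c + \<iota> a * xs ! s"
      unfolding e F.adj_def by auto
    have "dot xs (\<lambda>j. if j = s then a else 0) = \<iota> a * xs ! s"
    proof -
      have "dot xs (\<lambda>j. if j = s then a else 0) = (\<Sum>j<length xs. if j = s then \<iota> a * xs ! j else 0)"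
        unfolding dot_def by (intro sum.cong) auto
      then show ?thesis using s by simp
    qed
    then have "y = dot xs (\<lambda>j. c j + (if j = s then a else 0))" by (simp only: c dot_add)
    moreover have "(\<lambda>j. c j + (if j = s then a else 0)) \<in> zero_off s (length xs)"
      using c(1) s by (auto simp: zero_off_def)
    ultimately show "y \<in> dot xs ` zero_off s (length xs)" by blast
  next
    fix y assume "y \<in> dot xs ` zero_off s (length xs)"
    then obtain c where c: "c \<in> zero_off s (length xs)" "y = dot xs c" by auto
    let ?c = "\<lambda>j. if j = s then 0 else c j"
    have "dot xs c = \<iota> (c s) * xs ! s + (\<Sum>j\<in>{..<length xs} - {s}. \<iota> (c j) * xs ! j)"
      unfolding dot_def using s by (intro sum.remove) auto
    moreover have "dot xs ?c = \<iota> (?c s) * xs ! s + (\<Sum>j\<in>{..<length xs} - {s}. \<iota> (?c j) * xs ! j)"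
      unfolding dot_def using s by (intro sum.remove) auto
    moreover have "(\<Sum>j\<in>{..<length xs} - {s}. \<iota> (?c j) * xs ! j) =
        (\<Sum>j\<in>{..<length xs} - {s}. \<iota> (c j) * xs ! j)" by (intro sum.cong) auto
    ultimately have "y = dot xs ?c + \<iota> (c s) * xs ! s" by (simp add: c(2))
    moreover have "?c \<in> zero_off (Suc s) (length xs)"
      using c(1) by (auto simp: zero_off_def)
    ultimately show "y \<in> F.lspan (drop s xs)" unfolding e F.adj_def
      by (intro image_eqI[where x = "(dot xs ?c, \<iota> (c s))"]) auto
  qed
qed

text \<open>The fibres of \<open>dot xs\<close> over the span are translates of the fibre over 0, so
  they all have the same size.\<close>

lemma card_fiber:
  assumes s: "s \<le> length xs" and y: "y \<in> F.lspan (drop s xs)"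
  shows "card {c \<in> zero_off s (length xs). dot xs c = y} * card (F.lspan (drop s xs)) = q ^ (length xs - s)"
proof -
  let ?Z = "zero_off s (length xs) :: (nat \<Rightarrow> 'f) set" and ?S = "F.lspan (drop s xs)"
  define fib where "fib y = {c \<in> ?Z. dot xs c = y}" for y
  have eq: "card (fib y) = card (fib 0)" if y: "y \<in> ?S" for y
  proof -
    obtain c0 where c0: "c0 \<in> ?Z" "dot xs c0 = y" using y unfolding lspan_drop[OF s] by blast
    have "bij_betw (\<lambda>c j. c j + c0 j) (fib 0) (fib y)"
      by (rule bij_betw_byWitness[where f' = "\<lambda>c j. c j - c0 j"])
        (use c0 in \<open>auto simp: fib_def dot_add dot_diff zero_off_def\<close>)
    then show ?thesis by (simp add: bij_betw_same_card)
  qed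
  have "?Z = (\<Union>y\<in>?S. fib y)" unfolding lspan_drop[OF s] fib_def by blast
  then have "card ?Z = card (\<Union>y\<in>?S. fib y)" by simp
  also have "\<dots> = (\<Sum>y\<in>?S. card (fib y))"
    by (rule card_UN_disjoint) (auto simp: F.finite_lspan fib_def card_zero_off(2))
  also have "\<dots> = card ?S * card (fib 0)" using eq by simp
  finally show ?thesis using eq[OF y] by (simp add: card_zero_off card_F fib_def mult.commute)
qed

text \<open>
  The admissible rows form a coset of a subspace; by counting, it is not contained in the span of
  the rows chosen before.
\<close>

lemma greedy_row:
  fixes r :: "nat \<Rightarrow> nat \<Rightarrow> 'f"
  assumes len: "length xs = n" "length ys = n" and s: "s \<le> i" "i < n"
    and span: "F.lspan (drop s xs) = F.lspan (drop s ys)"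
    and r: "\<And>l. i < l \<Longrightarrow> l < n \<Longrightarrow> dot xs (r l) = ys ! l"
  obtains \<rho> where "\<rho> \<in> zero_off s n" "dot xs \<rho> = ys ! i"
    "\<And>c. \<rho> \<noteq> (\<lambda>j. \<Sum>l=Suc i..<n. c l * r l j)"
proof -
  let ?A = "{\<rho> \<in> zero_off s n. dot xs \<rho> = ys ! i}"
  \<comment> \<open>If a combination of the rows below solves the equation of row \<open>i\<close>
    for \<open>xs\<close>, its coefficients solve the same equation for \<open>ys\<close>. So
    \<open>?C\<close> bounds the number of admissible rows that depend on those below.\<close>
  let ?C = "{c \<in> zero_off (Suc i) n. dot ys c = ys ! i} :: (nat \<Rightarrow> 'f) set"
  let ?R = "\<lambda>c j. \<Sum>l=Suc i..<n. c l * r l j"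
  have "ys ! i \<in> F.lspan (drop s ys)"
    using F.lspan_superset[of "drop s ys"] s len nth_mem[of "i - s" "drop s ys"] by auto
  then have A: "card ?A * card (F.lspan (drop s ys)) = q ^ (n - s)"
    using card_fiber[of s xs "ys ! i"] span len s by simp
  have dotR: "dot xs (?R c) = dot ys c" if "c \<in> zero_off (Suc i) n" for c
  proof -
    have "dot xs (?R c) = (\<Sum>l=Suc i..<n. \<iota> (c l) * ys ! l)"
      unfolding dot_sum using r by (intro sum.cong) auto
    also have "\<dots> = dot ys c" unfolding dot_def
      using that len by (intro sum.mono_neutral_left) (auto simp: zero_off_def)
    finally show ?thesis .
  qed
  have finA: "finite ?A" by (rule finite_subset[OF _ card_zero_off(2)[of s n]]) blast
  have finC: "finite ?C" by (rule finite_subset[OF _ card_zero_off(2)[of "Suc i" n]]) blast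
  have "card ?C < card ?A"
  proof (rule ccontr)
    assume "\<not> card ?C < card ?A"
    then have AC: "card ?A \<le> card ?C" by simp
    have "q ^ (n - s) > 0" using q_ge_2 by simp
    then have "card ?A > 0" using A by (metis mult_is_0 neq0_conv)
    then have "card ?C > 0" using AC by linarith
    then obtain c0 where "c0 \<in> zero_off (Suc i) n" "dot ys c0 = ys ! i" by (auto simp: card_gt_0_iff)
    then have "ys ! i \<in> dot ys ` zero_off (Suc i) n" by (metis image_eqI)
    then have mem: "ys ! i \<in> F.lspan (drop (Suc i) ys)" using lspan_drop[of "Suc i" ys] len s by simp
    have C: "card ?C * card (F.lspan (drop (Suc i) ys)) = q ^ (n - Suc i)"
      using card_fiber[OF _ mem] len s by simp
    \<comment> \<open>A solution in \<open>?C\<close> makes entry \<open>i\<close> redundant, so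
      passing from \<open>i\<close> to \<open>Suc i\<close> does not shrink the span. This gains the
      factor \<open>q\<close> that makes the two fibre counts incompatible.\<close>
    have "drop i ys = ys ! i # drop (Suc i) ys" using s len by (simp add: Cons_nth_drop_Suc)
    then have "F.lspan (drop i ys) = F.lspan (drop (Suc i) ys)"
      using mem by (simp add: F.adj_absorb F.sp_lspan)
    then have "card (F.lspan (drop s ys)) \<le> q ^ (i - s) * card (F.lspan (drop (Suc i) ys))"
      using F.lspan_drop_card[of s ys "i - s"] s by simp
    then have "card ?A * card (F.lspan (drop s ys)) \<le>
        card ?C * (q ^ (i - s) * card (F.lspan (drop (Suc i) ys)))"
      using AC by (intro mult_le_mono)
    also have "\<dots> = q ^ (i - s) * q ^ (n - Suc i)" using C by (simp add: mult_ac)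
    also have "\<dots> = q ^ (n - s - 1)" using s by (simp flip: power_add)
    also have "\<dots> < q ^ (n - s)" using q_ge_2 s by (intro power_strict_increasing) auto
    finally show False using A by simp
  qed
  moreover have "card (?R ` ?C) \<le> card ?C" using finC by (rule card_image_le)
  ultimately have "\<not> ?A \<subseteq> ?R ` ?C" using card_mono[of "?R ` ?C" ?A] finC by fastforce
  then obtain \<rho> where \<rho>: "\<rho> \<in> ?A" "\<rho> \<notin> ?R ` ?C" by blast
  have "\<rho> \<noteq> ?R c" for c
  proof
    assume e: "\<rho> = ?R c"
    \<comment> \<open>Coefficients outside the range of summation are cleared, so that
      \<open>c'\<close> can be a member of \<open>?C\<close>.\<close>
    define c' where "c' = (\<lambda>l. if l \<in> {Suc i..<n} then c l else 0)"
    have c': "c' \<in> zero_off (Suc i) n" by (auto simp: c'_def zero_off_def)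
    have e': "?R c' = \<rho>" unfolding e c'_def by (intro ext sum.cong) auto
    then have "dot ys c' = ys ! i" using dotR[OF c'] \<rho>(1) by simp
    then have "?R c' \<in> ?R ` ?C" using c' by blast
    then show False using \<rho>(2) unfolding e' by blast
  qed
  then show ?thesis using that \<rho>(1) by blast
qed

text \<open>Rows are chosen from the bottom upwards, each outside the span of those below. In the
  application \<open>\<sigma> i\<close> is the start of the block containing \<open>i\<close>, where
  the two spans are known to agree.\<close>

lemma greedy_rows:
  assumes len: "length xs = n" "length ys = n"
    and \<sigma>: "\<And>i. i < n \<Longrightarrow> \<sigma> i \<le> i \<and> F.lspan (drop (\<sigma> i) xs) = F.lspan (drop (\<sigma> i) ys)"
  obtains r :: "nat \<Rightarrow> nat \<Rightarrow> 'f" where "\<And>i. i < n \<Longrightarrow> r i \<in> zero_off (\<sigma> i) n"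
    "\<And>i. i < n \<Longrightarrow> dot xs (r i) = ys ! i"
    "\<And>i c. i < n \<Longrightarrow> r i \<noteq> (\<lambda>j. \<Sum>l=Suc i..<n. c l * r l j)"
proof -
  have "\<exists>r. \<forall>i. k \<le> i \<and> i < n \<longrightarrow> r i \<in> zero_off (\<sigma> i) n \<and> dot xs (r i) = ys ! i \<and>
      (\<forall>c. r i \<noteq> (\<lambda>j. \<Sum>l=Suc i..<n. c l * r l j))" if "k \<le> n" for k
    using that
  proof (induct k rule: inc_induct)
    case base then show ?case by auto
  next
    case (step k)
    then obtain r where r: "\<And>i. Suc k \<le> i \<Longrightarrow> i < n \<Longrightarrow> r i \<in> zero_off (\<sigma> i) n \<and> dot xs (r i) = ys ! i \<and>
      (\<forall>c. r i \<noteq> (\<lambda>j. \<Sum>l=Suc i..<n. c l * r l j))" by blast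
    have k: "k < n" using step by simp
    have sk: "\<sigma> k \<le> k" "F.lspan (drop (\<sigma> k) xs) = F.lspan (drop (\<sigma> k) ys)" using \<sigma>[OF k] by auto
    have rl: "dot xs (r l) = ys ! l" if "k < l" "l < n" for l using r[of l] that by simp
    obtain \<rho> where \<rho>: "\<rho> \<in> zero_off (\<sigma> k) n" "dot xs \<rho> = ys ! k"
      "\<And>c. \<rho> \<noteq> (\<lambda>j. \<Sum>l=Suc k..<n. c l * r l j)"
      by (rule greedy_row[OF len sk(1) k sk(2), of r, OF rl]) (assumption, assumption, metis that)
    have upd: "(\<lambda>j. \<Sum>l=Suc i..<n. c l * (r(k := \<rho>)) l j) = (\<lambda>j. \<Sum>l=Suc i..<n. c l * r l j)"
      if "k \<le> i" for i c using that by (intro ext sum.cong) auto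
    show ?case
    proof (rule exI[of _ "r(k := \<rho>)"], intro allI impI)
      fix i assume i: "k \<le> i \<and> i < n"
      show "(r(k := \<rho>)) i \<in> zero_off (\<sigma> i) n \<and> dot xs ((r(k := \<rho>)) i) = ys ! i \<and>
        (\<forall>c. (r(k := \<rho>)) i \<noteq> (\<lambda>j. \<Sum>l=Suc i..<n. c l * (r(k := \<rho>)) l j))"
      proof (cases "i = k")
        case True then show ?thesis using \<rho> upd[of k] by simp
      next
        case False then show ?thesis using r[of i] i upd[of i] by simp
      qed
    qed
  qed
  from this[of 0] obtain r where "\<forall>i. 0 \<le> i \<and> i < n \<longrightarrow> r i \<in> zero_off (\<sigma> i) n \<and> dot xs (r i) = ys ! i \<and>
      (\<forall>c. r i \<noteq> (\<lambda>j. \<Sum>l=Suc i..<n. c l * r l j))" by auto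
  then show ?thesis using that[of r] by blast
qed

text \<open>A nonzero vector in the kernel of the transpose is a relation between rows; solving it
  for the row with the first nonzero coefficient contradicts \<open>indep\<close>.\<close>

lemma invertible_mat_of_independent_rows:
  fixes r :: "nat \<Rightarrow> nat \<Rightarrow> 'f"
  assumes off: "\<And>i. i < n \<Longrightarrow> r i \<in> zero_off s n"
    and indep: "\<And>i c. i < n \<Longrightarrow> r i \<noteq> (\<lambda>j. \<Sum>l=Suc i..<n. c l * r l j)"
  shows "invertible_mat (mat n n (\<lambda>(i, j). r i j))"
proof -
  let ?g = "mat n n (\<lambda>(i, j). r i j)"
  have gc: "?g \<in> carrier_mat n n" by simp
  have "det (transpose_mat ?g) \<noteq> 0"
  proof
    assume "det (transpose_mat ?g) = 0"
    then obtain v where v: "v \<in> carrier_vec n" "v \<noteq> 0\<^sub>v n" "transpose_mat ?g *\<^sub>v v = 0\<^sub>v n"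
      using det_0_iff_vec_prod_zero_field[of "transpose_mat ?g" n] by auto
    have "\<exists>i. i < n \<and> v $ i \<noteq> 0" using v(1,2) by (auto simp: vec_eq_iff)
    then obtain i where i: "i < n" "v $ i \<noteq> 0" "\<And>l. l < i \<Longrightarrow> v $ l = 0"
      using exists_least_iff[of "\<lambda>i. i < n \<and> v $ i \<noteq> 0"] by (metis order.strict_trans)
    have z: "(\<Sum>l<n. r l j * v $ l) = 0" if j: "j < n" for j
    proof -
      have "(transpose_mat ?g *\<^sub>v v) $ j = (\<Sum>l<n. r l j * v $ l)"
        using j v(1) by (simp add: scalar_prod_def lessThan_atLeast0)
      then show ?thesis using v(3) j by simp
    qed
    have "r i = (\<lambda>j. \<Sum>l=Suc i..<n. (- v $ l / v $ i) * r l j)"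
    proof
      fix j
      show "r i j = (\<Sum>l=Suc i..<n. (- v $ l / v $ i) * r l j)"
      proof (cases "j < n")
        case True
        have "(\<Sum>l<n. r l j * v $ l) = (\<Sum>l<i. r l j * v $ l) + (r i j * v $ i + (\<Sum>l=Suc i..<n. r l j * v $ l))"
          using sum.atLeastLessThan_concat[of 0 i n "\<lambda>l. r l j * v $ l"] i(1)
            sum.atLeast_Suc_lessThan[of i n "\<lambda>l. r l j * v $ l"]
          by (simp add: lessThan_atLeast0)
        then have e: "r i j * v $ i = - (\<Sum>l=Suc i..<n. r l j * v $ l)"
          using z[OF True] i(3) by (simp add: eq_neg_iff_add_eq_0)
        have "r i j = - (\<Sum>l=Suc i..<n. r l j * v $ l) / v $ i" using i(2) by (simp flip: e)
        also have "\<dots> = (\<Sum>l=Suc i..<n. (- v $ l / v $ i) * r l j)"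
          by (simp add: sum_divide_distrib sum_negf[symmetric] mult.commute)
        finally show ?thesis .
      next
        case False
        then have "r l j = 0" if "l < n" for l using off[OF that] by (simp add: zero_off_def)
        then show ?thesis using i(1) by simp
      qed
    qed
    then show False using indep[OF i(1), of "\<lambda>l. - v $ l / v $ i"] by blast
  qed
  then have "det ?g \<noteq> 0" using det_transpose[OF gc] by simp
  from det_non_zero_imp_unit[OF gc this] obtain h where "h \<in> carrier_mat n n" "h * ?g = 1\<^sub>m n" "?g * h = 1\<^sub>m n"
    by (auto simp: Units_def ring_mat_def)
  then show ?thesis by (auto simp: invertible_mat_def inverts_mat_def intro!: exI[of _ h])
qed

lemma map_mat_mult_vec:
  assumes "g \<in> carrier_mat n n" "v \<in> carrier_vec n" "i < n"
  shows "(map_mat \<iota> g *\<^sub>v v) $ i = (\<Sum>j<n. \<iota> (g $$ (i, j)) * v $ j)"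
  using assms by (simp add: scalar_prod_def lessThan_atLeast0)

lemma map_mat_inj:
  assumes g: "g \<in> carrier_mat n n" "invertible_mat g" and v: "v \<in> carrier_vec n" "w \<in> carrier_vec n"
    and e: "map_mat \<iota> g *\<^sub>v v = map_mat \<iota> g *\<^sub>v w"
  shows "v = w"
proof -
  obtain h where h: "h \<in> carrier_mat n n" "h * g = 1\<^sub>m n" using invertible_matE[OF g] by metis
  have "map_mat \<iota> h *\<^sub>v (map_mat \<iota> g *\<^sub>v u) = u" if "u \<in> carrier_vec n" for u
  proof -
    have "map_mat \<iota> h *\<^sub>v (map_mat \<iota> g *\<^sub>v u) = (map_mat \<iota> h * map_mat \<iota> g) *\<^sub>v u"
      using h g that by (intro assoc_mult_mat_vec[symmetric, of _ n n _ n]) auto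
    also have "map_mat \<iota> h * map_mat \<iota> g = 1\<^sub>m n"
      using h g by (simp flip: \<iota>.mat_hom_mult add: \<iota>.mat_hom_one)
    finally show ?thesis using that by simp
  qed
  then show ?thesis using v e by metis
qed

definition vecs :: "nat \<Rightarrow> 'k set \<Rightarrow> 'k vec set" where
  "vecs n E = {v \<in> carrier_vec n. \<forall>i<n. v $ i \<in> E}"

lemma finite_vecs: "finite E \<Longrightarrow> finite (vecs n E)"
proof -
  assume E: "finite E"
  have "list_of_vec ` vecs n E \<subseteq> {xs. set xs \<subseteq> E \<and> length xs = n}"
    by (auto simp: vecs_def set_conv_nth list_of_vec_index)
  then have "finite (list_of_vec ` vecs n E)"
    using finite_lists_length_eq[OF E] finite_subset by blast
  moreover have "inj_on list_of_vec (vecs n E)" by (metis inj_onI vec_list)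
  ultimately show ?thesis by (rule finite_imageD)
qed

lemma map_mat_vecs:
  assumes E: "finite_subfield E" "range \<iota> \<subseteq> E" and g: "g \<in> carrier_mat n n" and v: "v \<in> vecs n E"
  shows "map_mat \<iota> g *\<^sub>v v \<in> vecs n E"
proof -
  interpret E: finite_subfield E by fact
  have sum: "(\<Sum>j\<in>A. h j) \<in> E" if "\<And>j. j \<in> A \<Longrightarrow> h j \<in> E" for A :: "nat set" and h
    using that by (induct A rule: infinite_finite_induct) (auto intro: E.K0 E.K_add)
  have "v \<in> carrier_vec n" using v by (simp add: vecs_def)
  then show ?thesis using v g E(2) unfolding vecs_def
    by (auto simp: map_mat_mult_vec[OF g] simp del: index_mult_mat_vec intro!: sum E.K_mult)
qed

text \<open>The vectors whose entries from \<open>s\<close> on lie in a subspace \<open>U\<close>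
  are mapped injectively to vectors of the same kind, and by finiteness onto them. Applied to the
  span before and to the span after, this gives both inclusions.\<close>

lemma lspan_drop_map_mat:
  assumes E: "finite_subfield E" "range \<iota> \<subseteq> E" and g: "g \<in> carrier_mat n n" "invertible_mat g"
    and zero: "\<And>i j. i < n \<Longrightarrow> j < n \<Longrightarrow> j < s \<Longrightarrow> s \<le> i \<Longrightarrow> g $$ (i, j) = 0"
    and v: "v \<in> vecs n E"
  shows "F.lspan (drop s (list_of_vec (map_mat \<iota> g *\<^sub>v v))) = F.lspan (drop s (list_of_vec v))"
proof -
  interpret E: finite_subfield E by fact
  let ?T = "\<lambda>v. map_mat \<iota> g *\<^sub>v v"
  define N where "N U = {v \<in> vecs n E. \<forall>i. s \<le> i \<and> i < n \<longrightarrow> v $ i \<in> U}" for U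
  have NT: "?T ` N U = N U" if U: "F.sp U" for U
  proof (rule endo_inj_surj)
    show "finite (N U)" using finite_vecs[OF E.finite_K] by (simp add: N_def)
    show "?T ` N U \<subseteq> N U"
    proof (intro image_subsetI)
      fix u assume u: "u \<in> N U"
      then have uc: "u \<in> carrier_vec n" "u \<in> vecs n E" by (auto simp: N_def vecs_def)
      have "?T u $ i \<in> U" if i: "s \<le> i" "i < n" for i
        unfolding map_mat_mult_vec[OF g(1) uc(1) i(2)]
      proof (rule F.sp_sum[OF U])
        fix j assume j: "j \<in> {..<n}"
        show "\<iota> (g $$ (i, j)) * u $ j \<in> U"
        proof (cases "j < s")
          case True then show ?thesis using zero[of i j] i j F.spD(1)[OF U] by simp
        next
          case False then show ?thesis using u j by (intro F.spD(3)[OF U]) (auto simp: N_def)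
        qed
      qed
      then show "?T u \<in> N U" using map_mat_vecs[OF E g(1) uc(2)] by (simp add: N_def)
    qed
    show "inj_on ?T (N U)" using map_mat_inj[OF g] by (auto simp: inj_on_def N_def vecs_def)
  qed
  have mem: "u \<in> N U \<longleftrightarrow> F.lspan (drop s (list_of_vec u)) \<subseteq> U" if U: "F.sp U" and u: "u \<in> vecs n E" for u U
  proof -
    have uc: "dim_vec u = n" using u by (auto simp: vecs_def)
    have "set (drop s (list_of_vec u)) \<subseteq> U \<longleftrightarrow> u \<in> N U"
    proof
      assume a: "set (drop s (list_of_vec u)) \<subseteq> U"
      have "u $ i \<in> U" if "s \<le> i" "i < n" for i
        using nth_mem[of "i - s" "drop s (list_of_vec u)"] that uc a by (auto simp: list_of_vec_index)
      then show "u \<in> N U" using u by (simp add: N_def)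
    next
      assume "u \<in> N U"
      then show "set (drop s (list_of_vec u)) \<subseteq> U"
        using uc by (auto simp: in_set_conv_nth N_def list_of_vec_index)
    qed
    then show ?thesis using F.lspan_least[OF U] F.lspan_superset by blast
  qed
  let ?U = "F.lspan (drop s (list_of_vec v))" and ?U' = "F.lspan (drop s (list_of_vec (?T v)))"
  have Tv: "?T v \<in> vecs n E" by (rule map_mat_vecs[OF E g(1) v])
  have "v \<in> N ?U" using mem[OF F.sp_lspan v] by blast
  then have "?T v \<in> N ?U" using NT[OF F.sp_lspan] by blast
  then have 1: "?U' \<subseteq> ?U" using mem[OF F.sp_lspan Tv] by blast
  have "?T v \<in> N ?U'" using mem[OF F.sp_lspan Tv] by blast
  then obtain u where u: "u \<in> N ?U'" "?T u = ?T v" using NT[OF F.sp_lspan, of "drop s (list_of_vec (?T v))"] by (metis imageE)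
  have "u = v" using map_mat_inj[OF g, of u v] u v by (auto simp: N_def vecs_def)
  then have "?U \<subseteq> ?U'" using u(1) mem[OF F.sp_lspan v] by blast
  then show ?thesis using 1 by blast
qed

text \<open>One direction is the invariance of the spans. For the other, equal flags feed
  \<open>greedy_rows\<close>; the support of the rows gives the block shape and their independence
  the invertibility.\<close>

lemma orbit_iff_flag:
  assumes E: "finite_subfield E" "range \<iota> \<subseteq> E" and v: "v \<in> vecs (sum_list \<alpha>) E" "w \<in> vecs (sum_list \<alpha>) E"
  shows "(\<exists>g\<in>parabolic \<alpha>. map_mat \<iota> g *\<^sub>v v = w) \<longleftrightarrow> F.flag \<alpha> (list_of_vec v) = F.flag \<alpha> (list_of_vec w)"
proof
  let ?n = "sum_list \<alpha>"
  assume "\<exists>g\<in>parabolic \<alpha>. map_mat \<iota> g *\<^sub>v v = w"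
  then obtain g where g: "g \<in> carrier_mat ?n ?n" "invertible_mat g" and w: "map_mat \<iota> g *\<^sub>v v = w"
    and z: "\<And>b i j. b < length \<alpha> \<Longrightarrow> i < ?n \<Longrightarrow> j < ?n \<Longrightarrow> j < partial_sum \<alpha> b \<Longrightarrow> partial_sum \<alpha> b \<le> i \<Longrightarrow>
      g $$ (i, j) = 0" by (auto simp: parabolic_def)
  have "F.lspan (drop (partial_sum \<alpha> b) (list_of_vec w)) = F.lspan (drop (partial_sum \<alpha> b) (list_of_vec v))"
    if "b < length \<alpha>" for b
    using lspan_drop_map_mat[OF E g z[OF that] v(1)] by (simp add: w)
  then show "F.flag \<alpha> (list_of_vec v) = F.flag \<alpha> (list_of_vec w)" by (simp add: F.flag_index)
next
  let ?n = "sum_list \<alpha>" and ?xs = "list_of_vec v" and ?ys = "list_of_vec w"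
  assume fl: "F.flag \<alpha> ?xs = F.flag \<alpha> ?ys"
  have vc: "v \<in> carrier_vec ?n" "w \<in> carrier_vec ?n" using v by (auto simp: vecs_def)
  have span: "F.lspan (drop (partial_sum \<alpha> b) ?xs) = F.lspan (drop (partial_sum \<alpha> b) ?ys)"
    if "b < length \<alpha>" for b using fl that by (simp add: F.flag_index)
  let ?B = "\<lambda>i. {partial_sum \<alpha> b | b. b < length \<alpha> \<and> partial_sum \<alpha> b \<le> i}"
  \<comment> \<open>The last block boundary not beyond row \<open>i\<close>, hence the start of its
    block.\<close>
  define \<sigma> where "\<sigma> i = Max (?B i)" for i
  have finB: "finite (?B i)" for i by simp
  have \<sigma>: "\<sigma> i \<in> ?B i" if "i < ?n" for i
  proof -
    have "\<alpha> \<noteq> []" using that by auto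
    then have "partial_sum \<alpha> 0 \<in> ?B i" by (auto simp: partial_sum_def intro!: exI[of _ 0])
    then show ?thesis unfolding \<sigma>_def using finB by (intro Max_in) auto
  qed
  have len: "length ?xs = ?n" "length ?ys = ?n" using vc by auto
  have "\<sigma> i \<le> i \<and> F.lspan (drop (\<sigma> i) ?xs) = F.lspan (drop (\<sigma> i) ?ys)" if "i < ?n" for i
    using \<sigma>[OF that] span by auto
  from greedy_rows[OF len this] obtain r where r: "\<And>i. i < ?n \<Longrightarrow> r i \<in> zero_off (\<sigma> i) ?n"
    "\<And>i. i < ?n \<Longrightarrow> dot ?xs (r i) = ?ys ! i"
    "\<And>i c. i < ?n \<Longrightarrow> r i \<noteq> (\<lambda>j. \<Sum>l=Suc i..<?n. c l * r l j)" by blast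
  let ?g = "mat ?n ?n (\<lambda>(i, j). r i j)"
  have "r i \<in> zero_off 0 ?n" if "i < ?n" for i using r(1)[OF that] by (auto simp: zero_off_def)
  then have inv: "invertible_mat ?g" using r(3) by (rule invertible_mat_of_independent_rows)
  have "?g \<in> parabolic \<alpha>"
    unfolding parabolic_def
  proof (intro CollectI conjI allI impI)
    fix b i j assume b: "b < length \<alpha>" "i < ?n" "j < ?n" "j < partial_sum \<alpha> b \<and> partial_sum \<alpha> b \<le> i"
    then have "partial_sum \<alpha> b \<le> \<sigma> i" unfolding \<sigma>_def by (intro Max_ge finB) auto
    then have "r i j = 0" using r(1)[OF b(2)] b(4) by (auto simp: zero_off_def)
    then show "?g $$ (i, j) = 0" using b by simp
  qed (use inv in auto)
  moreover have "map_mat \<iota> ?g *\<^sub>v v = w"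
  proof (rule eq_vecI)
    fix i assume i: "i < dim_vec w"
    then have i': "i < ?n" using vc by simp
    have "(map_mat \<iota> ?g *\<^sub>v v) $ i = (\<Sum>j<?n. \<iota> (?g $$ (i, j)) * v $ j)"
      by (rule map_mat_mult_vec[OF _ vc(1) i']) simp
    also have "\<dots> = dot ?xs (r i)"
      using i' vc by (simp add: dot_def list_of_vec_index)
    also have "\<dots> = w $ i" using r(2)[OF i'] i by (simp add: list_of_vec_index)
    finally show "(map_mat \<iota> ?g *\<^sub>v v) $ i = w $ i" .
  qed (use vc in simp)
  ultimately show "\<exists>g\<in>parabolic \<alpha>. map_mat \<iota> g *\<^sub>v v = w" by blast
qed

end

section \<open>Permutation modules of cyclic groups\<close>

text \<open>Cycles are split off one at a time; \<open>L z\<close> is the length of the cycle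
  through the representative \<open>z\<close>.\<close>

lemma cyclic_decomposition:
  assumes "finite Y" "\<And>y. y \<in> Y \<Longrightarrow> T y \<in> Y" "\<And>y. y \<in> Y \<Longrightarrow> (T ^^ N) y = y" "N > 0"
  shows "\<exists>R L. R \<subseteq> Y \<and> (\<forall>z\<in>R. L z > 0 \<and> (\<forall>i. (T ^^ i) z = z \<longleftrightarrow> L z dvd i)) \<and>
    bij_betw (\<lambda>(z, a). (T ^^ a) z) (SIGMA z:R. {..<L z :: nat}) Y"
  using assms
proof (induct "card Y" arbitrary: Y rule: less_induct)
  case less
  show ?case
  proof (cases "Y = {}")
    case True then show ?thesis by (intro exI[of _ "{}"]) (auto simp: bij_betw_def)
  next
    case False
    then obtain z where z: "z \<in> Y" by blast
    define l where "l = (LEAST i. i > 0 \<and> (T ^^ i) z = z)"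
    have l: "l > 0" "(T ^^ l) z = z"
      using LeastI[of "\<lambda>i. i > 0 \<and> (T ^^ i) z = z", OF conjI[OF less.prems(4) less.prems(3)[OF z]]]
      unfolding l_def by blast+
    have lmin: "(T ^^ i) z \<noteq> z" if "0 < i" "i < l" for i
      using not_less_Least[of i "\<lambda>i. i > 0 \<and> (T ^^ i) z = z"] that by (auto simp: l_def)
    have mult: "(T ^^ (l * k)) z = z" for k
      by (induct k) (simp_all add: funpow_add l(2))
    have md: "(T ^^ i) z = (T ^^ (i mod l)) z" for i
    proof -
      have "(T ^^ i) z = (T ^^ (i mod l + l * (i div l))) z" by simp
      then show ?thesis by (simp only: funpow_add comp_def mult)
    qed
    have dvd: "(T ^^ i) z = z \<longleftrightarrow> l dvd i" for i
    proof
      assume "(T ^^ i) z = z"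
      then have "(T ^^ (i mod l)) z = z" using md by simp
      then have "i mod l = 0" using lmin[of "i mod l"] l(1) by (cases "i mod l = 0") auto
      then show "l dvd i" by auto
    qed (auto simp: mult)
    have TY: "(T ^^ i) y \<in> Y" if "y \<in> Y" for i y using that less.prems(2) by (induct i) auto
    define Ob where "Ob = (\<lambda>a. (T ^^ a) z) ` {..<l}"
    have ObI: "(T ^^ i) z \<in> Ob" for i unfolding Ob_def md[of i] using l(1) by auto
    have ObT: "T y \<in> Ob" if yO: "y \<in> Ob" for y
    proof -
      obtain a where "y = (T ^^ a) z" using yO by (auto simp: Ob_def)
      then have "T y = (T ^^ Suc a) z" by simp
      then show ?thesis using ObI by metis
    qed
    have ObTi: "(T ^^ i) y \<in> Ob" if "y \<in> Ob" for i y using that ObT by (induct i) auto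
    have ObY: "Ob \<subseteq> Y" using TY[OF z] by (auto simp: Ob_def)
    have "card (Y - Ob) < card Y" using ObI[of 0] z less.prems(1) by (intro psubset_card_mono) auto
    moreover have "T y \<in> Y - Ob" if y: "y \<in> Y - Ob" for y
    proof -
      \<comment> \<open>On \<open>Y\<close> the map \<open>T\<close> has the inverse
        \<open>T ^^ (N - 1)\<close>, so a point that enters the cycle was already on it.\<close>
      have "T y \<notin> Ob"
      proof
        assume "T y \<in> Ob"
        then have "(T ^^ (N - 1)) (T y) \<in> Ob" by (rule ObTi)
        moreover have "(T ^^ (N - 1)) (T y) = (T ^^ N) y" using less.prems(4)
          by (metis Suc_diff_1 comp_apply funpow_Suc_right)
        ultimately show False using y less.prems(3)[of y] by simp
      qed
      then show ?thesis using y less.prems(2) by blast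
    qed
    ultimately obtain R L where RL: "R \<subseteq> Y - Ob"
      "\<forall>z\<in>R. L z > 0 \<and> (\<forall>i. (T ^^ i) z = z \<longleftrightarrow> L z dvd i)"
      "bij_betw (\<lambda>(z, a). (T ^^ a) z) (SIGMA z:R. {..<L z :: nat}) (Y - Ob)"
      using less.hyps[of "Y - Ob"] less.prems by auto
    have zR: "z \<notin> R" using RL(1) ObI[of 0] by auto
    define L' where "L' = L(z := l)"
    have inj: "inj_on (\<lambda>a. (T ^^ a) z) {..<l}"
    proof (rule linorder_inj_onI)
      fix a b assume ab: "a < b" "a \<in> {..<l}" "b \<in> {..<l}"
      show "(T ^^ a) z \<noteq> (T ^^ b) z"
      proof
        assume e: "(T ^^ a) z = (T ^^ b) z"
        have "z = (T ^^ (l - b)) ((T ^^ b) z)" using ab l(2) by (simp flip: funpow_add comp_apply[of "T ^^ _"])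
        also have "\<dots> = (T ^^ (l - b + a)) z" by (simp add: e[symmetric] funpow_add)
        finally have "(T ^^ (l - b + a)) z = z" by (rule sym)
        then have "l dvd l - b + a" by (simp only: dvd)
        then have "l \<le> l - b + a" using ab by (intro dvd_imp_le) auto
        then show False using ab by auto
      qed
    qed auto
    have b1: "bij_betw (\<lambda>(z, a). (T ^^ a) z) ({z} \<times> {..<l}) Ob"
      using inj by (auto simp: bij_betw_def inj_on_def Ob_def image_iff)
    have "bij_betw (\<lambda>(z, a). (T ^^ a) z) (({z} \<times> {..<l}) \<union> (SIGMA z:R. {..<L z})) (Ob \<union> (Y - Ob))"
      by (rule bij_betw_combine[OF b1 RL(3)]) auto
    moreover have "({z} \<times> {..<l}) \<union> (SIGMA z:R. {..<L z}) = (SIGMA z:insert z R. {..<L' z})"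
      using zR by (auto simp: L'_def split: if_splits)
    moreover have "Ob \<union> (Y - Ob) = Y" using ObY by auto
    ultimately have "bij_betw (\<lambda>(z, a). (T ^^ a) z) (SIGMA z:insert z R. {..<L' z}) Y" by simp
    moreover have "\<forall>y\<in>insert z R. L' y > 0 \<and> (\<forall>i. (T ^^ i) y = y \<longleftrightarrow> L' y dvd i)"
      using RL(2) l(1) dvd zR by (auto simp: L'_def)
    moreover have "insert z R \<subseteq> Y" using z RL(1) by auto
    ultimately show ?thesis by blast
  qed
qed

text \<open>A geometric series whose ratio is 1 exactly for the multiples of
  \<open>N\<close>.\<close>

lemma primitive_root_sum:
  fixes z :: "'a::field"
  assumes z: "\<And>i. z ^ i = 1 \<longleftrightarrow> N dvd i"
  shows "(\<Sum>i<N. z ^ (k * i)) = (if N dvd k then of_nat N else 0)"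
proof (cases "N dvd k")
  case True
  then have "z ^ (k * i) = 1" for i using z by auto
  then show ?thesis using True by simp
next
  case False
  have "1 - (z ^ k) ^ N = (1 - z ^ k) * (\<Sum>i<N. (z ^ k) ^ i)" by (rule one_diff_power_eq)
  moreover have "(z ^ k) ^ N = 1" using z by (simp flip: power_mult)
  moreover have "z ^ k \<noteq> 1" using z False by simp
  ultimately show ?thesis using False by (simp add: power_mult)
qed

locale cyclic_action =
  fixes T :: "'y \<Rightarrow> 'y" and Y :: "'y set" and N :: nat and R :: "'y set" and L :: "'y \<Rightarrow> nat"
  assumes finY: "finite Y" and TY: "\<And>y. y \<in> Y \<Longrightarrow> T y \<in> Y" and N0: "N > 0"
    and TN: "\<And>y. y \<in> Y \<Longrightarrow> (T ^^ N) y = y"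
    and RY: "R \<subseteq> Y" and Lpos: "\<And>z. z \<in> R \<Longrightarrow> L z > 0"
    and Ldvd: "\<And>z i. z \<in> R \<Longrightarrow> (T ^^ i) z = z \<longleftrightarrow> L z dvd i"
    and bij: "bij_betw (\<lambda>(z, a). (T ^^ a) z) (SIGMA z:R. {..<L z}) Y"
begin

lemma TiY: "y \<in> Y \<Longrightarrow> (T ^^ i) y \<in> Y"
  using TY by (induct i) auto

lemma finR: "finite R"
  using finY RY finite_subset by blast

lemma LN: "z \<in> R \<Longrightarrow> L z dvd N"
  using Ldvd TN RY by blast

lemma Tmod: "z \<in> R \<Longrightarrow> (T ^^ (i mod L z)) z = (T ^^ i) z"
proof -
  assume z: "z \<in> R"
  have "(T ^^ i) z = (T ^^ (i mod L z + L z * (i div L z))) z" by simp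
  then show ?thesis using Ldvd[OF z, of "L z * (i div L z)"] by (simp only: funpow_add comp_def) simp
qed

text \<open>A cycle of length \<open>L z\<close> carries the characters of exponent \<open>r\<close>
  that are trivial on the stabiliser of \<open>z\<close>; divisibility of \<open>r * L z\<close> by
  \<open>N\<close> expresses this.\<close>

definition J :: "('y \<times> nat) set" where
  "J = (SIGMA z:R. {r. r < N \<and> N dvd r * L z})"

lemma finite_J: "finite J"
  unfolding J_def using finR by (intro finite_SigmaI) auto

text \<open>The Fourier coefficient of \<open>F\<close> along the orbit of \<open>z\<close>. Summing
  over the whole cyclic group instead of one turn of the orbit gives one formula for orbits of all
  lengths.\<close>

definition co :: "'k::field \<Rightarrow> ('y \<Rightarrow> 'k) \<Rightarrow> 'y \<times> nat \<Rightarrow> 'k" where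
  "co x F = (\<lambda>(z, r). \<Sum>i<N. x ^ (r * i) * F ((T ^^ i) z))"

lemma sum_shift:
  assumes "h N = h 0" shows "(\<Sum>i<N. h (Suc i)) = (\<Sum>i<N. h i :: 'a::ab_group_add)"
  using sum.lessThan_Suc_shift[of h N] assms by simp

text \<open>Shifting the summation index by one moves \<open>T\<close> into the argument at the cost
  of the factor \<open>x ^ r\<close>.\<close>

lemma co_shift:
  fixes x :: "'k::field"
  assumes x: "\<And>i. x ^ i = 1 \<longleftrightarrow> N dvd i" and z: "z \<in> Y"
    and F: "\<And>y. y \<in> Y \<Longrightarrow> G (T y) = F y"
  shows "co x G (z, r) = x ^ r * co x F (z, r)"
proof -
  have "co x G (z, r) = (\<Sum>i<N. x ^ (r * i) * G ((T ^^ i) z))" by (simp add: co_def)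
  also have "\<dots> = (\<Sum>i<N. x ^ (r * Suc i) * G ((T ^^ Suc i) z))"
  proof (rule sum_shift[symmetric])
    have "x ^ (r * N) = 1" using x by simp
    then show "x ^ (r * N) * G ((T ^^ N) z) = x ^ (r * 0) * G ((T ^^ 0) z)" using TN z by simp
  qed
  also have "\<dots> = (\<Sum>i<N. x ^ r * (x ^ (r * i) * F ((T ^^ i) z)))"
    using F TiY[OF z] by (intro sum.cong) (auto simp: power_add mult_ac)
  finally show ?thesis by (simp add: co_def sum_distrib_left)
qed

text \<open>A full turn of the orbit multiplies the coefficient by \<open>x ^ (r * L z)\<close>,
  which differs from 1 here.\<close>

lemma co_outside:
  fixes x :: "'k::field"
  assumes x: "\<And>i. x ^ i = 1 \<longleftrightarrow> N dvd i" and z: "z \<in> R" and r: "\<not> N dvd r * L z"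
  shows "co x F (z, r) = 0"
proof -
  have zY: "z \<in> Y" using z RY by auto
  have "co x F (z, r) = x ^ (r * k) * (\<Sum>i<N. x ^ (r * i) * F ((T ^^ (i + k)) z))" for k
  proof (induct k)
    case (Suc k)
    have "(\<Sum>i<N. x ^ (r * i) * F ((T ^^ (i + k)) z)) = (\<Sum>i<N. x ^ (r * Suc i) * F ((T ^^ (Suc i + k)) z))"
    proof (rule sum_shift[symmetric])
      have "x ^ (r * N) = 1" using x by simp
      moreover have "(T ^^ (N + k)) z = (T ^^ k) z"
        using TN[OF TiY[OF zY, of k]] by (simp add: funpow_add)
      ultimately show "x ^ (r * N) * F ((T ^^ (N + k)) z) = x ^ (r * 0) * F ((T ^^ (0 + k)) z)" by simp
    qed
    also have "\<dots> = x ^ r * (\<Sum>i<N. x ^ (r * i) * F ((T ^^ (i + Suc k)) z))"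
      by (simp add: power_add sum_distrib_left mult_ac)
    finally show ?case using Suc by (simp add: power_add mult_ac)
  qed (simp add: co_def)
  from this[of "L z"] have "co x F (z, r) = x ^ (r * L z) * (\<Sum>i<N. x ^ (r * i) * F ((T ^^ (i + L z)) z))" .
  also have "(\<Sum>i<N. x ^ (r * i) * F ((T ^^ (i + L z)) z)) = co x F (z, r)"
    using Ldvd[OF z, of "L z"] by (simp add: co_def funpow_add)
  finally have "(1 - x ^ (r * L z)) * co x F (z, r) = 0" by (simp add: algebra_simps)
  then show ?thesis using x r by simp
qed

text \<open>Fourier inversion, where the natural number \<open>N - a\<close> plays the part of the
  exponent \<open>-a\<close>.\<close>

lemma co_inverse:
  fixes x :: "'k::field"
  assumes x: "\<And>i. x ^ i = 1 \<longleftrightarrow> N dvd i" and a: "a < N" and z: "z \<in> R"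
  shows "(\<Sum>r<N. x ^ (r * (N - a)) * co x F (z, r)) = of_nat N * F ((T ^^ a) z)"
proof -
  have "(\<Sum>r<N. x ^ (r * (N - a)) * co x F (z, r)) =
      (\<Sum>r<N. \<Sum>i<N. x ^ ((N - a + i) * r) * F ((T ^^ i) z))"
    by (simp add: co_def sum_distrib_left power_add[symmetric] algebra_simps)
  also have "\<dots> = (\<Sum>i<N. (\<Sum>r<N. x ^ ((N - a + i) * r)) * F ((T ^^ i) z))"
    by (subst sum.swap) (simp add: sum_distrib_right)
  also have "\<dots> = (\<Sum>i<N. if i = a then of_nat N * F ((T ^^ i) z) else 0)"
  proof (intro sum.cong refl)
    fix i assume i: "i \<in> {..<N}"
    have "N dvd N - a + i \<longleftrightarrow> i = a"
    proof
      assume "N dvd N - a + i"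
      then obtain k where k: "N - a + i = N * k" by auto
      have "0 < N - a + i" "N - a + i < N * 2" using i a by auto
      then have "0 < k" "k < 2" unfolding k by auto
      then have "k = 1" by simp
      then show "i = a" using k a by auto
    qed (use a in auto)
    then show "(\<Sum>r<N. x ^ ((N - a + i) * r)) * F ((T ^^ i) z) =
      (if i = a then of_nat N * F ((T ^^ i) z) else 0)"
      using primitive_root_sum[of x N "N - a + i", OF x] by simp
  qed
  finally show ?thesis using a by simp
qed

lemma Y_cases:
  assumes "y \<in> Y" obtains z a where "z \<in> R" "a < L z" "y = (T ^^ a) z"
  using assms bij unfolding bij_betw_def by (auto simp: image_iff)

lemma T_unique:
  assumes "z \<in> R" "z' \<in> R" "(T ^^ a) z = (T ^^ b) z'"
  shows "z = z' \<and> a mod L z = b mod L z"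
proof -
  have "(T ^^ (a mod L z)) z = (T ^^ (b mod L z')) z'" using assms Tmod by simp
  moreover have "inj_on (\<lambda>(z, a). (T ^^ a) z) (SIGMA z:R. {..<L z})" using bij by (simp add: bij_betw_def)
  ultimately have "(z, a mod L z) = (z', b mod L z')"
    using assms(1,2) Lpos by (intro inj_onD[of "\<lambda>(z, a). (T ^^ a) z" "SIGMA z:R. {..<L z}"]) auto
  then show ?thesis by auto
qed

lemma L_le: "z \<in> R \<Longrightarrow> L z \<le> N"
  using LN N0 dvd_imp_le by blast

lemma co_bij:
  fixes x :: "'k::field"
  assumes x: "\<And>i. x ^ i = 1 \<longleftrightarrow> N dvd i" and N: "of_nat N \<noteq> (0::'k)"
  shows "bij_betw (\<lambda>F. restrict (co x F) J) (Y \<rightarrow>\<^sub>E UNIV) (J \<rightarrow>\<^sub>E UNIV)"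
proof (rule bij_betw_imageI)
  show "inj_on (\<lambda>F. restrict (co x F) J) (Y \<rightarrow>\<^sub>E UNIV)"
  proof (rule inj_onI)
    fix F G :: "'y \<Rightarrow> 'k"
    assume FG: "F \<in> Y \<rightarrow>\<^sub>E UNIV" "G \<in> Y \<rightarrow>\<^sub>E UNIV" "restrict (co x F) J = restrict (co x G) J"
    have co: "co x F (z, r) = co x G (z, r)" if "z \<in> R" "r < N" for z r
    proof (cases "N dvd r * L z")
      case True
      then have "(z, r) \<in> J" using that by (simp add: J_def)
      then show ?thesis using fun_cong[OF FG(3), of "(z, r)"] by simp
    next
      case False then show ?thesis using co_outside[OF x that(1) False] by simp
    qed
    show "F = G"
    proof (rule PiE_ext[OF FG(1,2)])
      fix y assume "y \<in> Y"
      then obtain z a where za: "z \<in> R" "a < L z" "y = (T ^^ a) z" by (rule Y_cases)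
      have a: "a < N" using za L_le[of z] by simp
      have "of_nat N * F y = (\<Sum>r<N. x ^ (r * (N - a)) * co x F (z, r))"
        by (simp only: co_inverse[OF x a za(1)] za(3))
      also have "\<dots> = (\<Sum>r<N. x ^ (r * (N - a)) * co x G (z, r))"
        using co[OF za(1)] by (intro sum.cong) auto
      also have "\<dots> = of_nat N * G y" by (simp only: co_inverse[OF x a za(1)] za(3))
      finally have "of_nat N * F y = of_nat N * G y" .
      then show "F y = G y" using N by (metis mult_left_cancel)
    qed
  qed
  show "(\<lambda>F. restrict (co x F) J) ` (Y \<rightarrow>\<^sub>E UNIV) = J \<rightarrow>\<^sub>E UNIV"
  proof (intro equalityI subsetI)
    fix c :: "'y \<times> nat \<Rightarrow> 'k" assume c: "c \<in> J \<rightarrow>\<^sub>E UNIV"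
    define D where "D z = {r. r < N \<and> N dvd r * L z}" for z
    \<comment> \<open>The inverse transform, with \<open>N - 1\<close> in place of the exponent
      -1.\<close>
    define f where "f z a = inverse (of_nat N) * (\<Sum>r\<in>D z. x ^ (r * (N - 1) * a) * c (z, r))" for z a
    define F where "F = (\<lambda>y\<in>Y. case inv_into (SIGMA z:R. {..<L z}) (\<lambda>(z, a). (T ^^ a) z) y of (z, a) \<Rightarrow> f z a)"
    \<comment> \<open>For exponents in \<open>D z\<close> a full turn changes nothing, so the
      formula is well defined on the orbit.\<close>
    have fmod: "f z (a mod L z) = f z a" if z: "z \<in> R" for z a
    proof -
      have "x ^ (r * (N - 1) * (a mod L z)) = x ^ (r * (N - 1) * a)" if r: "r \<in> D z" for r
      proof -
        have "N dvd r * (N - 1) * (L z * (a div L z))"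
          using r by (auto simp: D_def intro: dvd_trans[of N "r * L z"] simp: mult_ac)
        then have "x ^ (r * (N - 1) * (L z * (a div L z))) = 1" using x by blast
        moreover have "r * (N - 1) * a = r * (N - 1) * (a mod L z) + r * (N - 1) * (L z * (a div L z))"
          by (metis distrib_left mod_mult_div_eq)
        ultimately show ?thesis by (metis mult_1_right power_add)
      qed
      then show ?thesis unfolding f_def by simp
    qed
    have FT: "F ((T ^^ i) z) = f z i" if z: "z \<in> R" for z i
    proof -
      have "inv_into (SIGMA z:R. {..<L z}) (\<lambda>(z, a). (T ^^ a) z) ((\<lambda>(z, a). (T ^^ a) z) (z, i mod L z)) = (z, i mod L z)"
        using bij z Lpos by (intro inv_into_f_f) (auto simp: bij_betw_def)
      then have "inv_into (SIGMA z:R. {..<L z}) (\<lambda>(z, a). (T ^^ a) z) ((T ^^ i) z) = (z, i mod L z)"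
        using Tmod[OF z] by simp
      moreover have "(T ^^ i) z \<in> Y" using TiY z RY by blast
      ultimately show ?thesis by (simp add: F_def fmod[OF z])
    qed
    have "restrict (co x F) J = c"
    proof (rule PiE_ext[OF _ c])
      fix p assume "p \<in> J"
      then obtain z r where p: "p = (z, r)" "z \<in> R" "r \<in> D z" "(z, r) \<in> J" by (auto simp: J_def D_def)
      have fD: "finite (D z)" by (auto simp: D_def)
      have "co x F (z, r) = (\<Sum>i<N. x ^ (r * i) * f z i)" by (simp add: co_def FT[OF p(2)])
      also have "\<dots> = (\<Sum>i<N. \<Sum>s\<in>D z. inverse (of_nat N) * c (z, s) * x ^ ((r + s * (N - 1)) * i))"
      proof -
        have "x ^ (r * i) * x ^ (s * (N - 1) * i) = x ^ ((r + s * (N - 1)) * i)" for i s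
          by (simp only: power_add[symmetric] distrib_right)
        then have "x ^ (r * i) * (y * (x ^ (s * (N - 1) * i) * e)) = y * e * x ^ ((r + s * (N - 1)) * i)"
          for i s and y e :: 'k by (metis mult.left_commute mult.commute)
        then show ?thesis by (simp only: f_def sum_distrib_left)
      qed
      also have "\<dots> = (\<Sum>s\<in>D z. inverse (of_nat N) * c (z, s) * (\<Sum>i<N. x ^ ((r + s * (N - 1)) * i)))"
        by (subst sum.swap) (simp add: sum_distrib_left)
      also have "\<dots> = (\<Sum>s\<in>D z. if s = r then c (z, s) else 0)"
      proof (intro sum.cong refl)
        fix s assume s: "s \<in> D z"
        have "N dvd r + s * (N - 1) \<longleftrightarrow> s = r"
        proof
          assume "N dvd r + s * (N - 1)"
          \<comment> \<open>Over the integers \<open>N - 1\<close> can be replaced by -1 modulo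
            \<open>N\<close>.\<close>
          then have "int N dvd int (r + s * (N - 1))" by (simp only: int_dvd_int_iff)
          moreover have "int (r + s * (N - 1)) = int r - int s + int s * int N"
            using N0 by (cases N) (auto simp: algebra_simps)
          ultimately have "int N dvd int r - int s" by (simp only: dvd_add_times_triv_right_iff)
          moreover have "\<bar>int r - int s\<bar> < int N" using s p(3) by (auto simp: D_def)
          ultimately show "s = r" using dvd_imp_le_int[of "int r - int s" "int N"] by (cases "int r = int s") auto
        next
          assume "s = r"
          then have "r + s * (N - 1) = r * N" using N0 by (cases N) auto
          then show "N dvd r + s * (N - 1)" by simp
        qed
        then show "inverse (of_nat N) * c (z, s) * (\<Sum>i<N. x ^ ((r + s * (N - 1)) * i)) =
            (if s = r then c (z, s) else 0)"
          using primitive_root_sum[of x N "r + s * (N - 1)", OF x] N by simp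
      qed
      also have "\<dots> = c (z, r)" using fD p(3) by simp
      finally show "restrict (co x F) J p = c p" using p by simp
    qed auto
    moreover have "F \<in> Y \<rightarrow>\<^sub>E UNIV" by (auto simp: F_def)
    ultimately show "c \<in> (\<lambda>F. restrict (co x F) J) ` (Y \<rightarrow>\<^sub>E UNIV)" by (metis image_eqI)
  qed auto
qed

text \<open>Both sides compute the trace of the \<open>j\<close>-th power of \<open>T\<close> on
  functions on \<open>Y\<close>: a cycle contributes its length if that length divides
  \<open>j\<close>, and 0 otherwise.\<close>

lemma sum_J_fixed_points:
  fixes w :: complex
  assumes w: "\<And>i. w ^ i = 1 \<longleftrightarrow> N dvd i"
  shows "(\<Sum>(z, r)\<in>J. (w ^ j) ^ r) = of_nat (card {y \<in> Y. (T ^^ j) y = y})"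
proof -
  have inner: "(\<Sum>r | r < N \<and> N dvd r * L z. (w ^ j) ^ r) = (if L z dvd j then of_nat (L z) else 0)"
    if z: "z \<in> R" for z
  proof -
    obtain k where k: "N = L z * k" using LN[OF z] by auto
    have k0: "k > 0" and L0: "L z > 0" using k N0 by auto
    \<comment> \<open>The admissible exponents are the multiples of \<open>N / L z\<close>.\<close>
    have "{r. r < N \<and> N dvd r * L z} = (*) k ` {..<L z}"
      using k0 L0 by (auto simp: k mult.commute[of _ "L z"] elim!: dvdE)
    then have "(\<Sum>r | r < N \<and> N dvd r * L z. (w ^ j) ^ r) = (\<Sum>s<L z. (w ^ k) ^ (j * s))"
      using k0 by (simp add: sum.reindex inj_on_def power_mult[symmetric] mult_ac)
    also have "\<dots> = (if L z dvd j then of_nat (L z) else 0)"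
    proof (rule primitive_root_sum)
      show "(w ^ k) ^ i = 1 \<longleftrightarrow> L z dvd i" for i
        using w[of "k * i"] k0 by (simp add: k power_mult mult.commute[of "L z"])
    qed
    finally show ?thesis .
  qed
  have "(\<Sum>(z, r)\<in>J. (w ^ j) ^ r) = (\<Sum>z\<in>R. \<Sum>r | r < N \<and> N dvd r * L z. (w ^ j) ^ r)"
    unfolding J_def using finR by (intro sum.Sigma[symmetric]) auto
  also have "\<dots> = (\<Sum>z\<in>R. if L z dvd j then of_nat (L z) else 0)" using inner by (intro sum.cong) auto
  also have "\<dots> = (\<Sum>z\<in>{z\<in>R. L z dvd j}. of_nat (L z))" using finR by (rule sum.inter_filter[symmetric])
  also have "\<dots> = of_nat (card (SIGMA z:{z\<in>R. L z dvd j}. {..<L z}))" using finR by simp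
  also have "card (SIGMA z:{z\<in>R. L z dvd j}. {..<L z}) = card {y \<in> Y. (T ^^ j) y = y}"
  proof (rule bij_betw_same_card)
    have fix_iff: "(T ^^ j) ((T ^^ a) z) = (T ^^ a) z \<longleftrightarrow> L z dvd j" if z: "z \<in> R" for z a
    proof
      assume "(T ^^ j) ((T ^^ a) z) = (T ^^ a) z"
      then have "(T ^^ (j + a)) z = (T ^^ a) z" by (simp add: funpow_add)
      then have "(j + a) mod L z = a mod L z" using T_unique[OF z z, of "j + a" a] by simp
      then show "L z dvd j" using mod_eq_dvd_iff_nat[of a "j + a" "L z"] by simp
    next
      assume "L z dvd j"
      then have "(T ^^ j) z = z" using Ldvd[OF z] by simp
      moreover have "(T ^^ (j + a)) z = (T ^^ (a + j)) z" by (simp only: add.commute)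
      ultimately show "(T ^^ j) ((T ^^ a) z) = (T ^^ a) z" by (simp add: funpow_add)
    qed
    show "bij_betw (\<lambda>(z, a). (T ^^ a) z) (SIGMA z:{z\<in>R. L z dvd j}. {..<L z}) {y \<in> Y. (T ^^ j) y = y}"
    proof (rule bij_betw_subset[OF bij])
      show "(\<lambda>(z, a). (T ^^ a) z) ` (SIGMA z:{z\<in>R. L z dvd j}. {..<L z}) = {y \<in> Y. (T ^^ j) y = y}"
      proof (intro equalityI subsetI)
        fix y assume y: "y \<in> {y \<in> Y. (T ^^ j) y = y}"
        then have "y \<in> Y" by simp
        then obtain z a where za: "z \<in> R" "a < L z" "y = (T ^^ a) z" by (rule Y_cases)
        then have "L z dvd j" using fix_iff[OF za(1), of a] y by simp
        then show "y \<in> (\<lambda>(z, a). (T ^^ a) z) ` (SIGMA z:{z\<in>R. L z dvd j}. {..<L z})" using za by force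
      next
        fix y assume "y \<in> (\<lambda>(z, a). (T ^^ a) z) ` (SIGMA z:{z\<in>R. L z dvd j}. {..<L z})"
        then obtain z a where "z \<in> R" "L z dvd j" "y = (T ^^ a) z" by auto
        then show "y \<in> {y \<in> Y. (T ^^ j) y = y}" using fix_iff TiY RY by auto
      qed
    qed auto
  qed
  finally show ?thesis .
qed

end

text \<open>Fourier inversion on the cyclic group of order \<open>N\<close>.\<close>

lemma residue_counts_eq:
  fixes w :: complex and d :: "'i \<Rightarrow> nat" and e :: "'j \<Rightarrow> nat"
  assumes w: "\<And>i. w ^ i = 1 \<longleftrightarrow> N dvd i" and N: "N > 0" and fin: "finite I" "finite J"
    and eq: "\<And>j. j < N \<Longrightarrow> (\<Sum>i\<in>I. (w ^ j) ^ d i) = (\<Sum>i\<in>J. (w ^ j) ^ e i)"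
  shows "card {i\<in>I. d i mod N = r} = card {i\<in>J. e i mod N = r}"
proof (cases "r < N")
  case True
  have count: "(\<Sum>j<N. (w ^ j) ^ (N - r) * (\<Sum>i\<in>I. (w ^ j) ^ d i)) = of_nat N * of_nat (card {i\<in>I. d i mod N = r})"
    if "finite I" for I :: "'z set" and d
  proof -
    have "(\<Sum>j<N. (w ^ j) ^ (N - r) * (\<Sum>i\<in>I. (w ^ j) ^ d i)) = (\<Sum>j<N. \<Sum>i\<in>I. w ^ ((N - r + d i) * j))"
    proof -
      have "(w ^ j) ^ a * (w ^ j) ^ b = w ^ ((a + b) * j)" for a b j
        by (simp only: power_add[symmetric] power_mult[symmetric] mult.commute[of j] distrib_right)
      then show ?thesis by (simp only: sum_distrib_left)
    qed
    also have "\<dots> = (\<Sum>i\<in>I. if d i mod N = r then of_nat N else 0)"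
    proof (subst sum.swap, intro sum.cong refl)
      fix i
      have "N dvd N - r + d i \<longleftrightarrow> d i mod N = r"
      proof -
        have "int (N - r + d i) = int N + (int (d i) - int r)" using True by (simp add: of_nat_diff)
        then have "N dvd N - r + d i \<longleftrightarrow> int N dvd int N + (int (d i) - int r)"
          by (simp only: int_dvd_int_iff[symmetric])
        also have "\<dots> \<longleftrightarrow> int N dvd int (d i) - int r" by (rule dvd_add_triv_left_iff)
        also have "\<dots> \<longleftrightarrow> int (d i) mod int N = int r mod int N" by (simp only: mod_eq_dvd_iff)
        also have "\<dots> \<longleftrightarrow> d i mod N = r" unfolding zmod_int[symmetric] using True by simp
        finally show ?thesis .
      qed
      then show "(\<Sum>j<N. w ^ ((N - r + d i) * j)) = (if d i mod N = r then of_nat N else 0)"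
        using primitive_root_sum[of w N, OF w] by simp
    qed
    also have "\<dots> = of_nat N * of_nat (card {i\<in>I. d i mod N = r})"
      using that by (simp add: sum.inter_filter[symmetric])
    finally show ?thesis .
  qed
  have "(of_nat N :: complex) * of_nat (card {i\<in>I. d i mod N = r}) = of_nat N * of_nat (card {i\<in>J. e i mod N = r})"
  proof -
    have "(\<Sum>j<N. (w ^ j) ^ (N - r) * (\<Sum>i\<in>I. (w ^ j) ^ d i)) =
        (\<Sum>j<N. (w ^ j) ^ (N - r) * (\<Sum>i\<in>J. (w ^ j) ^ e i))"
      using eq by (intro sum.cong) auto
    then show ?thesis by (simp only: count[OF fin(1)] count[OF fin(2)])
  qed
  then have "(of_nat (card {i\<in>I. d i mod N = r}) :: complex) = of_nat (card {i\<in>J. e i mod N = r})"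
    using N by simp
  then show ?thesis by (simp only: of_nat_eq_iff)
next
  case False
  then have "{i\<in>I. d i mod N = r} = {}" "{i\<in>J. e i mod N = r} = {}" using N by auto
  then show ?thesis by (simp only: card.empty)
qed

text \<open>Bijections within the residue classes are glued; images from distinct classes cannot
  collide because the residue is preserved.\<close>

lemma residue_bijection:
  fixes d :: "'i \<Rightarrow> nat" and e :: "'j \<Rightarrow> nat"
  assumes fin: "finite I" "finite J" and eq: "\<And>r. card {i\<in>I. d i mod N = r} = card {i\<in>J. e i mod N = r}"
  obtains \<sigma> where "bij_betw \<sigma> J I" "\<And>j. j \<in> J \<Longrightarrow> d (\<sigma> j) mod N = e j mod N"
proof -
  have "\<exists>h. bij_betw h {i\<in>J. e i mod N = r} {i\<in>I. d i mod N = r}" for r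
    using fin eq[of r] by (intro finite_same_card_bij) auto
  then obtain h where h: "\<And>r. bij_betw (h r) {i\<in>J. e i mod N = r} {i\<in>I. d i mod N = r}" by metis
  define \<sigma> where "\<sigma> j = h (e j mod N) j" for j
  have \<sigma>: "\<sigma> j \<in> I" "d (\<sigma> j) mod N = e j mod N" if "j \<in> J" for j
    using h[of "e j mod N"] that unfolding \<sigma>_def bij_betw_def by auto
  have "bij_betw \<sigma> J I"
  proof (rule bij_betw_imageI)
    show "inj_on \<sigma> J"
    proof (rule inj_onI)
      fix i j assume ij: "i \<in> J" "j \<in> J" "\<sigma> i = \<sigma> j"
      then have e: "e i mod N = e j mod N" using \<sigma>(2)[OF ij(1)] \<sigma>(2)[OF ij(2)] by simp
      have "inj_on (h (e j mod N)) {i\<in>J. e i mod N = e j mod N}" using h by (simp add: bij_betw_def)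
      moreover have "h (e j mod N) i = h (e j mod N) j" using ij(3) e by (simp add: \<sigma>_def)
      ultimately show "i = j" using ij e by (auto dest: inj_onD)
    qed
    show "\<sigma> ` J = I"
    proof (intro equalityI subsetI)
      fix i assume i: "i \<in> I"
      then have "i \<in> h (d i mod N) ` {j\<in>J. e j mod N = d i mod N}"
        using h[of "d i mod N"] by (auto simp: bij_betw_def)
      then obtain j where "j \<in> J" "e j mod N = d i mod N" "i = h (d i mod N) j" by auto
      then show "i \<in> \<sigma> ` J" by (auto simp: \<sigma>_def image_iff intro!: bexI[of _ j])
    qed (use \<sigma> in auto)
  qed
  then show ?thesis using \<sigma>(2) that by blast
qed

section \<open>Flags stable under a scalar\<close>

lemma power_mod_card:
  fixes g :: "'a::field"
  assumes "g ^ N = 1" shows "g ^ i = g ^ (i mod N)"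
proof -
  have "g ^ i = g ^ (N * (i div N) + i mod N)" by simp
  then show ?thesis using assms by (simp only: power_add power_mult power_one mult_1_left)
qed

text \<open>A generator comes from the cyclicity of the multiplicative group. Its order is exactly
  \<open>N\<close>, since a smaller one would leave too few powers.\<close>

lemma finite_subfield_generator:
  fixes E :: "'k::field set"
  assumes sub: "subfield E (class_ring :: 'k ring)" and fin: "finite E"
  defines "N \<equiv> card E - 1"
  obtains g where "g \<in> E - {0}" "\<And>i. g ^ i = 1 \<longleftrightarrow> N dvd i" "E - {0} = (\<lambda>i. g ^ i) ` {..<N}" "N > 0"
proof -
  interpret E: finite_subfield E by (rule subfield_finite_subfield[OF sub fin])
  let ?R = "(class_ring :: 'k ring)\<lparr>carrier := E\<rparr>"
  interpret R: field ?R
    using ring.subfield_iff(2)[OF class_ring.ring_axioms sub] by simp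
  obtain a where a: "a \<in> carrier (mult_of ?R)" "carrier (mult_of ?R) = {a [^]\<^bsub>?R\<^esub> i | i::nat. i \<in> UNIV}"
    using R.finite_field_mult_group_has_gen fin by auto
  have pow: "a [^]\<^bsub>?R\<^esub> i = a ^ i" for i :: nat
    by (induct i) (auto simp: nat_pow_def mult.commute)
  have E0: "E - {0} = range (\<lambda>i. a ^ i)" using a(2)[unfolded pow] by auto
  have aE: "a \<in> E - {0}" using a(1) by simp
  have cE: "card (E - {0}) = N" using E.K0 fin by (simp add: N_def)
  have N0: "N > 0" using E.Q_ge_2 by (simp add: N_def)
  have aN: "a ^ N = 1"
    unfolding cE[symmetric] using aE fin E.K_mult by (intro power_card_mult_closed) auto
  have sub: "range (\<lambda>i. a ^ i) \<subseteq> (\<lambda>i. a ^ i) ` {..<k}" if "a ^ k = 1" "k > 0" for k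
  proof
    fix x assume "x \<in> range (\<lambda>i. a ^ i)"
    then obtain i where "x = a ^ i" by auto
    then show "x \<in> (\<lambda>i. a ^ i) ` {..<k}" using power_mod_card[OF that(1), of i] that(2) by auto
  qed
  have "a ^ i = 1 \<longleftrightarrow> N dvd i" for i
  proof
    assume i: "a ^ i = 1"
    show "N dvd i"
    proof (rule ccontr)
      assume "\<not> N dvd i"
      then have p: "i mod N > 0" by (simp add: dvd_eq_mod_eq_0)
      have "a ^ (i mod N) = 1" using power_mod_card[OF aN, of i] i by simp
      from sub[OF this p] have "card (E - {0}) \<le> card ((\<lambda>i. a ^ i) ` {..<i mod N})"
        unfolding E0 by (intro card_mono) auto
      also have "\<dots> \<le> i mod N" using card_image_le[of "{..<i mod N}" "\<lambda>i. a ^ i"] by simp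
      also have "\<dots> < N" using N0 by simp
      finally show False using cE by simp
    qed
  next
    assume "N dvd i"
    then show "a ^ i = 1" using power_mod_card[OF aN, of i] by (auto simp: dvd_eq_mod_eq_0)
  qed
  moreover have "E - {0} = (\<lambda>i. a ^ i) ` {..<N}" using E0 sub[OF aN N0] by auto
  ultimately show ?thesis using that[of a] aE N0 by blast
qed

lemma complex_primitive_root:
  assumes "N > 0" obtains w :: complex where "\<And>i. w ^ i = 1 \<longleftrightarrow> N dvd i"
proof -
  define w where "w = cis (2 * pi / real N)"
  have pw: "w ^ i = cis (2 * pi * real i / real N)" for i by (simp add: w_def DeMoivre mult_ac)
  have wN: "w ^ N = 1" using assms by (simp add: pw)
  have inj: "inj_on (\<lambda>k. w ^ k) {..<N}"
    using bij_betw_roots_unity[OF assms] by (simp add: bij_betw_def pw)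
  have "w ^ i = 1 \<longleftrightarrow> N dvd i" for i
  proof -
    have "w ^ i = 1 \<longleftrightarrow> w ^ (i mod N) = w ^ 0" using power_mod_card[OF wN, of i] by simp
    also have "\<dots> \<longleftrightarrow> i mod N = 0" using inj_onD[OF inj, of "i mod N" 0] assms by auto
    finally show ?thesis by (simp add: dvd_eq_mod_eq_0)
  qed
  then show ?thesis using that by blast
qed

text \<open>The elements are roots of a polynomial of degree \<open>M\<close>.\<close>

lemma card_power_fixed_le:
  fixes K :: "'k::field set"
  assumes "\<And>x. x \<in> K \<Longrightarrow> x ^ M = x" "M \<ge> 2" shows "card K \<le> M"
proof -
  define p :: "'k poly" where "p = Polynomial.monom 1 M - Polynomial.monom 1 1"
  have "Polynomial.coeff p M = 1" using assms(2) by (simp add: p_def)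
  then have p0: "p \<noteq> 0" by auto
  have "Polynomial.degree p \<le> M"
    unfolding p_def using assms(2) by (intro degree_diff_le) (auto simp: degree_monom_eq)
  moreover have "K \<subseteq> {x. poly p x = 0}" using assms(1) by (auto simp: p_def poly_monom)
  then have "card K \<le> card {x. poly p x = 0}" by (intro card_mono poly_roots_finite p0)
  ultimately show ?thesis using card_poly_roots_bound[OF p0] by linarith
qed

context field_extension
begin

lemma frobenius_add: "(x + y) ^ (q ^ j) = x ^ (q ^ j) + y ^ (q ^ j)" for x y :: 'k
proof (rule add_power_iterate, rule add_power_binomial_zero)
  show "q > 0" using q_ge_2 by simp
  fix i assume i: "0 < i" "i < q"
  then have "of_nat (q choose i) = (0 :: 'f)" using finite_field_choose_card[where 'f = 'f, of i] by (simp add: card_F)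
  then have "\<iota> (of_nat (q choose i)) = 0" by simp
  then show "of_nat (q choose i) = (0 :: 'k)" by (simp add: hom_distribs)
qed

lemma frobenius_fixed: "a \<in> range \<iota> \<Longrightarrow> a ^ (q ^ j) = a"
proof (induct j)
  case (Suc j)
  obtain b where b: "a = \<iota> b" using Suc by auto
  have "\<iota> (b ^ q) = \<iota> b" using finite_field_power_card[of b] by (simp add: card_F)
  then have "a ^ q = a" by (simp add: b hom_distribs)
  then show ?case using Suc by (simp add: power_mult)
qed simp

text \<open>This is the vanishing binomial coefficient \<open>q choose 1\<close>. For positive
  \<open>m\<close> it makes \<open>q ^ m - 1\<close> equal to -1, hence nonzero, in the large
  field.\<close>

lemma of_nat_q: "of_nat q = (0 :: 'k)"
proof -
  have "of_nat (q choose 1) = (0 :: 'f)" using finite_field_choose_card[where 'f = 'f, of 1] q_ge_2 by (simp add: card_F)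
  then have "\<iota> (of_nat q) = 0" by simp
  then show ?thesis by (simp add: hom_distribs)
qed

lemma sp_finite_subfield:
  assumes "finite_subfield E" "range \<iota> \<subseteq> E" shows "F.sp E"
proof -
  interpret E: finite_subfield E by fact
  show ?thesis unfolding F.sp_def using assms(2) E.K0 E.K_add E.K_mult by blast
qed

text \<open>\<open>K\<close> is the field generated by \<open>g\<close> over the image of \<open>\<iota>\<close>.\<close>

lemma adjoin_root_of_unity:
  assumes E: "finite_subfield E" "range \<iota> \<subseteq> E" "card E = q ^ m" and g: "g \<in> E" "g \<noteq> 0"
  obtains K d where "finite_subfield K" "card K = q ^ d" "d > 0" "d dvd m"
    "\<And>W. F.sp W \<and> (\<forall>x\<in>W. g * x \<in> W) \<longleftrightarrow> finite_subfield.sp K W"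
    "\<And>j. g ^ (q ^ j) = g \<longleftrightarrow> d dvd j"
proof -
  interpret E: finite_subfield E by fact
  define N where "N = card (E - {0})"
  \<comment> \<open>The exponents below \<open>N\<close> already give all powers of
    \<open>g\<close>, so this span is closed under multiplication.\<close>
  define K where "K = F.lspan (map (\<lambda>i. g ^ i) [0..<N])"
  have gE: "g \<in> E - {0}" using g by simp
  have N0: "N > 0" unfolding N_def using gE E.finite_K by (auto simp: card_gt_0_iff)
  have gN: "g ^ N = 1" unfolding N_def using gE E.finite_K E.K_mult by (intro power_card_mult_closed) auto
  have spE: "F.sp E" by (rule sp_finite_subfield[OF E(1,2)])
  have gpE: "g ^ i \<in> E" for i by (induct i) (use g E.K1 E.K_mult in auto)
  have gK: "g ^ i \<in> K" for i
  proof -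
    have "g ^ (i mod N) \<in> set (map (\<lambda>i. g ^ i) [0..<N])" using N0 by simp
    then have "g ^ (i mod N) \<in> K" unfolding K_def using F.lspan_superset by blast
    then show ?thesis by (simp flip: power_mod_card[OF gN])
  qed
  have least: "K \<subseteq> W" if "F.sp W" "\<And>i. g ^ i \<in> W" for W
    unfolding K_def using that by (intro F.lspan_least) auto
  have spK: "F.sp K" unfolding K_def by (rule F.sp_lspan)
  have KE: "K \<subseteq> E" using least spE gpE by blast
  have K1: "1 \<in> K" using gK[of 0] by simp
  have Kmul: "x * y \<in> W" if W: "F.sp W" "\<And>y. y \<in> W \<Longrightarrow> g * y \<in> W" and x: "x \<in> K" and y: "y \<in> W" for W x y
  proof -
    have "g ^ i * z \<in> W" if "z \<in> W" for i z by (induct i) (use that W(2) in \<open>auto simp: mult.assoc\<close>)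
    \<comment> \<open>The elements that multiply \<open>W\<close> into itself form a subspace
      containing all powers of \<open>g\<close>, so it contains \<open>K\<close>.\<close>
    then have "K \<subseteq> {x. \<forall>z\<in>W. x * z \<in> W}"
      using F.spD[OF W(1)] by (intro least) (auto simp: F.sp_def distrib_right mult.assoc)
    then show ?thesis using x y by blast
  qed
  have gKK: "g * y \<in> K" if y: "y \<in> K" for y
  proof -
    have "K \<subseteq> {y. g * y \<in> K}"
    proof (rule least)
      show "F.sp {y. g * y \<in> K}" unfolding F.sp_def
        using F.spD[OF spK] by (auto simp: distrib_left mult.left_commute)
      show "g ^ i \<in> {y. g * y \<in> K}" for i using gK[of "Suc i"] by simp
    qed
    then show ?thesis using y by blast
  qed
  have FK: "range \<iota> \<subseteq> K" using F.spD(3)[OF spK _ K1] by fastforce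
  have KF: "finite_subfield K"
  proof (rule finite_subfieldI)
    show "finite K" unfolding K_def by (rule F.finite_lspan)
    show "0 \<in> K" by (rule F.spD(1)[OF spK])
    show "a * b \<in> K" if "a \<in> K" "b \<in> K" for a b using Kmul[OF spK gKK that] .
    show "- a \<in> K" if "a \<in> K" for a using F.sp_diff[OF spK F.spD(1)[OF spK] that] by simp
  qed (use K1 F.spD[OF spK] in auto)
  interpret K: finite_subfield K by fact
  obtain d where d: "card K = q ^ d"
    using F.sp_card[OF spK K.finite_K F.sp_zero] K.K0 by auto
  have d0: "d > 0" using K.Q_ge_2 d by (cases d) auto
  have sp_iff: "F.sp W \<and> (\<forall>x\<in>W. g * x \<in> W) \<longleftrightarrow> K.sp W" for W
  proof
    assume "F.sp W \<and> (\<forall>x\<in>W. g * x \<in> W)"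
    then have W: "F.sp W" and st: "\<And>x. x \<in> W \<Longrightarrow> g * x \<in> W" by auto
    show "K.sp W" unfolding K.sp_def using F.spD(1,2)[OF W] Kmul[OF W st] by blast
  next
    assume W: "K.sp W"
    have "F.sp W" unfolding F.sp_def using K.spD[OF W] FK by blast
    moreover have "g \<in> K" using gK[of 1] by simp
    ultimately show "F.sp W \<and> (\<forall>x\<in>W. g * x \<in> W)" using K.spD(3)[OF W] by blast
  qed
  have "K.sp E" unfolding K.sp_def using KE E.K0 E.K_add E.K_mult by blast
  then obtain M where "card E = card {0 :: 'k} * card K ^ M"
    using K.sp_card[OF _ E.finite_K K.sp_zero] E.K0 by auto
  then have "q ^ m = q ^ (d * M)" by (simp add: E(3) d power_mult)
  then have dm: "d dvd m" using q_ge_2 by simp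
  have gd: "g ^ (q ^ (d * k)) = g" for k
  proof (induct k)
    case (Suc k)
    have "g ^ card (K - {0}) = 1"
      using gK[of 1] g K.finite_K K.K_mult by (intro power_card_mult_closed) auto
    moreover have "card K = Suc (card (K - {0}))" using K.K0 K.finite_K by (metis card.remove)
    ultimately have "g ^ (q ^ d) = g" by (simp flip: d)
    then have "(g ^ (q ^ d)) ^ (q ^ (d * k)) = g" using Suc by simp
    then show ?case by (simp flip: power_mult power_add)
  qed simp
  have key: "g ^ (q ^ j) = g \<longleftrightarrow> d dvd j" for j
  proof
    assume j: "g ^ (q ^ j) = g"
    show "d dvd j"
    proof (rule ccontr)
      assume "\<not> d dvd j"
      then have r: "j mod d > 0" by (simp add: dvd_eq_mod_eq_0)
      have "g ^ (q ^ j) = (g ^ (q ^ (d * (j div d)))) ^ (q ^ (j mod d))"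
        by (simp flip: power_mult power_add)
      then have gr: "g ^ (q ^ (j mod d)) = g" using j gd by simp
      \<comment> \<open>The fixed points of this Frobenius power form a subspace with all powers of
        \<open>g\<close>, so they contain \<open>K\<close>; but there are at most
        \<open>q ^ (j mod d)\<close> of them, too few for \<open>K\<close>.\<close>
      have "F.sp {x. x ^ (q ^ (j mod d)) = x}" unfolding F.sp_def
        using q_ge_2 by (auto simp: frobenius_add power_mult_distrib frobenius_fixed power_0_left)
      moreover have "(g ^ i) ^ (q ^ (j mod d)) = g ^ i" for i
        using gr by (metis power_mult mult.commute)
      ultimately have "K \<subseteq> {x. x ^ (q ^ (j mod d)) = x}" by (intro least) auto
      moreover have "q ^ (j mod d) \<ge> 2" using r q_ge_2 by (cases "j mod d") (auto intro: order.trans[OF q_ge_2])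
      ultimately have "card K \<le> q ^ (j mod d)" by (intro card_power_fixed_le) auto
      moreover have "q ^ (j mod d) < q ^ d" using q_ge_2 d0 by (intro power_strict_increasing) auto
      ultimately show False using d by simp
    qed
  next
    assume "d dvd j" then show "g ^ (q ^ j) = g" using gd by auto
  qed
  show ?thesis by (rule that[OF KF d d0 dm sp_iff key])
qed

text \<open>By \<open>orbit_iff_flag\<close> this set indexes the orbits of the parabolic group on
  the vectors over \<open>E\<close>.\<close>

definition flags_of :: "'k set \<Rightarrow> nat list \<Rightarrow> 'k set list set" where
  "flags_of E \<alpha> = (\<lambda>v. F.flag \<alpha> (list_of_vec v)) ` vecs (sum_list \<alpha>) E"

definition scale_flag :: "'k \<Rightarrow> 'k set list \<Rightarrow> 'k set list" where
  "scale_flag g = map ((`) ((*) g))"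

lemma flags_of_lists:
  "flags_of E \<alpha> = F.flag \<alpha> ` {xs. length xs = sum_list \<alpha> \<and> set xs \<subseteq> E}"
proof -
  have e: "list_of_vec ` vecs (sum_list \<alpha>) E = {xs. length xs = sum_list \<alpha> \<and> set xs \<subseteq> E}"
  proof (intro equalityI subsetI)
    fix xs assume xs: "xs \<in> {xs. length xs = sum_list \<alpha> \<and> set xs \<subseteq> E}"
    then have "vec_of_list xs \<in> vecs (sum_list \<alpha>) E"
      unfolding vecs_def by (force simp: vec_of_list_index intro!: carrier_vecI)
    then have "list_of_vec (vec_of_list xs) \<in> list_of_vec ` vecs (sum_list \<alpha>) E" by (rule imageI)
    then show "xs \<in> list_of_vec ` vecs (sum_list \<alpha>) E" by (simp only: list_vec)
  qed (auto simp: vecs_def set_conv_nth list_of_vec_index)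
  show ?thesis unfolding flags_of_def e[symmetric] image_image ..
qed

lemma finite_flags_of: "finite E \<Longrightarrow> finite (flags_of E \<alpha>)"
  unfolding flags_of_def using finite_vecs by blast

lemma adj_scale: "(*) g ` F.adj U x = F.adj ((*) g ` U) (g * x)"
proof -
  have "g * (u + a * x) = g * u + a * (g * x)" for u a by (simp add: algebra_simps)
  then show ?thesis unfolding F.adj_def by (force simp: image_iff)
qed

lemma flag_scale: "F.flag \<alpha> (map ((*) g) xs) = scale_flag g (F.flag \<alpha> xs)"
proof -
  have ls: "F.lspan (map ((*) g) xs) = (*) g ` F.lspan xs" for xs
    by (induct xs) (auto simp: adj_scale)
  show ?thesis by (induct \<alpha> arbitrary: xs) (auto simp: scale_flag_def ls drop_map)
qed

lemma scale_flag_power: "(scale_flag g ^^ j) = scale_flag (g ^ j)"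
proof (induct j)
  case (Suc j)
  then show ?case by (auto simp: scale_flag_def fun_eq_iff image_image mult.assoc)
qed (auto simp: scale_flag_def fun_eq_iff intro!: map_idI[symmetric])

lemma list_of_vec_smult: "list_of_vec (g \<cdot>\<^sub>v v) = map ((*) g) (list_of_vec v)"
  by (rule nth_equalityI) (auto simp: list_of_vec_index)

lemma scale_vecs: "finite_subfield E \<Longrightarrow> g \<in> E \<Longrightarrow> v \<in> vecs n E \<Longrightarrow> g \<cdot>\<^sub>v v \<in> vecs n E"
  by (auto simp: vecs_def intro!: finite_subfield.K_mult)

lemma scale_flags_of:
  assumes "finite_subfield E" "g \<in> E" "y \<in> flags_of E \<alpha>" shows "scale_flag g y \<in> flags_of E \<alpha>"
  using assms scale_vecs[OF assms(1,2)] unfolding flags_of_def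
  by (auto simp: flag_scale[symmetric] list_of_vec_smult[symmetric])

text \<open>For a finite set, being mapped into itself by a nonzero scalar is the same as being
  mapped onto itself.\<close>

lemma fixed_flags:
  assumes E: "finite_subfield E" "range \<iota> \<subseteq> E" and g: "g \<noteq> 0"
  shows "{y \<in> flags_of E \<alpha>. scale_flag g y = y} = F.stable_chains E g \<alpha>"
proof -
  interpret E: finite_subfield E by fact
  have spE: "F.sp E" by (rule sp_finite_subfield[OF E(1,2)])
  have "scale_flag g y = y \<longleftrightarrow> (\<forall>W\<in>set y. \<forall>x\<in>W. g * x \<in> W)" if y: "y \<in> flags_of E \<alpha>" for y
  proof -
    have fin: "finite W" if "W \<in> set y" for W
      using y that by (auto simp: flags_of_def F.flag_index F.finite_lspan)
    have "scale_flag g y = y \<longleftrightarrow> (\<forall>W\<in>set y. (*) g ` W = W)"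
      unfolding scale_flag_def by (metis list.map_id0 id_apply map_eq_conv)
    also have "\<dots> \<longleftrightarrow> (\<forall>W\<in>set y. \<forall>x\<in>W. g * x \<in> W)"
    proof (intro ball_cong refl)
      fix W assume W: "W \<in> set y"
      show "(*) g ` W = W \<longleftrightarrow> (\<forall>x\<in>W. g * x \<in> W)"
      proof
        assume "\<forall>x\<in>W. g * x \<in> W"
        then show "(*) g ` W = W" using g fin[OF W] by (intro endo_inj_surj) (auto simp: inj_on_def)
      qed blast
    qed
    finally show ?thesis .
  qed
  then show ?thesis
    unfolding F.flag_image_stable[OF spE E.finite_K, of \<alpha> g, symmetric] flags_of_lists by blast
qed

lemma card_fixed_flags:
  assumes E: "finite_subfield E" "range \<iota> \<subseteq> E" "card E = q ^ m" and g: "g \<in> E" "g \<noteq> 0"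
  obtains d where "d > 0" "d dvd m" "\<And>j. g ^ (q ^ j) = g \<longleftrightarrow> d dvd j"
    "real (card {y \<in> flags_of E \<alpha>. scale_flag g y = y}) =
      (\<Sum>b | length b = length \<alpha> \<and> (\<forall>i<length \<alpha>. d * b ! i \<le> \<alpha> ! i) \<and> d * sum_list b \<le> m. term_value q d m b)"
proof -
  interpret E: finite_subfield E by fact
  obtain K d where K: "finite_subfield K" "card K = q ^ d" "d > 0" "d dvd m"
    "\<And>W. F.sp W \<and> (\<forall>x\<in>W. g * x \<in> W) \<longleftrightarrow> finite_subfield.sp K W"
    "\<And>j. g ^ (q ^ j) = g \<longleftrightarrow> d dvd j" by (rule adjoin_root_of_unity[OF E g]) blast
  interpret K: finite_subfield K by fact
  let ?B = "{b. length b = length \<alpha> \<and> (\<forall>i<length \<alpha>. d * b ! i \<le> \<alpha> ! i)}"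
  have finB: "finite ?B"
  proof (rule finite_subset)
    show "?B \<subseteq> {b. set b \<subseteq> {..sum_list \<alpha>} \<and> length b = length \<alpha>}"
    proof (rule subsetI, intro CollectI conjI subsetI)
      fix b assume "b \<in> ?B" then show "length b = length \<alpha>" by simp
    next
      fix b x assume "b \<in> ?B" and x: "x \<in> set b"
      then have b: "length b = length \<alpha>" "\<forall>i<length \<alpha>. d * b ! i \<le> \<alpha> ! i" by auto
      obtain i where i: "i < length \<alpha>" "x = b ! i" using x b(1) by (auto simp: in_set_conv_nth)
      have "x \<le> d * x" using K(3) by simp
      also have "\<dots> \<le> \<alpha> ! i" using b(2) i by simp
      also have "\<dots> \<le> sum_list \<alpha>" using i(1) by (simp add: elem_le_sum_list)
      finally show "x \<in> {..sum_list \<alpha>}" by simp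
    qed
    show "finite {b. set b \<subseteq> {..sum_list \<alpha>} \<and> length b = length \<alpha>}" by (rule finite_lists_length_eq) simp
  qed
  obtain M where M: "m = d * M" using K(4) by auto
  have Mm: "m div d = M" using M K(3) by simp
  have "F.sp E" by (rule sp_finite_subfield[OF E(1,2)])
  then have spE: "K.sp E" using K(5)[of E] E.K_mult g(1) by blast
  have cE: "card E = card K ^ M" by (simp add: E(3) K(2) M power_mult)
  have tv: "real (card (K.dchains E b)) = term_value q d m b" for b
    using K.card_dchains[OF spE E.finite_K cE, of b] by (simp add: term_value_def Mm K(2))
  have "card {y \<in> flags_of E \<alpha>. scale_flag g y = y} = card (\<Union>b\<in>?B. K.dchains E b)"
    unfolding fixed_flags[OF E(1,2) g(2)] F.stable_chains_dchains[OF K(1,2,3,5) E.finite_K] ..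
  also have "\<dots> = (\<Sum>b\<in>?B. card (K.dchains E b))"
  proof (rule card_UN_disjoint[OF finB])
    show "\<forall>b\<in>?B. finite (K.dchains E b)" using K.finite_dchains[OF E.finite_K] by blast
    show "\<forall>b\<in>?B. \<forall>c\<in>?B. b \<noteq> c \<longrightarrow> K.dchains E b \<inter> K.dchains E c = {}"
      using K.dchains_disjoint[OF _ _ E.finite_K] by (metis (mono_tags, lifting) disjoint_iff mem_Collect_eq)
  qed
  finally have "real (card {y \<in> flags_of E \<alpha>. scale_flag g y = y}) = (\<Sum>b\<in>?B. term_value q d m b)"
    by (simp add: tv)
  also have "\<dots> = (\<Sum>b | length b = length \<alpha> \<and> (\<forall>i<length \<alpha>. d * b ! i \<le> \<alpha> ! i) \<and> d * sum_list b \<le> m.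
      term_value q d m b)"
  \<comment> \<open>Types too large for dimension \<open>m\<close> contribute 0, because their
    product has the factor with \<open>j = M\<close>. This matches the range of summation obtained
    from \<open>C_series\<close>.\<close>
  proof (rule sum.mono_neutral_right[OF finB])
    show "\<forall>b\<in>?B - {b. length b = length \<alpha> \<and> (\<forall>i<length \<alpha>. d * b ! i \<le> \<alpha> ! i) \<and> d * sum_list b \<le> m}.
        term_value q d m b = 0"
    proof
      fix b assume "b \<in> ?B - {b. length b = length \<alpha> \<and> (\<forall>i<length \<alpha>. d * b ! i \<le> \<alpha> ! i) \<and> d * sum_list b \<le> m}"
      then have "M < sum_list b" using K(3) by (auto simp: M not_le)
      then have "(\<Prod>j<sum_list b. real (q ^ d) ^ (m div d) - real (q ^ d) ^ j) = 0"
        unfolding Mm by (intro prod_zero) auto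
      then show "term_value q d m b = 0" by (simp add: term_value_def)
    qed
  qed auto
  finally show ?thesis using that[of d] K(3,4,6) by blast
qed

end

section \<open>Push-forward of finitely supported functions\<close>

lemma lookup_push:
  assumes "inj_on h S" "Poly_Mapping.keys f \<subseteq> S" "v \<in> S"
  shows "Poly_Mapping.lookup (push h f) (h v) = Poly_Mapping.lookup f v"
proof -
  have "Poly_Mapping.lookup (push h f) (h v) =
      (\<Sum>u\<in>Poly_Mapping.keys f. if u = v then Poly_Mapping.lookup f u else 0)"
    unfolding push_def lookup_sum using assms
    by (intro sum.cong) (auto simp: lookup_single when_def dest: inj_onD)
  then show ?thesis by (auto simp: in_keys_iff)
qed

lemma keys_push: "Poly_Mapping.keys (push h f) \<subseteq> h ` Poly_Mapping.keys f"
proof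
  fix w assume "w \<in> Poly_Mapping.keys (push h f)"
  then have "(\<Sum>u\<in>Poly_Mapping.keys f. Poly_Mapping.lookup (Poly_Mapping.single (h u) (Poly_Mapping.lookup f u)) w) \<noteq> 0"
    by (simp add: in_keys_iff push_def lookup_sum)
  then obtain u where "u \<in> Poly_Mapping.keys f"
    "Poly_Mapping.lookup (Poly_Mapping.single (h u) (Poly_Mapping.lookup f u)) w \<noteq> 0"
    by (meson sum.neutral)
  then show "w \<in> h ` Poly_Mapping.keys f" by (auto simp: lookup_single when_def split: if_splits)
qed

text \<open>On the finite set \<open>S\<close> the map \<open>h\<close> is a permutation, so every
  point at which the two functions are compared is of the form \<open>h v\<close>.\<close>

lemma push_fixed_iff:
  assumes h: "inj_on h S" "h ` S \<subseteq> S" and S: "finite S" and f: "Poly_Mapping.keys f \<subseteq> S"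
  shows "push h f = f \<longleftrightarrow> (\<forall>v\<in>S. Poly_Mapping.lookup f (h v) = Poly_Mapping.lookup f v)"
proof
  assume "push h f = f" then show "\<forall>v\<in>S. Poly_Mapping.lookup f (h v) = Poly_Mapping.lookup f v"
    using lookup_push[OF h(1) f] by metis
next
  assume a: "\<forall>v\<in>S. Poly_Mapping.lookup f (h v) = Poly_Mapping.lookup f v"
  show "push h f = f"
  proof (rule poly_mapping_eqI)
    fix w
    show "Poly_Mapping.lookup (push h f) w = Poly_Mapping.lookup f w"
    proof (cases "w \<in> S")
      case True
      then obtain v where "v \<in> S" "w = h v" using endo_inj_surj[OF S h(2,1)] by blast
      then show ?thesis using a lookup_push[OF h(1) f] by simp
    next
      case False
      then have "w \<notin> Poly_Mapping.keys f" "w \<notin> Poly_Mapping.keys (push h f)"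
        using f keys_push[of h f] h(2) by blast+
      then show ?thesis by (simp add: in_keys_iff)
    qed
  qed
qed

lemma (in cyclic_action) co_shift_power:
  fixes x :: "'k::field"
  assumes x: "\<And>i. x ^ i = 1 \<longleftrightarrow> N dvd i" and z: "z \<in> Y"
    and G: "\<And>y. y \<in> Y \<Longrightarrow> G ((T ^^ j) y) = F y"
  shows "co x G (z, r) = (x ^ j) ^ r * co x F (z, r)"
  using G
proof (induct j arbitrary: F)
  case 0
  have "co x G (z, r) = co x F (z, r)" unfolding co_def using 0 TiY[OF z] by (auto intro!: sum.cong)
  then show ?case by simp
next
  case (Suc j)
  have "co x G (z, r) = (x ^ j) ^ r * co x (\<lambda>y. G ((T ^^ j) y)) (z, r)" by (rule Suc.hyps) simp
  also have "co x (\<lambda>y. G ((T ^^ j) y)) (z, r) = x ^ r * co x F (z, r)"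
    using Suc.prems by (intro co_shift[OF x z]) (simp add: funpow_swap1)
  finally show ?case by (simp add: power_mult_distrib mult_ac)
qed

section \<open>The isomorphism\<close>

lemma perm_module_simps [simp]:
  "carrier (perm_module n E) = {f. Poly_Mapping.keys f \<subseteq> {v \<in> carrier_vec n. \<forall>i<n. v $ i \<in> E}}"
  "zero (perm_module n E) = 0" "add (perm_module n E) = (+)"
  "module.smult (perm_module n E) = (\<lambda>c. Poly_Mapping.map ((*) c))"
  by (simp_all add: perm_module_def)

lemma lookup_map_times: "Poly_Mapping.lookup (Poly_Mapping.map ((*) c) f) v = c * Poly_Mapping.lookup f v"
  for c :: "'a::mult_zero"
  by (simp add: Poly_Mapping.map.rep_eq when_def)

context field_extension
begin

abbreviation vflag :: "nat list \<Rightarrow> 'k vec \<Rightarrow> 'k set list" where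
  "vflag \<alpha> v \<equiv> F.flag \<alpha> (list_of_vec v)"

abbreviation perm_fixed :: "'k set \<Rightarrow> nat list \<Rightarrow> ('k, 'k vec \<Rightarrow>\<^sub>0 'k) module" where
  "perm_fixed E \<alpha> \<equiv> fixed_module (map_mat \<iota> ` parabolic \<alpha>) perm_mat_act (perm_module (sum_list \<alpha>) E)"

text \<open>Fixed elements are those constant on orbits, and \<open>orbit_iff_flag\<close> replaces
  orbits by fibres of \<open>vflag\<close>.\<close>

lemma perm_fixed_carrier:
  assumes E: "finite_subfield E" "range \<iota> \<subseteq> E"
  shows "carrier (perm_fixed E \<alpha>) = {f. Poly_Mapping.keys f \<subseteq> vecs (sum_list \<alpha>) E \<and>
    (\<forall>v\<in>vecs (sum_list \<alpha>) E. \<forall>w\<in>vecs (sum_list \<alpha>) E. vflag \<alpha> v = vflag \<alpha> w \<longrightarrow>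
      Poly_Mapping.lookup f v = Poly_Mapping.lookup f w)}"
proof -
  interpret E: finite_subfield E by fact
  let ?V = "vecs (sum_list \<alpha>) E"
  have "perm_mat_act (map_mat \<iota> g) f = f \<longleftrightarrow>
      (\<forall>v\<in>?V. Poly_Mapping.lookup f (map_mat \<iota> g *\<^sub>v v) = Poly_Mapping.lookup f v)"
    if f: "Poly_Mapping.keys f \<subseteq> ?V" and g: "g \<in> parabolic \<alpha>" for f :: "'k vec \<Rightarrow>\<^sub>0 'k" and g
  proof -
    have gc: "g \<in> carrier_mat (sum_list \<alpha>) (sum_list \<alpha>)" "invertible_mat g"
      using g by (auto simp: parabolic_def)
    show ?thesis unfolding perm_mat_act_def
    proof (rule push_fixed_iff[OF _ _ finite_vecs[OF E.finite_K] f])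
      show "inj_on (\<lambda>v. map_mat \<iota> g *\<^sub>v v) ?V"
        using map_mat_inj[OF gc] by (auto simp: inj_on_def vecs_def)
      show "(\<lambda>v. map_mat \<iota> g *\<^sub>v v) ` ?V \<subseteq> ?V" using map_mat_vecs[OF E gc(1)] by blast
    qed
  qed
  then have "(\<forall>h\<in>map_mat \<iota> ` parabolic \<alpha>. perm_mat_act h f = f) \<longleftrightarrow>
      (\<forall>v\<in>?V. \<forall>g\<in>parabolic \<alpha>. Poly_Mapping.lookup f (map_mat \<iota> g *\<^sub>v v) = Poly_Mapping.lookup f v)"
    if "Poly_Mapping.keys f \<subseteq> ?V" for f
    using that by auto
  moreover have "(\<forall>g\<in>parabolic \<alpha>. Poly_Mapping.lookup f (map_mat \<iota> g *\<^sub>v v) = Poly_Mapping.lookup f v) \<longleftrightarrow>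
      (\<forall>w\<in>?V. vflag \<alpha> v = vflag \<alpha> w \<longrightarrow> Poly_Mapping.lookup f v = Poly_Mapping.lookup f w)"
    if v: "v \<in> ?V" for f :: "'k vec \<Rightarrow>\<^sub>0 'k" and v
  proof
    assume l: "\<forall>g\<in>parabolic \<alpha>. Poly_Mapping.lookup f (map_mat \<iota> g *\<^sub>v v) = Poly_Mapping.lookup f v"
    show "\<forall>w\<in>?V. vflag \<alpha> v = vflag \<alpha> w \<longrightarrow> Poly_Mapping.lookup f v = Poly_Mapping.lookup f w"
    proof (intro ballI impI)
      fix w assume "w \<in> ?V" "vflag \<alpha> v = vflag \<alpha> w"
      then obtain g where "g \<in> parabolic \<alpha>" "map_mat \<iota> g *\<^sub>v v = w" using orbit_iff_flag[OF E v] by blast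
      then show "Poly_Mapping.lookup f v = Poly_Mapping.lookup f w" using l by auto
    qed
  next
    assume r: "\<forall>w\<in>?V. vflag \<alpha> v = vflag \<alpha> w \<longrightarrow> Poly_Mapping.lookup f v = Poly_Mapping.lookup f w"
    show "\<forall>g\<in>parabolic \<alpha>. Poly_Mapping.lookup f (map_mat \<iota> g *\<^sub>v v) = Poly_Mapping.lookup f v"
    proof
      fix g :: "'f mat" assume g: "g \<in> parabolic \<alpha>"
      then have w: "map_mat \<iota> g *\<^sub>v v \<in> ?V" using map_mat_vecs[OF E _ v] by (auto simp: parabolic_def)
      then have "vflag \<alpha> v = vflag \<alpha> (map_mat \<iota> g *\<^sub>v v)" using orbit_iff_flag[OF E v w] g by blast
      then show "Poly_Mapping.lookup f (map_mat \<iota> g *\<^sub>v v) = Poly_Mapping.lookup f v" using r w by metis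
    qed
  qed
  ultimately show ?thesis by (auto simp: fixed_module_def vecs_def[symmetric])
qed

lemma perm_fixedD:
  assumes E: "finite_subfield E" "range \<iota> \<subseteq> E" and f: "f \<in> carrier (perm_fixed E \<alpha>)"
  shows "Poly_Mapping.keys f \<subseteq> vecs (sum_list \<alpha>) E"
    and "\<And>v w. v \<in> vecs (sum_list \<alpha>) E \<Longrightarrow> w \<in> vecs (sum_list \<alpha>) E \<Longrightarrow> vflag \<alpha> v = vflag \<alpha> w \<Longrightarrow>
      Poly_Mapping.lookup f v = Poly_Mapping.lookup f w"
  using f unfolding perm_fixed_carrier[OF E] by blast+

lemma perm_fixedI:
  assumes E: "finite_subfield E" "range \<iota> \<subseteq> E" and "Poly_Mapping.keys f \<subseteq> vecs (sum_list \<alpha>) E"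
    and "\<And>v w. v \<in> vecs (sum_list \<alpha>) E \<Longrightarrow> w \<in> vecs (sum_list \<alpha>) E \<Longrightarrow> vflag \<alpha> v = vflag \<alpha> w \<Longrightarrow>
      Poly_Mapping.lookup f v = Poly_Mapping.lookup f w"
  shows "f \<in> carrier (perm_fixed E \<alpha>)"
  unfolding perm_fixed_carrier[OF E] using assms(3,4) by blast

lemma perm_fixed_ops:
  "zero (perm_fixed E \<alpha>) = 0" "add (perm_fixed E \<alpha>) = (+)"
  "module.smult (perm_fixed E \<alpha>) = (\<lambda>c. Poly_Mapping.map ((*) c))"
  by (simp_all add: fixed_module_def)

text \<open>Any vector of the orbit will do, since fixed elements do not distinguish between
  them.\<close>

definition flag_rep :: "'k set \<Rightarrow> nat list \<Rightarrow> 'k set list \<Rightarrow> 'k vec" where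
  "flag_rep E \<alpha> y = (SOME v. v \<in> vecs (sum_list \<alpha>) E \<and> vflag \<alpha> v = y)"

lemma flag_rep:
  assumes "y \<in> flags_of E \<alpha>"
  shows "flag_rep E \<alpha> y \<in> vecs (sum_list \<alpha>) E" "vflag \<alpha> (flag_rep E \<alpha> y) = y"
proof -
  have "\<exists>v. v \<in> vecs (sum_list \<alpha>) E \<and> vflag \<alpha> v = y" using assms by (auto simp: flags_of_def)
  from someI_ex[OF this] show "flag_rep E \<alpha> y \<in> vecs (sum_list \<alpha>) E" "vflag \<alpha> (flag_rep E \<alpha> y) = y"
    by (auto simp: flag_rep_def)
qed

text \<open>A fixed element seen as a function on orbits, made extensional to fit
  \<open>cyclic_action.co_bij\<close>.\<close>

definition flag_val :: "'k set \<Rightarrow> nat list \<Rightarrow> ('k vec \<Rightarrow>\<^sub>0 'k) \<Rightarrow> 'k set list \<Rightarrow> 'k" where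
  "flag_val E \<alpha> f = (\<lambda>y\<in>flags_of E \<alpha>. Poly_Mapping.lookup f (flag_rep E \<alpha> y))"

lemma flag_val_vflag:
  assumes E: "finite_subfield E" "range \<iota> \<subseteq> E" and f: "f \<in> carrier (perm_fixed E \<alpha>)"
    and v: "v \<in> vecs (sum_list \<alpha>) E"
  shows "flag_val E \<alpha> f (vflag \<alpha> v) = Poly_Mapping.lookup f v"
proof -
  have y: "vflag \<alpha> v \<in> flags_of E \<alpha>" using v by (auto simp: flags_of_def)
  have "flag_val E \<alpha> f (vflag \<alpha> v) = Poly_Mapping.lookup f (flag_rep E \<alpha> (vflag \<alpha> v))"
    using y by (simp only: flag_val_def restrict_apply')
  also have "\<dots> = Poly_Mapping.lookup f v" by (rule perm_fixedD(2)[OF E f flag_rep(1)[OF y] v flag_rep(2)[OF y]])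
  finally show ?thesis .
qed

lemma flag_val_bij:
  assumes E: "finite_subfield E" "range \<iota> \<subseteq> E"
  shows "bij_betw (flag_val E \<alpha>) (carrier (perm_fixed E \<alpha>)) (flags_of E \<alpha> \<rightarrow>\<^sub>E UNIV)"
proof (rule bij_betw_imageI)
  interpret E: finite_subfield E by fact
  let ?V = "vecs (sum_list \<alpha>) E"
  show "inj_on (flag_val E \<alpha>) (carrier (perm_fixed E \<alpha>))"
  proof (rule inj_onI, rule poly_mapping_eqI)
    fix f h v
    assume fh: "f \<in> carrier (perm_fixed E \<alpha>)" "h \<in> carrier (perm_fixed E \<alpha>)" "flag_val E \<alpha> f = flag_val E \<alpha> h"
    show "Poly_Mapping.lookup f v = Poly_Mapping.lookup h v"
    proof (cases "v \<in> ?V")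
      case True
      then show ?thesis using flag_val_vflag[OF E fh(1) True] flag_val_vflag[OF E fh(2) True] fh(3) by simp
    next
      case False
      then have "v \<notin> Poly_Mapping.keys f" "v \<notin> Poly_Mapping.keys h"
        using fh(1,2) unfolding perm_fixed_carrier[OF E] by auto
      then show ?thesis by (simp add: in_keys_iff)
    qed
  qed
  show "flag_val E \<alpha> ` carrier (perm_fixed E \<alpha>) = flags_of E \<alpha> \<rightarrow>\<^sub>E UNIV"
  proof (intro equalityI subsetI)
    fix G :: "'k set list \<Rightarrow> 'k" assume G: "G \<in> flags_of E \<alpha> \<rightarrow>\<^sub>E UNIV"
    define f where "f = (\<Sum>v\<in>?V. Poly_Mapping.single v (G (vflag \<alpha> v)))"
    have lf: "Poly_Mapping.lookup f v = (if v \<in> ?V then G (vflag \<alpha> v) else 0)" for v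
      using finite_vecs[OF E.finite_K]
      by (auto simp: f_def lookup_sum lookup_single when_def sum.delta)
    have "Poly_Mapping.keys f \<subseteq> ?V"
    proof
      fix v assume "v \<in> Poly_Mapping.keys f"
      then have "Poly_Mapping.lookup f v \<noteq> 0" by (simp only: in_keys_iff not_False_eq_True)
      then show "v \<in> ?V" unfolding lf by (simp split: if_splits)
    qed
    then have "f \<in> carrier (perm_fixed E \<alpha>)" unfolding perm_fixed_carrier[OF E] by (simp add: lf)
    moreover have "flag_val E \<alpha> f = G"
    proof (rule PiE_ext[OF _ G])
      fix y assume "y \<in> flags_of E \<alpha>"
      then show "flag_val E \<alpha> f y = G y" using flag_rep[of y E \<alpha>] by (simp add: flag_val_def lf)
    qed (auto simp: flag_val_def)
    ultimately show "G \<in> flag_val E \<alpha> ` carrier (perm_fixed E \<alpha>)" by blast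
  qed (auto simp: flag_val_def)
qed

text \<open>Pushing forward carries the value at a flag to the scaled flag, so the inverse scalar
  appears in the lookups.\<close>

lemma perm_scalar_act_fixed:
  assumes E: "finite_subfield E" "range \<iota> \<subseteq> E" and c: "c \<in> E" "c \<noteq> 0"
    and f: "f \<in> carrier (perm_fixed E \<alpha>)"
  shows "perm_scalar_act c f \<in> carrier (perm_fixed E \<alpha>)"
    and "y \<in> flags_of E \<alpha> \<Longrightarrow> flag_val E \<alpha> (perm_scalar_act c f) (scale_flag c y) = flag_val E \<alpha> f y"
proof -
  interpret E: finite_subfield E by fact
  let ?V = "vecs (sum_list \<alpha>) E"
  have kf: "Poly_Mapping.keys f \<subseteq> ?V" using f unfolding perm_fixed_carrier[OF E] by blast
  have inv: "inverse c \<cdot>\<^sub>v (c \<cdot>\<^sub>v v) = v" "c \<cdot>\<^sub>v (inverse c \<cdot>\<^sub>v v) = v" for v :: "'k vec"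
    using c(2) by (simp_all add: smult_smult_assoc)
  have inj: "inj_on (\<lambda>v. c \<cdot>\<^sub>v v) ?V" using inv(1) by (metis inj_onI)
  have sV: "c \<cdot>\<^sub>v v \<in> ?V" if "v \<in> ?V" for v using scale_vecs[OF E(1) c(1) that] .
  have lk: "Poly_Mapping.lookup (perm_scalar_act c f) (c \<cdot>\<^sub>v v) = Poly_Mapping.lookup f v" if "v \<in> ?V" for v
    unfolding perm_scalar_act_def by (rule lookup_push[OF inj kf that])
  have sfl: "vflag \<alpha> (a \<cdot>\<^sub>v v) = scale_flag a (vflag \<alpha> v)" for a v
    by (simp add: list_of_vec_smult flag_scale)
  have lk': "Poly_Mapping.lookup (perm_scalar_act c f) w = Poly_Mapping.lookup f (inverse c \<cdot>\<^sub>v w)"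
    "inverse c \<cdot>\<^sub>v w \<in> ?V" if "w \<in> ?V" for w
  proof -
    show i: "inverse c \<cdot>\<^sub>v w \<in> ?V" using scale_vecs[OF E(1) E.K_inverse[OF c(1)] that] .
    show "Poly_Mapping.lookup (perm_scalar_act c f) w = Poly_Mapping.lookup f (inverse c \<cdot>\<^sub>v w)"
      using lk[OF i] by (simp add: inv)
  qed
  show act: "perm_scalar_act c f \<in> carrier (perm_fixed E \<alpha>)"
  proof (rule perm_fixedI[OF E])
    show "Poly_Mapping.keys (perm_scalar_act c f) \<subseteq> ?V"
      using keys_push[of "\<lambda>v. c \<cdot>\<^sub>v v" f] kf sV unfolding perm_scalar_act_def by blast
    fix v w assume vw: "v \<in> ?V" "w \<in> ?V" "vflag \<alpha> v = vflag \<alpha> w"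
    have "vflag \<alpha> (inverse c \<cdot>\<^sub>v v) = vflag \<alpha> (inverse c \<cdot>\<^sub>v w)" by (simp only: sfl vw(3))
    then show "Poly_Mapping.lookup (perm_scalar_act c f) v = Poly_Mapping.lookup (perm_scalar_act c f) w"
      using perm_fixedD(2)[OF E f lk'(2)[OF vw(1)] lk'(2)[OF vw(2)]] by (simp only: lk'(1)[OF vw(1)] lk'(1)[OF vw(2)])
  qed
  assume y: "y \<in> flags_of E \<alpha>"
  note r = flag_rep[OF y]
  have "flag_val E \<alpha> (perm_scalar_act c f) (scale_flag c y) =
      flag_val E \<alpha> (perm_scalar_act c f) (vflag \<alpha> (c \<cdot>\<^sub>v flag_rep E \<alpha> y))" by (simp add: sfl r(2))
  also have "\<dots> = Poly_Mapping.lookup f (flag_rep E \<alpha> y)"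
    using flag_val_vflag[OF E act sV[OF r(1)]] lk[OF r(1)] by simp
  finally show "flag_val E \<alpha> (perm_scalar_act c f) (scale_flag c y) = flag_val E \<alpha> f y"
    using y by (simp add: flag_val_def)
qed

end

lemma (in cyclic_action) co_linear:
  assumes "\<And>y. y \<in> Y \<Longrightarrow> H y = c * F y + G y" "p \<in> J"
  shows "co x H p = c * co x F p + co x G p"
proof -
  obtain z r where p: "p = (z, r)" "z \<in> Y" using assms(2) RY by (auto simp: J_def)
  have "co x H p = (\<Sum>i<N. x ^ (r * i) * (c * F ((T ^^ i) z) + G ((T ^^ i) z)))"
    using assms(1) TiY[OF p(2)] by (simp add: p(1) co_def)
  then show ?thesis by (simp add: p(1) co_def distrib_left sum.distrib sum_distrib_left mult_ac)
qed

context field_extension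
begin

text \<open>The Fourier coefficients on flags diagonalise the scalars, with character exponent
  \<open>snd p\<close>. The last clause ties these exponents to the fixed flags, whose number the
  series computes.\<close>

lemma perm_fixed_coordinates:
  assumes E: "finite_subfield E" "range \<iota> \<subseteq> E" "card E = q ^ m" "m \<ge> 1"
    and N: "N = card E - 1" "N > 0"
    and g: "g \<in> E - {0}" "\<And>i. g ^ i = 1 \<longleftrightarrow> N dvd i" "E - {0} = (\<lambda>i. g ^ i) ` {..<N}"
  obtains J :: "('k set list \<times> nat) set" and co where
    "finite J" "coordinates (perm_fixed E \<alpha>) J co"
    "\<And>c f. c \<in> E - {0} \<Longrightarrow> f \<in> carrier (perm_fixed E \<alpha>) \<Longrightarrow> perm_scalar_act c f \<in> carrier (perm_fixed E \<alpha>)"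
    "\<And>c f p. c \<in> E - {0} \<Longrightarrow> f \<in> carrier (perm_fixed E \<alpha>) \<Longrightarrow> p \<in> J \<Longrightarrow>
      co (perm_scalar_act c f) p = c ^ snd p * co f p"
    "\<And>w j. (\<And>i. w ^ i = 1 \<longleftrightarrow> N dvd i) \<Longrightarrow>
      (\<Sum>p\<in>J. (w ^ j) ^ snd p) = complex_of_nat (card {y \<in> flags_of E \<alpha>. scale_flag (g ^ j) y = y})"
proof -
  interpret E: finite_subfield E by fact
  let ?Y = "flags_of E \<alpha>" and ?T = "scale_flag g"
  have gE: "g \<in> E" using g(1) by simp
  have TY: "?T y \<in> ?Y" if "y \<in> ?Y" for y by (rule scale_flags_of[OF E(1) gE that])
  have gN: "g ^ N = 1" using g(2) by simp
  have TN: "(?T ^^ N) y = y" for y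
    unfolding scale_flag_power gN by (simp add: scale_flag_def map_idI)
  obtain R L where RL: "R \<subseteq> ?Y" "\<forall>z\<in>R. L z > 0 \<and> (\<forall>i. (?T ^^ i) z = z \<longleftrightarrow> L z dvd i)"
    "bij_betw (\<lambda>(z, a). (?T ^^ a) z) (SIGMA z:R. {..<L z :: nat}) ?Y"
    using cyclic_decomposition[OF finite_flags_of[OF E.finite_K] TY TN N(2)] by blast
  interpret C: cyclic_action ?T ?Y N R L
    by unfold_locales (use finite_flags_of[OF E.finite_K] TY TN N(2) RL in auto)
  have Nk: "of_nat N \<noteq> (0 :: 'k)"
  proof -
    \<comment> \<open>So \<open>N\<close> is -1 in the large field, where \<open>q\<close>
      vanishes.\<close>
    have "Suc N = q ^ m" using N E(3) E.Q_ge_2 by simp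
    then have "of_nat (Suc N) = (of_nat q :: 'k) ^ m" by (simp only: of_nat_power)
    also have "\<dots> = 0" using E(4) by (simp add: of_nat_q)
    finally show ?thesis by auto
  qed
  let ?W = "perm_fixed E \<alpha>"
  define co where "co f = restrict (C.co g (flag_val E \<alpha> f)) C.J" for f
  have bij: "bij_betw co (carrier ?W) (C.J \<rightarrow>\<^sub>E UNIV)"
    using bij_betw_trans[OF flag_val_bij[OF E(1,2)] C.co_bij[OF g(2) Nk]] by (simp add: co_def[abs_def] comp_def)
  have mem: "f + h \<in> carrier ?W" "Poly_Mapping.map ((*) c) f \<in> carrier ?W"
    if "f \<in> carrier ?W" "h \<in> carrier ?W" for f h c
  proof -
    have "Poly_Mapping.keys (Poly_Mapping.map ((*) c) f) \<subseteq> Poly_Mapping.keys f"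
    proof
      fix v assume "v \<in> Poly_Mapping.keys (Poly_Mapping.map ((*) c) f)"
      then have "c * Poly_Mapping.lookup f v \<noteq> 0" unfolding in_keys_iff lookup_map_times .
      then show "v \<in> Poly_Mapping.keys f" by (metis in_keys_iff mult_zero_right)
    qed
    moreover note f = perm_fixedD[OF E(1,2) that(1)] and h = perm_fixedD[OF E(1,2) that(2)]
    ultimately show "Poly_Mapping.map ((*) c) f \<in> carrier ?W"
      by (intro perm_fixedI[OF E(1,2)]) (blast, metis lookup_map_times f(2))
    have "Poly_Mapping.keys (f + h) \<subseteq> vecs (sum_list \<alpha>) E" using Poly_Mapping.keys_add[of f h] f(1) h(1) by blast
    then show "f + h \<in> carrier ?W"
    proof (rule perm_fixedI[OF E(1,2)])
      fix v w assume vw: "v \<in> vecs (sum_list \<alpha>) E" "w \<in> vecs (sum_list \<alpha>) E" "vflag \<alpha> v = vflag \<alpha> w"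
      show "Poly_Mapping.lookup (f + h) v = Poly_Mapping.lookup (f + h) w"
        by (simp only: lookup_add f(2)[OF vw] h(2)[OF vw])
    qed
  qed
  have zero: "0 \<in> carrier ?W" unfolding perm_fixed_carrier[OF E(1,2)] by simp
  have coord: "coordinates ?W C.J co"
    unfolding coordinates_def perm_fixed_ops
  proof (intro conjI ballI allI)
    show "finite C.J" by (rule C.finite_J)
    show "bij_betw co (carrier ?W) (C.J \<rightarrow>\<^sub>E UNIV)" by (rule bij)
    show "0 \<in> carrier ?W" by (rule zero)
    show "co 0 p = 0" if "p \<in> C.J" for p
      using C.co_linear[of "flag_val E \<alpha> 0" 0 "flag_val E \<alpha> 0" "\<lambda>_. 0" p g] that
      by (auto simp: co_def flag_val_def C.co_def split: prod.splits)
  next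
    fix f h assume fh: "f \<in> carrier ?W" "h \<in> carrier ?W"
    show "f + h \<in> carrier ?W" by (rule mem[OF fh])
    show "co (f + h) p = co f p + co h p" if "p \<in> C.J" for p
      using C.co_linear[of "flag_val E \<alpha> (f + h)" 1 "flag_val E \<alpha> f" "flag_val E \<alpha> h" p g] that
      by (simp add: co_def flag_val_def lookup_add)
  next
    fix c f assume f: "f \<in> carrier ?W"
    show "Poly_Mapping.map ((*) c) f \<in> carrier ?W" by (rule mem[OF f f])
    show "co (Poly_Mapping.map ((*) c) f) p = c * co f p" if "p \<in> C.J" for p
      using C.co_linear[of "flag_val E \<alpha> (Poly_Mapping.map ((*) c) f)" c "flag_val E \<alpha> f" "\<lambda>_. 0" p g] that
      by (auto simp: co_def flag_val_def lookup_map_times C.co_def split: prod.splits)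
  qed
  have act: "perm_scalar_act c f \<in> carrier ?W" if "c \<in> E - {0}" "f \<in> carrier ?W" for c f
    using perm_scalar_act_fixed(1)[OF E(1,2) _ _ that(2)] that(1) by simp
  have actco: "co (perm_scalar_act c f) p = c ^ snd p * co f p"
    if c: "c \<in> E - {0}" and f: "f \<in> carrier ?W" and p: "p \<in> C.J" for c f p
  proof -
    obtain j where j: "c = g ^ j" using c g(3) by auto
    obtain z r where zr: "p = (z, r)" "z \<in> ?Y" using p RL(1) by (auto simp: C.J_def)
    have "C.co g (flag_val E \<alpha> (perm_scalar_act c f)) (z, r) = (g ^ j) ^ r * C.co g (flag_val E \<alpha> f) (z, r)"
    proof (rule C.co_shift_power[OF g(2) zr(2)])
      fix y assume "y \<in> ?Y"
      then show "flag_val E \<alpha> (perm_scalar_act c f) ((?T ^^ j) y) = flag_val E \<alpha> f y"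
        using perm_scalar_act_fixed(2)[OF E(1,2) _ _ f] c by (simp add: scale_flag_power j)
    qed
    then show ?thesis using p by (simp add: co_def zr j)
  qed
  show ?thesis
  proof (rule that[OF C.finite_J coord act actco])
    fix w :: complex and j
    assume w: "\<And>i. w ^ i = 1 \<longleftrightarrow> N dvd i"
    have "(\<Sum>p\<in>C.J. (w ^ j) ^ snd p) = (\<Sum>(z, r)\<in>C.J. (w ^ j) ^ r)" by (simp add: split_def)
    also have "\<dots> = complex_of_nat (card {y \<in> ?Y. (?T ^^ j) y = y})" by (rule C.sum_J_fixed_points[OF w])
    finally show "(\<Sum>p\<in>C.J. (w ^ j) ^ snd p) = complex_of_nat (card {y \<in> ?Y. scale_flag (g ^ j) y = y})"
      by (simp add: scale_flag_power)
  qed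
qed

text \<open>The monomial \<open>\<mu>\<close> carries the character exponent
  \<open>mdeg \<mu>\<close> and the pair \<open>p\<close> the exponent \<open>snd p\<close>. Only
  residues modulo \<open>N\<close> matter, and \<open>eq\<close> shows that these occur equally
  often on both sides.\<close>

lemma trunc_perm_iso:
  assumes n: "sum_list \<alpha> = n" and m: "m \<ge> 1"
    and hilb: "Hilb n (q ^ m) (fixed_module (parabolic \<alpha> :: 'f mat set) trunc_mat_act (trunc_module n (q ^ m)))
      = C_series q \<alpha> m"
    and E: "subfield E (class_ring :: 'k ring)" "card E = q ^ m" "range \<iota> \<subseteq> E"
  shows "group_module_iso (E - {0})
     (fixed_module (map_mat \<iota> ` parabolic \<alpha>) trunc_mat_act (trunc_module n (q ^ m) :: ('k, 'k mpoly set) module))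
     trunc_scalar_act (fixed_module (map_mat \<iota> ` parabolic \<alpha>) perm_mat_act (perm_module n E)) perm_scalar_act"
proof -
  have "card E > 0" using E(2) q_ge_2 by simp
  then have finE: "finite E" by (rule card_ge_0_finite)
  have EF: "finite_subfield E" by (rule subfield_finite_subfield[OF E(1) finE])
  interpret E: finite_subfield E by fact
  define N where "N = card E - 1"
  obtain g where g: "g \<in> E - {0}" "\<And>i. g ^ i = 1 \<longleftrightarrow> N dvd i" "E - {0} = (\<lambda>i. g ^ i) ` {..<N}" "N > 0"
    using finite_subfield_generator[OF E(1) finE] unfolding N_def by metis
  have qm: "q ^ m > 0" using q_ge_2 by simp
  have H: "h \<in> carrier_mat n n \<and> invertible_mat h" if "h \<in> parabolic \<alpha>" for h :: "'f mat"
    using that n by (auto simp: parabolic_def)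
  \<comment> \<open>The identity serves as the embedding when \<open>frobenius_mpoly\<close> is
    applied over the small field.\<close>
  have idh: "field_hom (\<lambda>x :: 'f. x)" by unfold_locales auto
  let ?V = "fixed_module (map_mat \<iota> ` parabolic \<alpha>) trunc_mat_act (trunc_module n (q ^ m) :: ('k, 'k mpoly set) module)"
  obtain I where I: "finite I"
    "\<And>d. vectorspace.dim class_ring (graded_part n (q ^ m)
        (fixed_module (parabolic \<alpha> :: 'f mat set) trunc_mat_act (trunc_module n (q ^ m))) d) = card {\<mu>\<in>I. mdeg \<mu> = d}"
    "coordinates ?V I (\<lambda>X. restrict (cvec n (q ^ m) X) I)"
    "\<And>\<gamma> X. \<gamma> \<noteq> 0 \<Longrightarrow> X \<in> carrier ?V \<Longrightarrow> trunc_scalar_act \<gamma> X \<in> carrier ?V"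
    "\<And>\<gamma> X \<mu>. \<gamma> \<noteq> 0 \<Longrightarrow> X \<in> carrier ?V \<Longrightarrow>
       cvec n (q ^ m) (trunc_scalar_act \<gamma> X) \<mu> = \<gamma> ^ mdeg \<mu> * cvec n (q ^ m) X \<mu>"
    by (rule trunc_fixed_coordinates[OF hom qm H frobenius_mpoly[OF idh card_F] frobenius_mpoly[OF hom card_F]]) blast+
  obtain J :: "('k set list \<times> nat) set" and co where J: "finite J" "coordinates (perm_fixed E \<alpha>) J co"
    "\<And>c f. c \<in> E - {0} \<Longrightarrow> f \<in> carrier (perm_fixed E \<alpha>) \<Longrightarrow> perm_scalar_act c f \<in> carrier (perm_fixed E \<alpha>)"
    "\<And>c f p. c \<in> E - {0} \<Longrightarrow> f \<in> carrier (perm_fixed E \<alpha>) \<Longrightarrow> p \<in> J \<Longrightarrow>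
      co (perm_scalar_act c f) p = c ^ snd p * co f p"
    "\<And>w j. (\<And>i. w ^ i = 1 \<longleftrightarrow> N dvd i) \<Longrightarrow>
      (\<Sum>p\<in>J. (w ^ j) ^ snd p) = complex_of_nat (card {y \<in> flags_of E \<alpha>. scale_flag (g ^ j) y = y})"
    by (rule perm_fixed_coordinates[OF EF E(3,2) m N_def g(4,1,2,3)]) blast+
  obtain w :: complex where w: "\<And>i. w ^ i = 1 \<longleftrightarrow> N dvd i" using complex_primitive_root[OF g(4)] by blast
  define h where "h d = card {\<mu>\<in>I. mdeg \<mu> = d}" for d
  \<comment> \<open>A crude bound on the degrees that occur; it only has to make the series a
    polynomial.\<close>
  define D where "D = (\<Sum>\<mu>\<in>I. mdeg \<mu>)"
  have le_D: "mdeg \<mu> \<le> D" if "\<mu> \<in> I" for \<mu> unfolding D_def by (rule member_le_sum) (use I(1) that in auto)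
  have C: "Abs_fps (\<lambda>k. of_nat (h k)) = C_series q \<alpha> m" using hilb by (simp add: Hilb_def I(2) h_def)
  have h0: "h k = 0" if k: "k > D" for k
  proof -
    have "{\<mu>\<in>I. mdeg \<mu> = k} = {}" using le_D k by fastforce
    then show ?thesis by (simp only: h_def card.empty)
  qed
  have eq: "(\<Sum>\<mu>\<in>I. (w ^ j) ^ mdeg \<mu>) = (\<Sum>p\<in>J. (w ^ j) ^ snd p)" for j
  proof -
    have gj: "g ^ j \<in> E - {0}"
    proof -
      have "g ^ j \<in> E" by (induct j) (use g(1) E.K1 E.K_mult in auto)
      then show ?thesis using g(1) by simp
    qed
    then obtain d where d: "d > 0" "d dvd m" "\<And>l. (g ^ j) ^ (q ^ l) = g ^ j \<longleftrightarrow> d dvd l"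
      and val: "real (card {y \<in> flags_of E \<alpha>. scale_flag (g ^ j) y = y}) =
      (\<Sum>b | length b = length \<alpha> \<and> (\<forall>i<length \<alpha>. d * b ! i \<le> \<alpha> ! i) \<and> d * sum_list b \<le> m. term_value q d m b)"
      using card_fixed_flags[OF EF E(3,2), of "g ^ j" \<alpha>] by auto
    have w0: "w \<noteq> 0"
    proof
      assume "w = 0" moreover have "w ^ N = 1" using w by simp
      ultimately show False using g(4) by (simp add: power_0_left)
    qed
    \<comment> \<open>\<open>w\<close> and \<open>g\<close> have the same order, so equalities
      between powers carry over from the finite field to the complex numbers.\<close>
    have transfer: "w ^ a = w ^ b \<longleftrightarrow> g ^ a = g ^ b" if "b \<le> a" for a b
    proof -
      have "w ^ a = w ^ b * w ^ (a - b)" "g ^ a = g ^ b * g ^ (a - b)" using that by (simp_all flip: power_add)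
      then show ?thesis using w0 g(1) w g(2) by simp
    qed
    have key: "(w ^ j) ^ (q ^ l) = w ^ j \<longleftrightarrow> d dvd l" for l
    proof -
      have "j \<le> j * q ^ l" using q_ge_2 by simp
      then show ?thesis using transfer[of j "j * q ^ l"] d(3)[of l] by (simp add: power_mult)
    qed
    have "(\<Sum>\<mu>\<in>I. (w ^ j) ^ mdeg \<mu>) = (\<Sum>k\<le>D. \<Sum>\<mu>\<in>{\<mu>\<in>I. mdeg \<mu> = k}. (w ^ j) ^ mdeg \<mu>)"
      using I(1) le_D by (intro sum.group[symmetric]) auto
    also have "\<dots> = (\<Sum>k\<le>D. of_nat (h k) * (w ^ j) ^ k)" by (simp add: h_def)
    also have "\<dots> = of_real (real (card {y \<in> flags_of E \<alpha>. scale_flag (g ^ j) y = y}))"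
      unfolding val by (rule C_series_at_root[OF q_ge_2 d(1,2) _ key C h0]) (use w0 in simp)
    also have "\<dots> = (\<Sum>p\<in>J. (w ^ j) ^ snd p)" using J(5)[OF w, of j] by simp
    finally show ?thesis .
  qed
  have "card {\<mu>\<in>I. mdeg \<mu> mod N = r} = card {p\<in>J. snd p mod N = r}" for r
    by (rule residue_counts_eq[OF w g(4) I(1) J(1) eq])
  then obtain \<sigma> where \<sigma>: "bij_betw \<sigma> J I" "\<And>p. p \<in> J \<Longrightarrow> mdeg (\<sigma> p) mod N = snd p mod N"
    using residue_bijection[OF I(1) J(1), of mdeg N snd] by blast
  have "group_module_iso (E - {0}) ?V trunc_scalar_act (perm_fixed E \<alpha>) perm_scalar_act"
  proof (rule group_module_isoI[OF I(3) J(2) _ _ J(3,4) \<sigma>(1)])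
    show "trunc_scalar_act \<gamma> X \<in> carrier ?V" if "\<gamma> \<in> E - {0}" "X \<in> carrier ?V" for \<gamma> X
      using I(4) that by simp
    show "restrict (cvec n (q ^ m) (trunc_scalar_act \<gamma> X)) I \<mu> = \<gamma> ^ mdeg \<mu> * restrict (cvec n (q ^ m) X) I \<mu>"
      if "\<gamma> \<in> E - {0}" "X \<in> carrier ?V" "\<mu> \<in> I" for \<gamma> X \<mu>
      using I(5) that by simp
    fix p \<gamma> assume p: "p \<in> J" and \<gamma>: "\<gamma> \<in> E - {0}"
    obtain i where "\<gamma> = g ^ i" using \<gamma> g(3) by auto
    then have "\<gamma> ^ N = 1" using g(2)[of "i * N"] by (simp add: power_mult)
    \<comment> \<open>Exponents that agree modulo \<open>N\<close> give the same character on
      \<open>E - {0}\<close>.\<close>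
    from power_mod_card[OF this, of "snd p"] power_mod_card[OF this, of "mdeg (\<sigma> p)"]
    show "\<gamma> ^ snd p = \<gamma> ^ mdeg (\<sigma> p)" using \<sigma>(2)[OF p] by simp
  qed
  then show ?thesis using n by simp
qed

end

theorem proposition6:
  fixes q n :: nat and \<iota> :: "'f::{field,finite} \<Rightarrow> 'k::field"
  assumes q: "card (UNIV :: 'f set) = q"
    and n: "n \<ge> 1"
    and parabolic_hilb:
      "\<forall>\<alpha> m. composition n \<alpha> \<longrightarrow>
         Hilb n (q ^ m)
           (fixed_module (parabolic \<alpha> :: 'f mat set) trunc_mat_act (trunc_module n (q ^ m)))
         = C_series q \<alpha> m"
    and hom: "field_hom \<iota>"
  shows "\<forall>\<alpha> m E. composition n \<alpha> \<and> m \<ge> 1 \<and>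
           subfield E (class_ring :: 'k ring) \<and> card E = q ^ m \<and> range \<iota> \<subseteq> E \<longrightarrow>
         group_module_iso (E - {0})
           (fixed_module (map_mat \<iota> ` parabolic \<alpha>) trunc_mat_act
              (trunc_module n (q ^ m) :: ('k, 'k mpoly set) module))
           trunc_scalar_act
           (fixed_module (map_mat \<iota> ` parabolic \<alpha>) perm_mat_act (perm_module n E))
           perm_scalar_act"
proof (intro allI impI)
  fix \<alpha> m and E :: "'k set"
  assume a: "composition n \<alpha> \<and> m \<ge> 1 \<and>
           subfield E (class_ring :: 'k ring) \<and> card E = q ^ m \<and> range \<iota> \<subseteq> E"
  interpret field_extension \<iota> by (rule field_extension.intro[OF hom])
  have qF: "card (range \<iota>) = q" using card_F q by simp
  have s: "sum_list \<alpha> = n" using a by (simp add: composition_def)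
  have h: "Hilb n (q ^ m) (fixed_module (parabolic \<alpha> :: 'f mat set) trunc_mat_act (trunc_module n (q ^ m)))
      = C_series q \<alpha> m" using parabolic_hilb a by blast
  show "group_module_iso (E - {0})
           (fixed_module (map_mat \<iota> ` parabolic \<alpha>) trunc_mat_act
              (trunc_module n (q ^ m) :: ('k, 'k mpoly set) module))
           trunc_scalar_act
           (fixed_module (map_mat \<iota> ` parabolic \<alpha>) perm_mat_act (perm_module n E))
           perm_scalar_act"
    using trunc_perm_iso[OF s, of m E, unfolded qF] h a by blast
qed

end
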